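(* Let $G$ be a finite simple graph on the vertex set $[n]=\{1,\dots,n\}$ with at least one edge, let $\mathrm{k}$ be a field, and let $I(G)\subseteq S=\mathrm{k}[x_1,\dots,x_n]$ be its edge ideal. Then $I(G)^2$ has a linear free resolution over $S$ if and only if $G$ is gap-free and $\operatorname{reg} I(G)\le 3$.
   Context: $S=\mathrm{k}[x_1,\dots,x_n]$ is standard graded with maximal homogeneous ideal $\mathfrak m=(x_1,\dots,x_n)$. The edge ideal is $I(G)=(x_ix_j \mid \{i,j\}\in E(G))\subseteq S$. A gap in $G$ is a pair of disjoint edges forming an induced subgraph of $G$ (i.e. edges $\{a,b\},\{c,d\}$ on four distinct vertices with no other edge of $G$ among $a,b,c,d$); $G$ is gap-free if it has no gaps. For a finitely generated graded $S$-module $L$, $\operatorname{reg}(L)=\max\{i+j\mid H^i_{\mathfrak m}(L)_j\neq 0\}$ is the Castelnuovo-Mumford regularity; for a nonzero proper homogeneous ideal $J$, $\operatorname{reg}(J)=\operatorname{reg}(S/J)+1$. For $s\ge 1$, $I(G)^s$ is generated in degree $2s$, and it has a linear (free) resolution if and only if $\operatorname{reg} I(G)^s=2s$. *)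

theory Defs
  imports Complex_Main "HOL-Library.Poly_Mapping"
begin

text \<open>
  The set $[n]$ is rendered as a finite linearly ordered type \<open>'v\<close> with $n = $ \<open>CARD('v)\<close>.
  The polynomial ring $S$ over \<open>'k\<close> in the variables \<open>'v\<close> is the type \<open>('v, 'k) mpol\<close>;
  its exponent vectors are the elements of \<open>'v \<Rightarrow>\<^sub>0 nat\<close>.
  Laurent polynomials serve as a common overring for all the localisations of ideals of $S$
  at products of variables.
\<close>

type_synonym ('v, 'k) mpol = "('v \<Rightarrow>\<^sub>0 nat) \<Rightarrow>\<^sub>0 'k"
type_synonym ('v, 'k) laurent = "('v \<Rightarrow>\<^sub>0 int) \<Rightarrow>\<^sub>0 'k"

definition var :: "'v \<Rightarrow> ('v, 'k::field) mpol" where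
  "var v = Poly_Mapping.single (Poly_Mapping.single v 1) 1"

definition to_laurent :: "('v, 'k::field) mpol \<Rightarrow> ('v, 'k) laurent" where
  "to_laurent p = (\<Sum>m\<in>Poly_Mapping.keys p.
     Poly_Mapping.single (Poly_Mapping.map int m) (Poly_Mapping.lookup p m))"

text \<open>Zero is homogeneous of every degree, and it is the only polynomial in $S$ that is
  homogeneous of a negative degree.\<close>

definition homogeneous :: "int \<Rightarrow> ('v::finite, 'k::field) laurent \<Rightarrow> bool" where
  "homogeneous d f \<longleftrightarrow>
     (\<forall>m\<in>Poly_Mapping.keys f. (\<Sum>v\<in>UNIV. Poly_Mapping.lookup m v) = d)"


subsection \<open>Ideals\<close>

lemma module_times: "module ((*) :: 'a::comm_ring_1 \<Rightarrow> 'a \<Rightarrow> 'a)"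
  by unfold_locales (simp_all add: algebra_simps)

definition ideal_gen :: "'a::comm_ring_1 set \<Rightarrow> 'a set" where
  "ideal_gen X = module.span (*) X"

definition ideal_mult :: "'a::comm_ring_1 set \<Rightarrow> 'a set \<Rightarrow> 'a set" where
  "ideal_mult I J = ideal_gen {f * g | f g. f \<in> I \<and> g \<in> J}"

primrec ideal_power :: "'a::comm_ring_1 set \<Rightarrow> nat \<Rightarrow> 'a set" where
  "ideal_power I 0 = UNIV"
| "ideal_power I (Suc s) = ideal_mult I (ideal_power I s)"


subsection \<open>Graphs and edge ideals\<close>

definition simple_graph :: "'v set set \<Rightarrow> bool" where
  "simple_graph E \<longleftrightarrow> (\<forall>e\<in>E. card e = 2)"

definition is_gap :: "'v set set \<Rightarrow> 'v set \<Rightarrow> 'v set \<Rightarrow> bool" where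
  "is_gap E e f \<longleftrightarrow>
     e \<in> E \<and> f \<in> E \<and> e \<inter> f = {} \<and> {g \<in> E. g \<subseteq> e \<union> f} = {e, f}"

definition gap_free :: "'v set set \<Rightarrow> bool" where
  "gap_free E \<longleftrightarrow> (\<nexists>e f. is_gap E e f)"

definition edge_ideal :: "'v set set \<Rightarrow> ('v, 'k::field) mpol set" where
  "edge_ideal E = ideal_gen {var i * var j | i j. {i, j} \<in> E}"


subsection \<open>Graded free resolutions\<close>

text \<open>The free module of rank \<open>b\<close> consists of the vectors indexed by \<open>{..<b}\<close>, extended by
  zero.\<close>

definition free_mod :: "nat \<Rightarrow> (nat \<Rightarrow> 'a::comm_ring_1) set" where
  "free_mod b = {u. \<forall>r\<ge>b. u r = 0}"

definition mat_apply ::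
  "nat \<Rightarrow> nat \<Rightarrow> (nat \<Rightarrow> nat \<Rightarrow> 'a::comm_ring_1) \<Rightarrow> (nat \<Rightarrow> 'a) \<Rightarrow> nat \<Rightarrow> 'a" where
  "mat_apply b b' A u = (\<lambda>r. if r < b' then \<Sum>c<b. A r c * u c else 0)"

text \<open>
  A graded free resolution
  $\cdots \to F_2 \to F_1 \to F_0 \to J \to 0$ of an ideal $J$ of $S$, where
  $F_i = \bigoplus_{c < \beta_i} S(-\delta_{i,c})$. The row vector \<open>\<epsilon>\<close> is the augmentation
  $F_0 \to J$, and the matrix \<open>\<phi> i\<close> is the differential $F_{i+1} \to F_i$. Its \<open>(r, c)\<close>
  entry has degree $\delta_{i+1,c} - \delta_{i,r}$, so that all the maps have degree 0.
\<close>

definition graded_free_resolution ::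
  "('v::finite, 'k::field) mpol set \<Rightarrow> (nat \<Rightarrow> nat) \<Rightarrow> (nat \<Rightarrow> nat \<Rightarrow> int) \<Rightarrow>
   (nat \<Rightarrow> ('v, 'k) mpol) \<Rightarrow> (nat \<Rightarrow> nat \<Rightarrow> nat \<Rightarrow> ('v, 'k) mpol) \<Rightarrow> bool" where
  "graded_free_resolution J \<beta> \<delta> \<epsilon> \<phi> \<longleftrightarrow>
     (\<forall>c<\<beta> 0. homogeneous (\<delta> 0 c) (to_laurent (\<epsilon> c))) \<and>
     (\<forall>i. \<forall>r<\<beta> i. \<forall>c<\<beta> (Suc i).
        homogeneous (\<delta> (Suc i) c - \<delta> i r) (to_laurent (\<phi> i r c))) \<and>
     (\<lambda>u. \<Sum>c<\<beta> 0. \<epsilon> c * u c) ` free_mod (\<beta> 0) = J \<and>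
     {u \<in> free_mod (\<beta> 0). (\<Sum>c<\<beta> 0. \<epsilon> c * u c) = 0}
       = mat_apply (\<beta> 1) (\<beta> 0) (\<phi> 0) ` free_mod (\<beta> 1) \<and>
     (\<forall>i. {u \<in> free_mod (\<beta> (Suc i)). mat_apply (\<beta> (Suc i)) (\<beta> i) (\<phi> i) u = (\<lambda>_. 0)}
       = mat_apply (\<beta> (Suc (Suc i))) (\<beta> (Suc i)) (\<phi> (Suc i)) ` free_mod (\<beta> (Suc (Suc i))))"

text \<open>
  Linearity means $F_i = S(-d-i)^{\beta_i}$ for some $d$ and all $i$. The entries of all the
  differentials are then linear forms, so such a resolution is automatically minimal.
\<close>

definition has_linear_resolution :: "('v::finite, 'k::field) mpol set \<Rightarrow> bool" where
  "has_linear_resolution J \<longleftrightarrow>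
     (\<exists>d \<beta> \<epsilon> \<phi>. graded_free_resolution J \<beta> (\<lambda>i c. d + int i) \<epsilon> \<phi>)"


subsection \<open>Local cohomology and regularity of an ideal\<close>

text \<open>
  The localisation $J_{x_F}$ at $x_F = \prod_{v \in F} x_v$, consisting of the fractions
  $g / x_F^t$ with $g \in J$.
\<close>

definition localisation ::
  "('v, 'k::field) mpol set \<Rightarrow> 'v set \<Rightarrow> ('v, 'k) laurent set" where
  "localisation J F =
     {to_laurent g * Poly_Mapping.single (\<Sum>v\<in>F. Poly_Mapping.single v (- int t)) 1
       | g t. g \<in> J}"

text \<open>
  The module $H^i_{\mathfrak m}(J)_j$ is computed as the $i$-th cohomology of the degree \<open>j\<close>
  part of the Cech complex of $J$ on the variables, whose $i$-th term is
  $\bigoplus_{|F| = i} J_{x_F}$. The cohomological degree \<open>i\<close> is an integer, and the term in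
  degree $-1$ is zero.
\<close>

definition cech_cochains ::
  "('v::finite, 'k::field) mpol set \<Rightarrow> int \<Rightarrow> int \<Rightarrow> ('v set \<Rightarrow> ('v, 'k) laurent) set" where
  "cech_cochains J i j =
     {c. \<forall>F. c F \<in> localisation J F \<and> homogeneous j (c F) \<and> (int (card F) \<noteq> i \<longrightarrow> c F = 0)}"

definition cech_diff ::
  "('v::{finite,linorder} set \<Rightarrow> ('v, 'k::field) laurent) \<Rightarrow> 'v set \<Rightarrow> ('v, 'k) laurent" where
  "cech_diff c F = (\<Sum>v\<in>F. (- 1) ^ card {w \<in> F. w < v} * c (F - {v}))"

definition cocycles ::
  "('v::{finite,linorder}, 'k::field) mpol set \<Rightarrow> int \<Rightarrow> int \<Rightarrow> ('v set \<Rightarrow> ('v, 'k) laurent) set"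
  where "cocycles J i j = {c \<in> cech_cochains J i j. cech_diff c = (\<lambda>_. 0)}"

definition coboundaries ::
  "('v::{finite,linorder}, 'k::field) mpol set \<Rightarrow> int \<Rightarrow> int \<Rightarrow> ('v set \<Rightarrow> ('v, 'k) laurent) set"
  where "coboundaries J i j = cech_diff ` cech_cochains J (i - 1) j"

definition local_cohomology ::
  "('v::{finite,linorder}, 'k::field) mpol set \<Rightarrow> int \<Rightarrow> int \<Rightarrow>
   ('v set \<Rightarrow> ('v, 'k) laurent) set set"
  where "local_cohomology J i j =
    cocycles J i j // {(c, c'). (\<lambda>F. c F - c' F) \<in> coboundaries J i j}"

text \<open>The zero element of the quotient is the class \<open>coboundaries J i j\<close>.\<close>

definition regularity :: "('v::{finite,linorder}, 'k::field) mpol set \<Rightarrow> int" where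
  "regularity J =
     (GREATEST r. \<exists>i j. r = i + j \<and> local_cohomology J i j \<noteq> {coboundaries J i j})"

end

theory Submission
  imports Defs "HOL-Library.Function_Algebras"
begin

text \<open>
  Everything is read off multidegree by multidegree. In multidegree \<open>a\<close> the Cech complex of a
  monomial ideal \<open>J\<close> is the cochain complex of the up-set of all \<open>F\<close> with $x^a \in J_{x_F}$, and its
  cohomology vanishes when that up-set is a cone, or is glued from cones.

  If $a$ has an exponent at least 2, the up-set of $I(G)^2$ is a cone. If the positive part of $a$ is
  the product of a set $S$ of variables, then for $|S| \le 1$ it is an up-set of $I(G)$ itself; for
  larger $S$ it is a cone, splits into two cones along the neighbourhoods of two vertices of $S$, or
  ($S$ a triangle) is the complement of a simplex; gap-freeness makes that complex, and the
  intersection in the second case when $S$ is an edge, a simplex. So, granted gap-freeness,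
  $H^i(I(G)^2)_j = 0$ for all $i + j > 4$ if and only if $H^i(I(G))_j = 0$ for all $i + j > 3$.

  That the vanishing of $H^i(J)_j$ for $i + j > d$ is equivalent to a $d$-linear resolution, for $J$
  generated in degree at least $d$, is dimension shifting together with Mumford's argument that the
  lowest degree then generates; the latter is a chase in the double complex of Koszul and Cech
  complexes. Finally, for a gap $e$, $f$, the functional "coefficient of $x_e^2$" on the generators
  kills the part of every linear syzygy along the variables of $f$, but not
  the syzygy $x_f^2 [x_e^2] - x_e^2 [x_f^2]$.
\<close>

subsection \<open>Cochains on families of sets\<close>

text \<open>The thresholds 4 and 5 differ by one because of a single variable. If the positive part
  of \<open>a\<close> is one variable \<open>u\<close>, the strand of the square at \<open>a\<close>
  is the strand of the ideal at \<open>a\<close> with the entry at \<open>u\<close> lowered to 0, so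
  i + j drops by one. Conversely some zero entry has to be raised to 1; if all entries are negative
  there is none, but then only the set of all variables can occur, and the bound on i + j puts i
  above its cardinality n.

  A given linear resolution is graded by total degree only, so its syzygy modules need not split
  into multidegrees. Multidegrees are therefore used for free modules and monomial ideals alone.
  Syzygies are treated as submodules of free modules inside the Laurent ring, given together with
  all their localisations, and cohomology is carried through short exact sequences. The resolution
  may also be infinite: each shift raises i by one, and since the Cech complex stops at n this takes
  the place of a bound on the length.\<close>

definition sg :: "'v::linorder \<Rightarrow> 'v set \<Rightarrow> 'a::comm_ring_1" where
  "sg v F = (- 1) ^ card {w \<in> F. w < v}"

definition cdiff :: "('v::{finite,linorder} set \<Rightarrow> 'a::comm_ring_1) \<Rightarrow> 'v set \<Rightarrow> 'a" where
  "cdiff c F = (\<Sum>v\<in>F. sg v F * c (F - {v}))"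

lemma cech_diff_eq_cdiff: "cech_diff c = cdiff c"
  by (simp add: fun_eq_iff cech_diff_def cdiff_def sg_def)

lemma sg_sq [simp]: "sg v F * sg v F = 1"
  by (simp add: sg_def flip: power_mult_distrib)

lemma sg_sq_left [simp]: "sg v F * (sg v F * x) = x"
  by (simp flip: mult.assoc)

text \<open>The sign counts strictly smaller elements and is defined for \<open>v\<close> outside
  \<open>F\<close> too. Removing \<open>v\<close> (Cech) and inserting \<open>v\<close> (cone
  homotopy, Koszul) thus use the same sign.\<close>

lemma sg_insert_self [simp]: "sg v (insert v F) = sg v F"
proof -
  have "{w \<in> insert v F. w < v} = {w \<in> F. w < v}" by auto
  then show ?thesis by (simp add: sg_def)
qed

lemma sg_remove_self [simp]: "sg v (F - {v}) = sg v F"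
proof -
  have "{w \<in> F - {v}. w < v} = {w \<in> F. w < v}" by auto
  then show ?thesis by (simp add: sg_def)
qed

lemma sg_empty [simp]: "sg v {} = 1"
  by (simp add: sg_def)

lemma sg_insert_less:
  fixes F :: "'v::{finite,linorder} set"
  assumes "v < w" "v \<notin> F"
  shows "sg w (insert v F) = - sg w F"
proof -
  have "{x \<in> insert v F. x < w} = insert v {x \<in> F. x < w}" using assms by auto
  then show ?thesis using assms by (simp add: sg_def)
qed

lemma sg_insert_greater:
  assumes "v < w"
  shows "sg v (insert w F) = sg v F"
proof -
  have "{x \<in> insert w F. x < v} = {x \<in> F. x < v}" using assms by auto
  then show ?thesis by (simp add: sg_def)
qed

text \<open>Only the larger of \<open>v\<close> and \<open>w\<close> sees the other one below it, so
  exactly one of the four signs flips.\<close>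

lemma sg_swap_insert:
  fixes F :: "'v::{finite,linorder} set"
  assumes "v \<noteq> w" "v \<notin> F" "w \<notin> F"
  shows "sg v F * sg w (insert v F) = - (sg w F * sg v (insert w F) :: 'a::comm_ring_1)"
proof (cases "v < w")
  case True
  then show ?thesis using assms by (simp add: sg_insert_less sg_insert_greater)
next
  case False
  then have "w < v" using assms by auto
  then show ?thesis using assms by (simp add: sg_insert_less sg_insert_greater)
qed

text \<open>The sum is split into ordered pairs and cancelled. Deducing that it equals its own
  negative would not suffice in the presence of 2-torsion.\<close>

lemma sum_antisym_zero:
  fixes g :: "'v::linorder \<Rightarrow> 'v \<Rightarrow> 'a::ab_group_add"
  assumes fin: "finite A"
    and anti: "\<And>v w. v \<in> A \<Longrightarrow> w \<in> A \<Longrightarrow> v \<noteq> w \<Longrightarrow> g v w = - g w v"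
  shows "(\<Sum>v\<in>A. \<Sum>w\<in>A - {v}. g v w) = 0"
proof -
  have "(\<Sum>v\<in>A. \<Sum>w\<in>A - {v}. g v w)
      = (\<Sum>v\<in>A. (\<Sum>w\<in>{w \<in> A. v < w}. g v w) + (\<Sum>w\<in>{w \<in> A. w < v}. g v w))"
  proof (rule sum.cong[OF refl])
    fix v
    have *: "A - {v} = {w \<in> A. v < w} \<union> {w \<in> A. w < v}" by auto
    show "(\<Sum>w\<in>A - {v}. g v w)
        = (\<Sum>w\<in>{w \<in> A. v < w}. g v w) + (\<Sum>w\<in>{w \<in> A. w < v}. g v w)"
      unfolding * by (rule sum.union_disjoint) (use fin in auto)
  qed
  also have "\<dots> = (\<Sum>v\<in>A. \<Sum>w\<in>{w \<in> A. v < w}. g v w) + (\<Sum>v\<in>A. \<Sum>w\<in>{w \<in> A. w < v}. g v w)"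
    by (rule sum.distrib)
  also have "(\<Sum>v\<in>A. \<Sum>w\<in>{w \<in> A. w < v}. g v w) = (\<Sum>w\<in>A. \<Sum>v\<in>{v \<in> A. w < v}. g v w)"
    by (rule sum.swap_restrict[OF fin fin])
  also have "\<dots> = (\<Sum>w\<in>A. \<Sum>v\<in>{v \<in> A. w < v}. - g w v)"
    by (intro sum.cong refl) (auto intro!: anti)
  also have "\<dots> = - (\<Sum>v\<in>A. \<Sum>w\<in>{w \<in> A. v < w}. g v w)"
    by (simp add: sum_negf)
  finally show ?thesis by simp
qed

lemma cdiff_zero [simp]: "cdiff (\<lambda>_. 0) F = 0"
  by (simp add: cdiff_def)

lemma cdiff_add: "cdiff (\<lambda>F. c F + c' F) F = cdiff c F + cdiff c' F"
  by (simp add: cdiff_def algebra_simps sum.distrib)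

lemma cdiff_diff: "cdiff (\<lambda>F. c F - c' F) F = cdiff c F - cdiff c' F"
  by (simp add: cdiff_def algebra_simps sum_subtractf)

lemma cdiff_mult: "cdiff (\<lambda>F. x * c F) F = x * cdiff c F"
  by (simp add: cdiff_def sum_distrib_left mult.left_commute)

lemma cdiff_sum: "cdiff (\<lambda>F. \<Sum>i\<in>I. c i F) F = (\<Sum>i\<in>I. cdiff (c i) F)"
proof -
  have "cdiff (\<lambda>F. \<Sum>i\<in>I. c i F) F = (\<Sum>v\<in>F. \<Sum>i\<in>I. sg v F * c i (F - {v}))"
    by (simp add: cdiff_def sum_distrib_left)
  also have "\<dots> = (\<Sum>i\<in>I. cdiff (c i) F)"
    unfolding cdiff_def by (rule sum.swap)
  finally show ?thesis .
qed

lemma cdiff_cdiff [simp]: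
  fixes c :: "'v::{finite,linorder} set \<Rightarrow> 'a::comm_ring_1"
  shows "cdiff (cdiff c) F = 0"
proof -
  have "cdiff (cdiff c) F
      = (\<Sum>v\<in>F. \<Sum>w\<in>F - {v}. sg v F * sg w (F - {v}) * c (F - {v} - {w}))"
    by (simp add: cdiff_def sum_distrib_left mult.assoc)
  also have "\<dots> = 0"
  proof (rule sum_antisym_zero)
    fix v w assume vw: "v \<in> F" "w \<in> F" "v \<noteq> w"
    define G where "G = F - {v} - {w}"
    have G: "F - {v} = insert w G" "F - {w} = insert v G" "v \<notin> G" "w \<notin> G"
      using vw by (auto simp: G_def)
    have "sg v F = (sg v (insert w G) :: 'a)" "sg w F = (sg w (insert v G) :: 'a)"
      by (simp_all flip: G(1,2))
    then have "sg v F * sg w (F - {v}) = - (sg w F * sg v (F - {w}) :: 'a)"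
      using sg_swap_insert[OF vw(3) G(3,4), where 'a = 'a] by (simp add: G mult.commute)
    moreover have "F - {v} - {w} = F - {w} - {v}" by auto
    ultimately show "sg v F * sg w (F - {v}) * c (F - {v} - {w})
        = - (sg w F * sg v (F - {w}) * c (F - {w} - {v}))"
      by simp
  qed simp
  finally show ?thesis .
qed

text \<open>The contracting homotopy of a cone with apex \<open>v\<close>. If \<open>v\<close> lies
  in \<open>F\<close>, only the summand that removes \<open>v\<close> survives; otherwise the claim
  is the cocycle condition at \<open>insert v F\<close>, solved for \<open>c F\<close>.\<close>

lemma cdiff_cone:
  fixes c :: "'v::{finite,linorder} set \<Rightarrow> 'a::comm_ring_1"
  assumes "\<And>F. cdiff c F = 0"
  shows "cdiff (\<lambda>F. if v \<in> F then 0 else sg v F * c (insert v F)) F = c F"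
proof (cases "v \<in> F")
  case True
  have "cdiff (\<lambda>F. if v \<in> F then 0 else sg v F * c (insert v F)) F
      = (\<Sum>w\<in>F. if w = v then sg v F * (sg v F * c F) else 0)"
    unfolding cdiff_def
  proof (rule sum.cong[OF refl])
    fix w
    assume "w \<in> F"
    have "insert v (F - {v}) = F" using True by blast
    then show "sg w F * (if v \<in> F - {w} then 0 else sg v (F - {w}) * c (insert v (F - {w})))
        = (if w = v then sg v F * (sg v F * c F) else 0)"
      using True by (cases "w = v") simp_all
  qed
  also have "\<dots> = c F" using True by simp
  finally show ?thesis .
next
  case False
  have "0 = cdiff c (insert v F)" using assms by simp
  also have "\<dots> = sg v F * c F + (\<Sum>w\<in>F. sg w (insert v F) * c (insert v F - {w}))"
    using False by (simp add: cdiff_def)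
  finally have eq: "sg v F * c F = - (\<Sum>w\<in>F. sg w (insert v F) * c (insert v F - {w}))"
    by (simp add: eq_neg_iff_add_eq_0)
  have "c F = sg v F * (sg v F * c F)" by simp
  also have "\<dots> = (\<Sum>w\<in>F. - sg v F * sg w (insert v F) * c (insert v F - {w}))"
    unfolding eq by (simp add: sum_distrib_left sum_negf mult.assoc)
  also have "\<dots> = (\<Sum>w\<in>F. sg w F * (sg v (F - {w}) * c (insert v (F - {w}))))"
  proof (rule sum.cong[OF refl])
    fix w assume w: "w \<in> F"
    define G where "G = F - {w}"
    have G: "F = insert w G" "w \<notin> G" "v \<notin> G" "v \<noteq> w" using w False by (auto simp: G_def)
    have *: "sg v G * sg w (insert v G) = - (sg w G * sg v (insert w G) :: 'a)"
      by (rule sg_swap_insert) (use G in auto)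
    have "- sg v F * sg w (insert v F) = (- sg v (insert w G) * sg w (insert v G) :: 'a)"
      using G(4) by (simp add: G(1) insert_commute[of v w])
    also have "\<dots> = sg w G * sg v G"
    proof -
      have "sg v G * sg w (insert v G) * (sg v G * sg v (insert w G))
          = - (sg w G * sg v (insert w G)) * (sg v G * sg v (insert w G) :: 'a)"
        using * by simp
      also have "\<dots> = - (sg w G * sg v G) * (sg v (insert w G) * sg v (insert w G))"
        by (simp add: algebra_simps)
      finally have "(sg v G * sg v G) * (sg w (insert v G) * sg v (insert w G))
          = - (sg w G * sg v G :: 'a)"
        by (simp add: algebra_simps)
      then show ?thesis by (simp add: mult.commute)
    qed
    also have "\<dots> = sg w F * sg v (F - {w})"
      using G by simp
    finally have "- sg v F * sg w (insert v F) = (sg w F * sg v (F - {w}) :: 'a)" .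
    moreover have "insert v F - {w} = insert v (F - {w})" using G by auto
    ultimately show "- sg v F * sg w (insert v F) * c (insert v F - {w})
        = sg w F * (sg v (F - {w}) * c (insert v (F - {w})))"
      by (simp add: mult.assoc)
  qed
  also have "\<dots> = cdiff (\<lambda>F. if v \<in> F then 0 else sg v F * c (insert v F)) F"
    unfolding cdiff_def by (rule sum.cong) (use False in auto)
  finally show ?thesis by simp
qed

definition cochain :: "'v set set \<Rightarrow> int \<Rightarrow> ('v set \<Rightarrow> 'k::zero) \<Rightarrow> bool" where
  "cochain U i c \<longleftrightarrow> (\<forall>F. c F \<noteq> 0 \<longrightarrow> F \<in> U \<and> int (card F) = i)"

text \<open>For an up-set \<open>U\<close> these are the relative cochains of the full simplex
  modulo the complex of the sets outside \<open>U\<close>, indexed by cardinality instead of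
  dimension.\<close>

definition acyclic_at :: "'k::comm_ring_1 itself \<Rightarrow> 'v::{finite,linorder} set set \<Rightarrow> int \<Rightarrow> bool" where
  "acyclic_at k U i \<longleftrightarrow>
     (\<forall>c::'v set \<Rightarrow> 'k. cochain U i c \<longrightarrow> (\<forall>F. cdiff c F = 0) \<longrightarrow>
        (\<exists>b. cochain U (i - 1) b \<and> (\<forall>F. cdiff b F = c F)))"

lemma cochain_cdiff:
  assumes "cochain U i c" "\<And>v F. F \<in> U \<Longrightarrow> insert v F \<in> U"
  shows "cochain U (i + 1) (cdiff c)"
  unfolding cochain_def
proof (intro allI impI)
  fix F assume "cdiff c F \<noteq> 0"
  then obtain v where v: "v \<in> F" "c (F - {v}) \<noteq> 0"
    unfolding cdiff_def by (metis (no_types, lifting) mult_zero_right sum.neutral)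
  then have "F - {v} \<in> U" "int (card (F - {v})) = i" using assms(1) by (auto simp: cochain_def)
  then show "F \<in> U \<and> int (card F) = i + 1"
    using v(1) assms(2)[of "F - {v}" v] card_Suc_Diff1[of F v] by (auto simp: insert_absorb)
qed

lemma acyclic_atE:
  fixes c :: "'v::{finite,linorder} set \<Rightarrow> 'k::comm_ring_1"
  assumes "acyclic_at TYPE('k) U i" "cochain U i c" "\<And>F. cdiff c F = 0"
  obtains b where "cochain U (i - 1) b" "\<And>F. cdiff b F = c F"
  using assms unfolding acyclic_at_def by blast

lemma acyclic_at_cong:
  assumes "\<And>F. int (card F) = i \<Longrightarrow> F \<in> U \<longleftrightarrow> F \<in> U'"
    and "\<And>F. int (card F) = i - 1 \<Longrightarrow> F \<in> U \<longleftrightarrow> F \<in> U'"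
  shows "acyclic_at TYPE('k::comm_ring_1) U i \<longleftrightarrow> acyclic_at TYPE('k) U' i"
proof -
  have "cochain U i c \<longleftrightarrow> cochain U' i c" "cochain U (i - 1) c \<longleftrightarrow> cochain U' (i - 1) c"
    for c :: "'a set \<Rightarrow> 'k"
    using assms by (auto simp: cochain_def)
  then show ?thesis by (simp add: acyclic_at_def)
qed

lemma acyclic_at_large:
  assumes "\<And>F. F \<in> U \<Longrightarrow> int (card F) \<noteq> i"
  shows "acyclic_at TYPE('k::comm_ring_1) U i"
  unfolding acyclic_at_def
proof (intro allI impI)
  fix c :: "'a set \<Rightarrow> 'k"
  assume "cochain U i c"
  with assms have "c = (\<lambda>_. 0)" by (auto simp: cochain_def fun_eq_iff)
  then show "\<exists>b. cochain U (i - 1) b \<and> (\<forall>F. cdiff b F = c F)"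
    by (intro exI[of _ "\<lambda>_. 0"]) (simp add: cochain_def)
qed

lemma acyclic_at_empty: "acyclic_at TYPE('k::comm_ring_1) {} i"
  by (rule acyclic_at_large) simp

text \<open>The homotopy at \<open>F\<close> reads the cocycle at \<open>insert v F\<close>, so
  closure under removing \<open>v\<close> keeps its support inside \<open>U\<close>.\<close>

lemma acyclic_at_cone:
  assumes "\<And>F. v \<notin> F \<Longrightarrow> insert v F \<in> U \<Longrightarrow> F \<in> U"
  shows "acyclic_at TYPE('k::comm_ring_1) U i"
  unfolding acyclic_at_def
proof (intro allI impI)
  fix c :: "'a set \<Rightarrow> 'k"
  assume c: "cochain U i c" "\<forall>F. cdiff c F = 0"
  let ?b = "\<lambda>F. if v \<in> F then 0 else sg v F * c (insert v F)"
  have "cochain U (i - 1) ?b"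
    unfolding cochain_def
  proof (intro allI impI)
    fix F assume "?b F \<noteq> 0"
    then have "v \<notin> F" "c (insert v F) \<noteq> 0" by (auto split: if_splits)
    then show "F \<in> U \<and> int (card F) = i - 1"
      using c(1) assms unfolding cochain_def by fastforce
  qed
  moreover have "cdiff ?b F = c F" for F
    by (rule cdiff_cone) (use c in auto)
  ultimately show "\<exists>b. cochain U (i - 1) b \<and> (\<forall>F. cdiff b F = c F)"
    by blast
qed

text \<open>Mayer-Vietoris: primitives of a cocycle on \<open>U1\<close> and on \<open>U2\<close>
  differ by a cocycle on the union, one degree lower.\<close>

lemma acyclic_at_Int:
  assumes up: "\<And>v F. F \<in> U1 \<Longrightarrow> insert v F \<in> U1" "\<And>v F. F \<in> U2 \<Longrightarrow> insert v F \<in> U2"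
    and 1: "acyclic_at TYPE('k::comm_ring_1) U1 i"
    and 2: "acyclic_at TYPE('k) U2 i" and 12: "acyclic_at TYPE('k) (U1 \<union> U2) (i - 1)"
  shows "acyclic_at TYPE('k) (U1 \<inter> U2) i"
  unfolding acyclic_at_def
proof (intro allI impI)
  fix c :: "'a set \<Rightarrow> 'k"
  assume c: "cochain (U1 \<inter> U2) i c" and "\<forall>F. cdiff c F = 0"
  then have c0: "\<And>F. cdiff c F = 0" by blast
  from c have c1: "cochain U1 i c" and c2: "cochain U2 i c" by (auto simp: cochain_def)
  obtain b1 where b1: "cochain U1 (i - 1) b1" "\<And>F. cdiff b1 F = c F"
    using acyclic_atE[OF 1 c1 c0] by blast
  obtain b2 where b2: "cochain U2 (i - 1) b2" "\<And>F. cdiff b2 F = c F"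
    using acyclic_atE[OF 2 c2 c0] by blast
  have "cochain (U1 \<union> U2) (i - 1) (\<lambda>F. b1 F - b2 F)"
    using b1(1) b2(1) unfolding cochain_def by (metis UnCI diff_zero)
  moreover have "cdiff (\<lambda>F. b1 F - b2 F) F = 0" for F
    by (simp add: cdiff_diff b1 b2)
  ultimately obtain e where e: "cochain (U1 \<union> U2) (i - 1 - 1) e"
      "\<And>F. cdiff e F = b1 F - b2 F"
    using acyclic_atE[OF 12] by blast
  \<comment> \<open>Splitting \<open>e\<close> into a part on \<open>U1\<close> and a part on
    \<open>U2\<close> turns the difference of the primitives into corrections of both; the corrected
    primitives coincide, hence live on the intersection.\<close>
  define e1 where "e1 = (\<lambda>F. if F \<in> U1 then e F else 0)"
  define e2 where "e2 = (\<lambda>F. if F \<in> U1 then 0 else e F)"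
  let ?b = "\<lambda>F. b1 F - cdiff e1 F"
  have e12: "cdiff e F = cdiff e1 F + cdiff e2 F" for F
    unfolding cdiff_add[symmetric] by (rule arg_cong[of _ _ "\<lambda>c. cdiff c F"]) (auto simp: e1_def e2_def)
  have b_eq: "?b F = b2 F + cdiff e2 F" for F
    using e(2)[of F] e12[of F] by (simp add: algebra_simps)
  have "cochain U1 (i - 2) e1" using e(1) by (auto simp: cochain_def e1_def)
  from cochain_cdiff[OF this up(1)] have "cochain U1 (i - 1) (cdiff e1)" by simp
  with b1(1) have s1: "cochain U1 (i - 1) ?b"
    by (force simp: cochain_def)
  have "cochain U2 (i - 2) e2" using e(1) by (auto simp: cochain_def e2_def)
  from cochain_cdiff[OF this up(2)] have "cochain U2 (i - 1) (cdiff e2)" by simp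
  with b2(1) have s2: "cochain U2 (i - 1) ?b"
    unfolding b_eq by (force simp: cochain_def)
  have "cochain (U1 \<inter> U2) (i - 1) ?b" using s1 s2 by (auto simp: cochain_def)
  moreover have "cdiff ?b F = c F" for F
    by (simp add: cdiff_diff b1)
  ultimately show "\<exists>b. cochain (U1 \<inter> U2) (i - 1) b \<and> (\<forall>F. cdiff b F = c F)"
    by blast
qed

subsection \<open>Degree strands of the first two powers of an edge ideal\<close>

definition nbhd :: "'v set set \<Rightarrow> 'v \<Rightarrow> 'v set" where
  "nbhd E u = {w. {u, w} \<in> E}"

text \<open>Up to powers of the variables in \<open>F\<close>, the product of the variables in \<open>S\<close> lies in $I(G)^2$.\<close>

definition covers2 :: "'v set set \<Rightarrow> 'v set \<Rightarrow> 'v set \<Rightarrow> bool" where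
  "covers2 E S F \<longleftrightarrow> (\<exists>e\<in>E. \<exists>f\<in>E. e \<union> f \<subseteq> F \<union> S \<and> e \<inter> f \<subseteq> F)"

lemma covers2I:
  "e \<in> E \<Longrightarrow> f \<in> E \<Longrightarrow> e \<subseteq> F \<union> S \<Longrightarrow> f \<subseteq> F \<union> S \<Longrightarrow> e \<inter> f \<subseteq> F \<Longrightarrow> covers2 E S F"
  unfolding covers2_def by blast

lemma covers2_mono: "covers2 E S F \<Longrightarrow> F \<subseteq> F' \<Longrightarrow> covers2 E S F'"
  unfolding covers2_def by (meson Un_mono order_refl order_trans)

lemma nbhd_sym: "w \<in> nbhd E u \<longleftrightarrow> u \<in> nbhd E w"
  by (simp add: nbhd_def insert_commute)

lemma simple_graph_irrefl: "simple_graph E \<Longrightarrow> u \<notin> nbhd E u"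
  by (auto simp: simple_graph_def nbhd_def)

lemma simple_graph_edge:
  assumes "simple_graph E" "e \<in> E" "x \<in> e"
  obtains w where "w \<in> nbhd E x" "e = {x, w}" "w \<noteq> x"
proof -
  have "card e = 2" using assms by (auto simp: simple_graph_def)
  then obtain p q where "e = {p, q}" "p \<noteq> q" by (auto simp: card_2_iff)
  with assms that show thesis by (auto simp: nbhd_def insert_commute)
qed

text \<open>Any vertex outside \<open>N\<close> is an apex. If there is none, the family is the
  single set \<open>UNIV\<close>, of cardinality below \<open>i\<close>.\<close>

lemma acyclic_at_superset:
  fixes N :: "'v::{finite,linorder} set"
  assumes "int (card N) < i"
  shows "acyclic_at TYPE('k::comm_ring_1) {F. N \<subseteq> F} i"
proof (cases "N = UNIV")
  case True
  then show ?thesis using assms by (intro acyclic_at_large) (auto simp: top.extremum_unique)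
next
  case False
  then obtain v where "v \<notin> N" by blast
  then show ?thesis by (intro acyclic_at_cone[of v]) auto
qed

text \<open>A vertex of \<open>C\<close> outside \<open>N\<close> is an apex. In the remaining cases
  the condition on \<open>C\<close> excludes at most the set \<open>N\<close> itself, and the 2
  keeps its cardinality away from both \<open>i\<close> and \<open>i - 1\<close>.\<close>

lemma acyclic_at_not_simplex:
  fixes N :: "'v::{finite,linorder} set"
  assumes i: "int (card N) + 2 \<le> i"
  shows "acyclic_at TYPE('k::comm_ring_1) {F. N \<subseteq> F \<and> \<not> F \<subseteq> C} i"
proof (cases "N \<subseteq> C \<and> N \<noteq> C")
  case True
  then obtain v where "v \<in> C" "v \<notin> N" by blast
  then show ?thesis by (intro acyclic_at_cone[of v]) auto
next
  case False
  have "acyclic_at TYPE('k) {F. N \<subseteq> F \<and> \<not> F \<subseteq> C} i \<longleftrightarrow> acyclic_at TYPE('k) {F. N \<subseteq> F} i"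
    by (rule acyclic_at_cong) (use False i in auto)
  then show ?thesis using acyclic_at_superset[of N i] i by auto
qed

text \<open>If \<open>e\<close> misses both neighbourhoods, it is disjoint from
  \<open>{u, v}\<close>, and a third edge within the four vertices would have to join
  \<open>e\<close> to \<open>u\<close> or \<open>v\<close>. So the two edges would form a
  gap.\<close>

lemma gap_free_edge_meets_nbhd:
  assumes E: "simple_graph E" "gap_free E" and uv: "{u, v} \<in> E" and e: "e \<in> E"
  shows "e \<inter> (nbhd E u \<union> nbhd E v) \<noteq> {}"
proof
  assume *: "e \<inter> (nbhd E u \<union> nbhd E v) = {}"
  have uv': "u \<in> nbhd E v" "v \<in> nbhd E u" using uv by (simp_all add: nbhd_def insert_commute)
  have "{g \<in> E. g \<subseteq> {u, v} \<union> e} = {{u, v}, e}"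
  proof (intro subset_antisym subsetI, rule ccontr)
    fix g assume "g \<in> {g \<in> E. g \<subseteq> {u, v} \<union> e}" "g \<notin> {{u, v}, e}"
    then have g: "g \<in> E" "g \<subseteq> {u, v} \<union> e" "g \<noteq> e" and ne: "g \<noteq> {u, v}" by auto
    have "x \<in> {u, v}" if xg: "x \<in> g" for x
    proof (rule ccontr)
      assume "x \<notin> {u, v}"
      with xg g have x: "x \<in> e" by auto
      obtain w where w: "w \<in> nbhd E x" "g = {x, w}" "w \<noteq> x"
        using simple_graph_edge[OF E(1) g(1) xg] .
      obtain y where y: "y \<in> nbhd E x" "e = {x, y}" "y \<noteq> x"
        using simple_graph_edge[OF E(1) e x] .
      have "w \<noteq> y" using w y g(3) by auto
      then have "w = u \<or> w = v" using g(2) w y by auto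
      then have "x \<in> nbhd E u \<union> nbhd E v" using w(1) by (auto simp: nbhd_sym)
      then show False using x * by auto
    qed
    then have "g \<subseteq> {u, v}" by auto
    moreover have "card g = 2" "card {u, v} = 2" using E g uv by (auto simp: simple_graph_def)
    ultimately show False using ne by (metis card_subset_eq finite.emptyI finite.insertI)
  qed (use uv e in auto)
  moreover have "{u, v} \<inter> e = {}" using * uv' by auto
  ultimately have "is_gap E {u, v} e" using uv e by (simp add: is_gap_def)
  then show False using E(2) by (auto simp: gap_free_def)
qed

section \<open>Strands of the square: \<open>N\<close> holds the negative exponents and
  \<open>S\<close> the exponents equal to 1\<close>

context
  fixes E :: "'v::{finite,linorder} set set" and N S :: "'v set"
  assumes E: "simple_graph E" and NS: "N \<inter> S = {}"
begin

text \<open>Since \<open>S\<close> already supplies one factor \<open>u\<close>, membership of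
  \<open>u\<close> in \<open>F\<close> matters only if both edges contain \<open>u\<close>. Then
  \<open>w\<close> and \<open>w'\<close> are their other ends; if these coincide, the repeated end
  must be supplied by \<open>F\<close>.\<close>

lemma covers2_remove:
  assumes "covers2 E S (insert u F)" "u \<in> S" "\<not> covers2 E S F"
  obtains w w' where "{u, w} \<in> E" "{u, w'} \<in> E" "w \<noteq> u" "w' \<noteq> u" "w \<in> F \<union> S" "w' \<in> F \<union> S"
    "w = w' \<Longrightarrow> w \<in> F"
proof -
  obtain e f where ef: "e \<in> E" "f \<in> E" "e \<union> f \<subseteq> insert u F \<union> S" "e \<inter> f \<subseteq> insert u F"
    using assms(1) unfolding covers2_def by blast
  have "e \<subseteq> F \<union> S" "f \<subseteq> F \<union> S" using ef assms(2) by auto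
  then have "\<not> e \<inter> f \<subseteq> F" using covers2I[OF ef(1,2)] assms(3) by blast
  then have u: "u \<in> e" "u \<in> f" using ef by auto
  obtain w where w: "w \<in> nbhd E u" "e = {u, w}" "w \<noteq> u"
    using simple_graph_edge[OF E ef(1) u(1)] .
  obtain w' where w': "w' \<in> nbhd E u" "f = {u, w'}" "w' \<noteq> u"
    using simple_graph_edge[OF E ef(2) u(2)] .
  show thesis
    by (rule that[of w w']) (use w w' ef assms(2) in auto)
qed

text \<open>The apex is \<open>u\<close>. If \<open>u\<close> could not be removed, both edges
  through \<open>u\<close> would end outside \<open>F\<close>, hence in \<open>S\<close> and hence
  at \<open>v\<close>; but a repeated end lies in \<open>F\<close>.\<close>

lemma cone_nbhd:
  assumes uv: "u \<in> S" "S \<inter> nbhd E u \<subseteq> {v}" and A: "nbhd E u \<subseteq> A" "u \<notin> A"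
  shows "acyclic_at TYPE('k::comm_ring_1) {F. N \<subseteq> F \<and> (covers2 E S F \<or> F \<inter> A \<noteq> {})} i"
proof (rule acyclic_at_cone[of u])
  fix F assume u: "u \<notin> F" and *: "insert u F \<in> {F. N \<subseteq> F \<and> (covers2 E S F \<or> F \<inter> A \<noteq> {})}"
  have "covers2 E S F \<or> F \<inter> A \<noteq> {}"
  proof (rule ccontr)
    assume "\<not> (covers2 E S F \<or> F \<inter> A \<noteq> {})"
    then have n: "\<not> covers2 E S F" "F \<inter> A = {}" by auto
    with * A have "covers2 E S (insert u F)" by auto
    then obtain w w' where w: "{u, w} \<in> E" "{u, w'} \<in> E" "w \<in> F \<union> S" "w' \<in> F \<union> S" "w = w' \<Longrightarrow> w \<in> F"
      using covers2_remove[OF _ uv(1) n(1)] by metis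
    then have "w \<in> nbhd E u" "w' \<in> nbhd E u" by (auto simp: nbhd_def)
    with n A have "w \<notin> F" "w' \<notin> F" by auto
    with w \<open>w \<in> nbhd E u\<close> \<open>w' \<in> nbhd E u\<close> uv show False by auto
  qed
  then show "F \<in> {F. N \<subseteq> F \<and> (covers2 E S F \<or> F \<inter> A \<noteq> {})}"
    using * uv NS by auto
qed

text \<open>A set that meets both neighbourhoods contains the far ends of an edge at
  \<open>u\<close> and of an edge at \<open>v\<close>, and these two edges cover. So the family is
  the intersection of the two cones of \<open>cone_nbhd\<close>, and Mayer-Vietoris reduces it to
  their union.\<close>

lemma covers2_split:
  assumes uv: "u \<in> S" "v \<in> S" "u \<noteq> v" "S \<inter> nbhd E u \<subseteq> {v}" "S \<inter> nbhd E v \<subseteq> {u}"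
    and "acyclic_at TYPE('k::comm_ring_1)
      {F. N \<subseteq> F \<and> (covers2 E S F \<or> F \<inter> (nbhd E u \<union> nbhd E v) \<noteq> {})} (i - 1)"
  shows "acyclic_at TYPE('k) {F. N \<subseteq> F \<and> covers2 E S F} i"
proof -
  let ?U = "\<lambda>A. {F. N \<subseteq> F \<and> (covers2 E S F \<or> F \<inter> A \<noteq> {})}"
  have "acyclic_at TYPE('k) (?U (nbhd E u) \<inter> ?U (nbhd E v)) i"
  proof (rule acyclic_at_Int)
    show "acyclic_at TYPE('k) (?U (nbhd E u)) i"
      using uv simple_graph_irrefl[OF E] by (intro cone_nbhd[of u v]) auto
    show "acyclic_at TYPE('k) (?U (nbhd E v)) i"
      using uv simple_graph_irrefl[OF E] by (intro cone_nbhd[of v u]) auto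
    have "?U (nbhd E u) \<union> ?U (nbhd E v) = ?U (nbhd E u \<union> nbhd E v)" by auto
    then show "acyclic_at TYPE('k) (?U (nbhd E u) \<union> ?U (nbhd E v)) (i - 1)"
      using assms by simp
  qed (auto intro: covers2_mono)
  moreover have "covers2 E S F"
    if "F \<inter> nbhd E u \<noteq> {}" "F \<inter> nbhd E v \<noteq> {}" for F
  proof -
    obtain f g where "f \<in> F" "{u, f} \<in> E" "g \<in> F" "{v, g} \<in> E"
      using \<open>F \<inter> nbhd E u \<noteq> {}\<close> \<open>F \<inter> nbhd E v \<noteq> {}\<close> by (auto simp: nbhd_def)
    then show ?thesis
      using uv by (intro covers2I[of "{u, f}" _ "{v, g}"]) auto
  qed
  then have "?U (nbhd E u) \<inter> ?U (nbhd E v) = {F. N \<subseteq> F \<and> covers2 E S F}" by blast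
  ultimately show ?thesis by simp
qed

text \<open>The neighbourhoods of \<open>u\<close> and \<open>v\<close> avoid \<open>S\<close>, so
  the union of the two cones is again a cone with apex \<open>u\<close>.\<close>

lemma covers2_independent:
  assumes "u \<in> S" "v \<in> S" "u \<noteq> v" and indep: "\<And>e. e \<in> E \<Longrightarrow> \<not> e \<subseteq> S"
  shows "acyclic_at TYPE('k::comm_ring_1) {F. N \<subseteq> F \<and> covers2 E S F} i"
proof -
  have *: "S \<inter> nbhd E x = {}" if "x \<in> S" for x
    using indep[of "{x, _}"] that by (auto simp: nbhd_def)
  show ?thesis
  proof (rule covers2_split[of u v])
    show "acyclic_at TYPE('k)
      {F. N \<subseteq> F \<and> (covers2 E S F \<or> F \<inter> (nbhd E u \<union> nbhd E v) \<noteq> {})} (i - 1)"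
      by (rule cone_nbhd[of u v]) (use assms * in auto)
  qed (use assms * in auto)
qed

text \<open>Of the 3, one is lost in the passage to \<open>i - 1\<close> and two are required by
  \<open>acyclic_at_not_simplex\<close>.\<close>

lemma covers2_edge:
  assumes gf: "gap_free E" and uv: "{u, v} \<in> E" "S = {u, v}" and i: "int (card N) + 3 \<le> i"
  shows "acyclic_at TYPE('k::comm_ring_1) {F. N \<subseteq> F \<and> covers2 E S F} i"
proof (rule covers2_split[of u v])
  let ?A = "nbhd E u \<union> nbhd E v"
  \<comment> \<open>Such an \<open>F\<close> avoids \<open>u\<close> and \<open>v\<close> too. By
    gap-freeness an edge inside \<open>F\<close> and \<open>S\<close> must contain \<open>u\<close>
    or \<open>v\<close>, and its other end is a neighbour, hence not in \<open>F\<close>. So the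
    only edge available is \<open>{u, v}\<close>, and using it twice would need \<open>u\<close> in
    \<open>F\<close>.\<close>
  have *: "\<not> covers2 E S F" if F: "F \<inter> ?A = {}" for F
  proof
    assume "covers2 E S F"
    then obtain e f where ef: "e \<in> E" "f \<in> E" "e \<subseteq> F \<union> S" "f \<subseteq> F \<union> S" "e \<inter> f \<subseteq> F"
      unfolding covers2_def by auto
    have F': "u \<notin> F" "v \<notin> F" using F uv by (auto simp: nbhd_def insert_commute)
    have "g = {u, v}" if g: "g \<in> E" "g \<subseteq> F \<union> S" for g
    proof -
      have "g \<inter> {u, v} \<noteq> {}"
        using gap_free_edge_meets_nbhd[OF E gf uv(1) g(1)] F g(2) uv(2) by blast
      then obtain x where x: "x \<in> g" "x \<in> {u, v}" by blast
      obtain w where w: "w \<in> nbhd E x" "g = {x, w}" "w \<noteq> x"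
        using simple_graph_edge[OF E g(1) x(1)] .
      have "w \<in> {u, v}" using w x g(2) uv(2) F by auto
      then show ?thesis using w x by auto
    qed
    with ef F' show False by (metis Int_absorb insert_subset)
  qed
  have "{F. N \<subseteq> F \<and> (covers2 E S F \<or> F \<inter> ?A \<noteq> {})} = {F. N \<subseteq> F \<and> \<not> F \<subseteq> - ?A}"
    using * by blast
  then show "acyclic_at TYPE('k) {F. N \<subseteq> F \<and> (covers2 E S F \<or> F \<inter> ?A \<noteq> {})} (i - 1)"
    using acyclic_at_not_simplex[of N "i - 1" "- ?A"] i by auto
qed (use uv simple_graph_irrefl[OF E] in \<open>auto simp: nbhd_def\<close>)

text \<open>The apex is \<open>t\<close>. If \<open>t\<close> could not be removed, an edge from
  \<open>t\<close> to a vertex other than \<open>u\<close>, \<open>v\<close> would pair with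
  \<open>{u, v}\<close>: inside \<open>S\<close> this contradicts \<open>n0\<close>, and an end in
  \<open>F\<close> is excluded likewise. So both edges at \<open>t\<close> end in \<open>u\<close>
  or \<open>v\<close> outside \<open>F\<close>, at distinct ends, and \<open>t\<close> would be
  adjacent to both.\<close>

lemma covers2_cone:
  assumes uv: "{u, v} \<in> E" "u \<in> S" "v \<in> S" and t: "t \<in> S" "t \<noteq> u" "t \<noteq> v"
    and nt: "{t, u} \<notin> E \<or> {t, v} \<notin> E" and n0: "\<not> covers2 E S {}"
  shows "acyclic_at TYPE('k::comm_ring_1) {F. N \<subseteq> F \<and> covers2 E S F} i"
proof (rule acyclic_at_cone[of t])
  fix F assume tF: "t \<notin> F" and *: "insert t F \<in> {F. N \<subseteq> F \<and> covers2 E S F}"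
  have "covers2 E S F"
  proof (rule ccontr)
    assume n: "\<not> covers2 E S F"
    obtain w w' where w: "{t, w} \<in> E" "{t, w'} \<in> E" "w \<in> F \<union> S" "w' \<in> F \<union> S" "w = w' \<Longrightarrow> w \<in> F"
      using covers2_remove[OF _ t(1) n] * by (metis mem_Collect_eq)
    have **: "x \<notin> F \<and> x \<in> {u, v}" if x: "{t, x} \<in> E" "x \<in> F \<union> S" for x
    proof -
      have 1: "x \<notin> F" using n covers2I[OF x(1) uv(1), of F S] uv t x(2) by auto
      moreover have "x \<in> {u, v}"
        using n0 covers2I[OF x(1) uv(1), of "{}" S] uv t x(2) 1 by auto
      ultimately show ?thesis by simp
    qed
    show False using **[OF w(1,3)] **[OF w(2,4)] w nt by auto
  qed
  then show "F \<in> {F. N \<subseteq> F \<and> covers2 E S F}" using * t NS by auto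
qed

text \<open>An edge from a corner into \<open>F\<close> pairs with the opposite side. If
  \<open>F\<close> meets no neighbourhood, gap-freeness forces both edges into the triangle, where
  they would have to be disjoint, and three vertices are too few.\<close>

lemma covers2_triangle:
  assumes gf: "gap_free E" and S: "S = {u, v, t}"
    and uv: "{u, v} \<in> E" "{u, t} \<in> E" "{v, t} \<in> E" and i: "int (card N) + 2 \<le> i"
  shows "acyclic_at TYPE('k::comm_ring_1) {F. N \<subseteq> F \<and> covers2 E S F} i"
proof -
  let ?A = "nbhd E u \<union> nbhd E v \<union> nbhd E t"
  have neq: "u \<noteq> v" "u \<noteq> t" "v \<noteq> t" using uv E by (auto simp: simple_graph_def)
  have "covers2 E S F" if F: "F \<inter> ?A \<noteq> {}" for F
  proof -
    consider f where "f \<in> F" "{u, f} \<in> E" | f where "f \<in> F" "{v, f} \<in> E" | f where "f \<in> F" "{t, f} \<in> E"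
      using F by (auto simp: nbhd_def)
    then show ?thesis
    proof cases
      case (1 f)
      then show ?thesis using uv neq S by (intro covers2I[of "{u, f}" _ "{v, t}"]) auto
    next
      case (2 f)
      then show ?thesis using uv neq S by (intro covers2I[of "{v, f}" _ "{u, t}"]) auto
    next
      case (3 f)
      then show ?thesis using uv neq S by (intro covers2I[of "{t, f}" _ "{u, v}"]) auto
    qed
  qed
  moreover have "\<not> covers2 E S F" if F: "F \<inter> ?A = {}" for F
  proof
    assume "covers2 E S F"
    then obtain e f where ef: "e \<in> E" "f \<in> E" "e \<subseteq> F \<union> S" "f \<subseteq> F \<union> S" "e \<inter> f \<subseteq> F"
      unfolding covers2_def by auto
    have F': "F \<inter> S = {}" using F uv S by (auto simp: nbhd_def insert_commute)
    have *: "g \<subseteq> S \<and> card g = 2" if g: "g \<in> E" "g \<subseteq> F \<union> S" for g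
    proof -
      have "g \<inter> S \<noteq> {}"
        using gap_free_edge_meets_nbhd[OF E gf uv(1) g(1)] F g(2) by blast
      then obtain x where x: "x \<in> g" "x \<in> S" by blast
      obtain w where w: "w \<in> nbhd E x" "g = {x, w}" "w \<noteq> x"
        using simple_graph_edge[OF E g(1) x(1)] .
      have "w \<in> S" using w x g(2) F S by auto
      then show ?thesis using w x by auto
    qed
    have "e \<inter> f = {}" using ef(5) F' *[OF ef(1,3)] by blast
    then have "card (e \<union> f) = 4"
      using *[OF ef(1,3)] *[OF ef(2,4)] by (simp add: card_Un_disjoint)
    moreover have "card (e \<union> f) \<le> card S"
      using *[OF ef(1,3)] *[OF ef(2,4)] by (intro card_mono) auto
    moreover have "card S \<le> 3" using S by (simp add: card_insert_if)
    ultimately show False by simp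
  qed
  ultimately have "{F. N \<subseteq> F \<and> covers2 E S F} = {F. N \<subseteq> F \<and> \<not> F \<subseteq> - ?A}" by blast
  then show ?thesis using acyclic_at_not_simplex[of N i "- ?A"] i by simp
qed

text \<open>The bound is what i + j at least 5 yields once the degree is estimated by
  \<open>card S\<close> minus \<open>card N\<close>. It specialises to the 3 of
  \<open>covers2_edge\<close> for two elements of \<open>S\<close> and to the 2 of
  \<open>covers2_triangle\<close> for three.\<close>

lemma covers2_acyclic:
  assumes gf: "gap_free E" and S: "2 \<le> card S" and i: "int (card N) + 5 \<le> i + int (card S)"
  shows "acyclic_at TYPE('k::comm_ring_1) {F. N \<subseteq> F \<and> covers2 E S F} i"
proof -
  obtain u0 v0 where uv0: "u0 \<in> S" "v0 \<in> S" "u0 \<noteq> v0"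
    using S by (metis card_2_iff' obtain_subset_with_card_n subset_iff)
  show ?thesis
  proof (cases "covers2 E S {}")
    case True
    then have "covers2 E S F" for F using covers2_mono by blast
    then show ?thesis using uv0 NS by (intro acyclic_at_cone[of u0]) auto
  next
    case n0: False
    show ?thesis
    proof (cases "\<exists>e\<in>E. e \<subseteq> S")
      case False
      then show ?thesis using covers2_independent[OF uv0] by blast
    next
      case True
      then obtain e where e: "e \<in> E" "e \<subseteq> S" by blast
      then have "card e = 2" using E by (auto simp: simple_graph_def)
      then obtain u v where uv: "e = {u, v}" "u \<noteq> v" by (auto simp: card_2_iff)
      show ?thesis
      proof (cases "S = {u, v}")
        case True
        then have "card S = 2" using uv by simp
        then show ?thesis by (intro covers2_edge[OF gf _ True]) (use i e uv in auto)
      next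
        case False
        then obtain t where t: "t \<in> S" "t \<noteq> u" "t \<noteq> v" using e uv by auto
        show ?thesis
        proof (cases "{t, u} \<in> E \<and> {t, v} \<in> E")
          case False
          then show ?thesis by (intro covers2_cone[of u v t]) (use e uv t n0 in auto)
        next
          case tri: True
          show ?thesis
          proof (cases "S = {u, v, t}")
            case True
            then have "card S = 3" using uv t by simp
            then show ?thesis
              by (intro covers2_triangle[OF gf True]) (use i e uv tri in \<open>auto simp: insert_commute\<close>)
          next
            case False
            then obtain s where s: "s \<in> S" "s \<noteq> u" "s \<noteq> v" "s \<noteq> t" using e uv t by auto
            \<comment> \<open>A fourth vertex \<open>s\<close> cannot be adjacent to
              \<open>u\<close>: together with \<open>{t, v}\<close> this would give two disjoint
              edges inside \<open>S\<close>. So \<open>s\<close> serves as the apex.\<close>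
            have "{s, u} \<notin> E"
            proof
              assume "{s, u} \<in> E"
              then have "covers2 E S {}"
                using tri s t e uv by (intro covers2I[of "{s, u}" _ "{t, v}"]) auto
              then show False using n0 by simp
            qed
            then show ?thesis by (intro covers2_cone[of u v s]) (use e uv s n0 in auto)
          qed
        qed
      qed
    qed
  qed
qed

end

text \<open>The sets \<open>F\<close> with $x^a \in I(G)_{x_F}$ and $x^a \in I(G)^2_{x_F}$, for an integer exponent vector \<open>a\<close>.\<close>

definition strand1 :: "'v set set \<Rightarrow> ('v \<Rightarrow> int) \<Rightarrow> 'v set set" where
  "strand1 E a = {F. \<exists>e\<in>E. \<forall>v. v \<notin> F \<longrightarrow> of_bool (v \<in> e) \<le> a v}"

definition strand2 :: "'v set set \<Rightarrow> ('v \<Rightarrow> int) \<Rightarrow> 'v set set" where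
  "strand2 E a = {F. \<exists>e\<in>E. \<exists>f\<in>E. \<forall>v. v \<notin> F \<longrightarrow> of_bool (v \<in> e) + of_bool (v \<in> f) \<le> a v}"

section \<open>Comparison of the strands of the ideal and of its square\<close>

lemma strand1_neg:
  assumes "\<And>v. a v \<le> 0"
  shows "strand1 E a = {F. {v. a v < 0} \<subseteq> F \<and> (\<exists>e\<in>E. e \<subseteq> F)}"
proof -
  have "of_bool (v \<in> e) \<le> a v \<longleftrightarrow> v \<notin> e \<and> \<not> a v < 0" for v and e :: "'a set"
    using assms[of v] by auto
  then show ?thesis by (auto simp: strand1_def)
qed

lemma strand2_le1:
  assumes "\<And>v. a v \<le> 1"
  shows "strand2 E a = {F. {v. a v < 0} \<subseteq> F \<and> covers2 E {v. a v = 1} F}"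
proof -
  have "of_bool (v \<in> e) + of_bool (v \<in> f) \<le> a v \<longleftrightarrow>
      \<not> a v < 0 \<and> (v \<in> e \<union> f \<longrightarrow> a v = 1) \<and> v \<notin> e \<inter> f" for v and e f :: "'a set"
    using assms[of v] by auto
  then have eq: "(\<forall>v. v \<notin> F \<longrightarrow> of_bool (v \<in> e) + of_bool (v \<in> f) \<le> a v) \<longleftrightarrow>
      {v. a v < 0} \<subseteq> F \<and> e \<union> f \<subseteq> F \<union> {v. a v = 1} \<and> e \<inter> f \<subseteq> F" for F e f
    by blast
  show ?thesis unfolding strand2_def covers2_def eq by blast
qed

text \<open>If neither edge were inside \<open>F\<close>, both would contain the one element of
  \<open>S\<close>, outside \<open>F\<close>; but it lies in their intersection.\<close>

lemma covers2_small:
  assumes E: "simple_graph E" and "card S \<le> 1" "finite S"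
  shows "covers2 E S F \<longleftrightarrow> (\<exists>e\<in>E. e \<subseteq> F)"
proof
  assume "covers2 E S F"
  then obtain e f where ef: "e \<in> E" "f \<in> E" "e \<subseteq> F \<union> S" "f \<subseteq> F \<union> S" "e \<inter> f \<subseteq> F"
    unfolding covers2_def by auto
  show "\<exists>e\<in>E. e \<subseteq> F"
  proof (rule ccontr)
    assume n: "\<not> (\<exists>e\<in>E. e \<subseteq> F)"
    obtain x where x: "x \<in> e" "x \<notin> F" using n ef(1) by blast
    obtain y where y: "y \<in> f" "y \<notin> F" using n ef(2) by blast
    have "x \<in> S" "y \<in> S" using x y ef(3,4) by auto
    then have "x = y"
      using assms card_le_Suc0_iff_eq[of S] by auto
    then show False using x y ef(5) by auto
  qed
qed (auto simp: covers2_def)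

lemma sum_int_split:
  fixes a :: "'v::finite \<Rightarrow> int"
  assumes "\<And>v. a v \<le> 1"
  shows "(\<Sum>v\<in>UNIV. a v) \<le> int (card {v. a v = 1}) - int (card {v. a v < 0})"
proof -
  have "(\<Sum>v\<in>UNIV. a v) \<le> (\<Sum>v\<in>UNIV. of_bool (a v = 1) - of_bool (a v < 0))"
    by (rule sum_mono) (use assms in \<open>auto simp: of_bool_def not_less intro: antisym\<close>)
  also have "\<dots> = int (card {v. a v = 1}) - int (card {v. a v < 0})"
    by (simp add: sum_subtractf of_bool_def flip: sum.inter_filter)
  finally show ?thesis .
qed

lemma strand2_acyclic:
  fixes a :: "'v::{finite,linorder} \<Rightarrow> int"
  assumes E: "simple_graph E" "gap_free E"
    and H: "\<And>a i. (\<And>v. a v \<le> 0) \<Longrightarrow> 4 \<le> i + (\<Sum>v\<in>UNIV. a v)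
      \<Longrightarrow> acyclic_at TYPE('k::comm_ring_1) (strand1 E a) i"
    and i: "5 \<le> i + (\<Sum>v\<in>UNIV. a v)"
  shows "acyclic_at TYPE('k) (strand2 E a) i"
proof (cases "\<forall>v. a v \<le> 1")
  case False
  then obtain u where "\<not> a u \<le> 1" by blast
  then have u: "2 \<le> a u" by simp
  \<comment> \<open>An exponent of at least 2 satisfies the demand of any two edges at
    \<open>u\<close>, with or without \<open>u\<close> in \<open>F\<close>; so \<open>u\<close> is
    an apex.\<close>
  have 2: "of_bool P + of_bool Q \<le> a u" for P Q using u by (cases P; cases Q) auto
  show ?thesis
  proof (rule acyclic_at_cone[of u])
    fix F assume "insert u F \<in> strand2 E a"
    then obtain e f where ef: "e \<in> E" "f \<in> E"
      and le: "\<And>v. v \<notin> insert u F \<Longrightarrow> of_bool (v \<in> e) + of_bool (v \<in> f) \<le> a v"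
      unfolding strand2_def by blast
    have "of_bool (v \<in> e) + of_bool (v \<in> f) \<le> a v" if "v \<notin> F" for v
      using le[of v] 2 that by (cases "v = u") auto
    then show "F \<in> strand2 E a" using ef unfolding strand2_def by blast
  qed
next
  case True
  define N where "N = {v. a v < 0}"
  define S where "S = {v. a v = 1}"
  have eq: "strand2 E a = {F. N \<subseteq> F \<and> covers2 E S F}"
    unfolding N_def S_def by (rule strand2_le1) (use True in auto)
  have NS: "N \<inter> S = {}" by (auto simp: N_def S_def)
  have le: "(\<Sum>v\<in>UNIV. a v) \<le> int (card S) - int (card N)"
    unfolding N_def S_def by (rule sum_int_split) (use True in auto)
  show ?thesis
  proof (cases "2 \<le> card S")
    case True
    then show ?thesis
      unfolding eq by (intro covers2_acyclic[OF E(1) NS E(2)]) (use i le in auto)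
  next
    case False
    \<comment> \<open>With at most one positive entry only the set \<open>N\<close> matters, so
      \<open>a\<close> may be replaced by the exponent of highest degree with negative set
      \<open>N\<close> and no positive entry. Its degree is at least that of \<open>a\<close> minus
      1, which turns 5 into 4.\<close>
    define a' where "a' = (\<lambda>v. - of_bool (v \<in> N) :: int)"
    have "strand2 E a = {F. N \<subseteq> F \<and> (\<exists>e\<in>E. e \<subseteq> F)}"
      unfolding eq using covers2_small[OF E(1), of S] False by auto
    also have "\<dots> = {F. {v. a' v < 0} \<subseteq> F \<and> (\<exists>e\<in>E. e \<subseteq> F)}"
      by (simp add: a'_def of_bool_def)
    also have "\<dots> = strand1 E a'"
      by (rule strand1_neg[symmetric]) (simp add: a'_def)
    finally have "strand2 E a = strand1 E a'" .
    moreover have "(\<Sum>v\<in>UNIV. a' v) = - int (card N)"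
      by (simp add: a'_def sum_negf of_bool_def flip: sum.inter_filter)
    ultimately show ?thesis
      using H[of a' i] i le False by (simp add: a'_def)
  qed
qed

lemma strand1_acyclic_pos:
  fixes a :: "'v::{finite,linorder} \<Rightarrow> int"
  assumes u: "0 < a u"
  shows "acyclic_at TYPE('k::comm_ring_1) (strand1 E a) i"
proof (rule acyclic_at_cone[of u])
  fix F assume "insert u F \<in> strand1 E a"
  then obtain e where e: "e \<in> E"
    and le: "\<And>v. v \<notin> insert u F \<Longrightarrow> of_bool (v \<in> e) \<le> a v"
    unfolding strand1_def by blast
  have "of_bool P \<le> a u" for P using u by (cases P) auto
  then have "of_bool (v \<in> e) \<le> a v" if "v \<notin> F" for v
    using le[of v] that by (cases "v = u") auto
  then show "F \<in> strand1 E a" using e unfolding strand1_def by blast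
qed

lemma strand1_acyclic:
  fixes a :: "'v::{finite,linorder} \<Rightarrow> int"
  assumes E: "simple_graph E"
    and H: "\<And>a i. 5 \<le> i + (\<Sum>v\<in>UNIV. a v) \<Longrightarrow> acyclic_at TYPE('k::comm_ring_1) (strand2 E a) i"
    and i: "4 \<le> i + (\<Sum>v\<in>UNIV. a v)"
  shows "acyclic_at TYPE('k) (strand1 E a) i"
proof (cases "\<forall>v. a v \<le> 0")
  case False
  then obtain u where "\<not> a u \<le> 0" by blast
  then have u: "0 < a u" by simp
  then show ?thesis by (rule strand1_acyclic_pos)
next
  case True
  define N where "N = {v. a v < 0}"
  have eq: "strand1 E a = {F. N \<subseteq> F \<and> (\<exists>e\<in>E. e \<subseteq> F)}"
    unfolding N_def by (rule strand1_neg) (use True in auto)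
  show ?thesis
  proof (cases "N = UNIV")
    case N: True
    have "(\<Sum>v\<in>UNIV. a v) \<le> - int (card N)"
    proof -
      have "a v \<le> 1" "a v \<noteq> 1" for v using spec[OF True, of v] by auto
      then show ?thesis using sum_int_split[of a] by (simp add: N_def)
    qed
    then show ?thesis using N i unfolding eq
      by (intro acyclic_at_large) (auto simp: top.extremum_unique)
  next
    case False
    then obtain u where u: "u \<notin> N" by blast
    then have u0: "a u = 0" using True by (auto simp: N_def not_less intro: antisym)
    \<comment> \<open>Raising one zero entry to 1 leaves the up-set unchanged by
      \<open>covers2_small\<close> and lifts the total from 4 to 5, where the hypothesis on the
      square applies.\<close>
    define a' where "a' = a(u := 1)"
    have a': "{v. a' v < 0} = N" "{v. a' v = 1} = {u}"
      using u u0 spec[OF True] by (auto simp: a'_def N_def) (metis not_one_le_zero)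
    have "strand2 E a' = {F. N \<subseteq> F \<and> covers2 E {u} F}"
    proof -
      have "a' v \<le> 1" for v using spec[OF True, of v] by (simp add: a'_def)
      then show ?thesis using strand2_le1[of a' E] by (simp only: a')
    qed
    also have "\<dots> = strand1 E a" unfolding eq using covers2_small[OF E, of "{u}"] by auto
    finally have "strand2 E a' = strand1 E a" .
    moreover have "(\<Sum>v\<in>UNIV. a' v) = (\<Sum>v\<in>UNIV. a v) + 1"
    proof -
      have "(\<Sum>v\<in>UNIV. a' v) = a' u + (\<Sum>v\<in>UNIV - {u}. a' v)" by (rule sum.remove) auto
      also have "(\<Sum>v\<in>UNIV - {u}. a' v) = (\<Sum>v\<in>UNIV - {u}. a v)" by (rule sum.cong) (auto simp: a'_def)
      also have "\<dots> = (\<Sum>v\<in>UNIV. a v) - a u" by (simp add: sum_diff1)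
      finally show ?thesis using u0 by (simp add: a'_def)
    qed
    ultimately show ?thesis using H[of i a'] i by simp
  qed
qed

abbreviation (input) "lookup \<equiv> Poly_Mapping.lookup"
abbreviation (input) "keys \<equiv> Poly_Mapping.keys"

subsection \<open>Laurent polynomials\<close>

lemma poly_mapping_sum_single:
  "(\<Sum>a\<in>keys f. Poly_Mapping.single a (lookup f a)) = f"
proof (rule poly_mapping_eqI)
  fix b
  have "lookup (\<Sum>a\<in>keys f. Poly_Mapping.single a (lookup f a)) b
      = (\<Sum>a\<in>keys f. if a = b then lookup f a else 0)"
    by (simp add: lookup_sum lookup_single when_def)
  also have "\<dots> = lookup f b" by (simp add: in_keys_iff)
  finally show "lookup (\<Sum>a\<in>keys f. Poly_Mapping.single a (lookup f a)) b = lookup f b" .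
qed

lemma lookup_single_mult:
  fixes f :: "'e::cancel_comm_monoid_add \<Rightarrow>\<^sub>0 'k::comm_semiring_0"
  shows "lookup (Poly_Mapping.single b c * f) (b + a) = c * lookup f a"
proof -
  have "Poly_Mapping.single b c * f = (\<Sum>d\<in>keys f. Poly_Mapping.single (b + d) (c * lookup f d))"
    by (subst (1) poly_mapping_sum_single[of f, symmetric])
       (simp add: sum_distrib_left mult_single)
  then have "lookup (Poly_Mapping.single b c * f) (b + a)
      = (\<Sum>d\<in>keys f. if d = a then c * lookup f d else 0)"
    by (simp add: lookup_sum lookup_single when_def)
  also have "\<dots> = c * lookup f a" by (simp add: in_keys_iff)
  finally show ?thesis .
qed

lemma keys_single_mult:
  fixes f :: "'e::cancel_comm_monoid_add \<Rightarrow>\<^sub>0 'k::comm_semiring_0"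
  shows "keys (Poly_Mapping.single b c * f) \<subseteq> (+) b ` keys f"
  using keys_mult[of "Poly_Mapping.single b c" f] by (auto split: if_splits)

lemma keys_uminus: "keys (- f) = keys (f :: 'e \<Rightarrow>\<^sub>0 'k::ab_group_add)"
  by (auto simp: in_keys_iff)

lemma keys_minus_subset: "keys (f - g) \<subseteq> keys f \<union> keys (g :: 'e \<Rightarrow>\<^sub>0 'k::ab_group_add)"
  by (auto simp: in_keys_iff lookup_minus)

definition emb :: "('v \<Rightarrow>\<^sub>0 nat) \<Rightarrow> 'v \<Rightarrow>\<^sub>0 int" where
  "emb = Poly_Mapping.map int"

lemma lookup_emb [simp]: "lookup (emb m) v = int (lookup m v)"
  by (simp add: emb_def map.rep_eq when_def)

lemma inj_emb: "inj emb"
  by (rule injI, rule poly_mapping_eqI) (metis lookup_emb of_nat_eq_iff)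

lemma emb_eq_iff [simp]: "emb m = emb m' \<longleftrightarrow> m = m'"
  by (simp add: inj_eq[OF inj_emb])

lemma emb_add: "emb (m + m') = emb m + emb m'"
  by (rule poly_mapping_eqI) (simp add: lookup_add)

lemma emb_zero [simp]: "emb 0 = 0"
  by (rule poly_mapping_eqI) simp

definition negs :: "('v \<Rightarrow>\<^sub>0 int) \<Rightarrow> 'v set" where
  "negs a = {v. lookup a v < 0}"

lemma negs_emb [simp]: "negs (emb m) = {}"
  by (simp add: negs_def)

lemma negs_emptyE:
  assumes "negs a = {}"
  obtains m where "a = emb m"
proof
  show "a = emb (Poly_Mapping.map nat a)"
    by (rule poly_mapping_eqI)
       (use assms in \<open>auto simp: map.rep_eq when_def negs_def not_less\<close>)
qed

lemma negs_add: "negs (a + b) \<subseteq> negs a \<union> negs b"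
  by (auto simp: negs_def lookup_add)

lemma to_laurent_eq_sum:
  assumes "finite A" "keys p \<subseteq> A"
  shows "to_laurent p = (\<Sum>m\<in>A. Poly_Mapping.single (emb m) (lookup p m))"
  unfolding to_laurent_def emb_def
  by (rule sum.mono_neutral_left) (use assms in \<open>auto simp: in_keys_iff\<close>)

lemma to_laurent_zero [simp]: "to_laurent 0 = 0"
  by (simp add: to_laurent_def)

lemma to_laurent_single: "to_laurent (Poly_Mapping.single m c) = Poly_Mapping.single (emb m) c"
  by (simp add: to_laurent_def emb_def)

lemma to_laurent_add: "to_laurent (p + q) = to_laurent p + to_laurent q"
  using keys_add[of p q]
  by (simp add: to_laurent_eq_sum[of "keys p \<union> keys q"] lookup_add single_add sum.distrib)

lemma to_laurent_sum: "to_laurent (sum f A) = (\<Sum>x\<in>A. to_laurent (f x))"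
  by (induction A rule: infinite_finite_induct) (simp_all add: to_laurent_add)

lemma to_laurent_mult: "to_laurent (p * q) = to_laurent p * to_laurent q"
proof -
  have "to_laurent (p * q) = to_laurent ((\<Sum>m\<in>keys p. Poly_Mapping.single m (lookup p m))
      * (\<Sum>m\<in>keys q. Poly_Mapping.single m (lookup q m)))"
    by (simp add: poly_mapping_sum_single)
  also have "\<dots> = to_laurent p * to_laurent q"
    by (simp add: sum_product mult_single to_laurent_sum to_laurent_single emb_add
        to_laurent_eq_sum[of "keys p" p] to_laurent_eq_sum[of "keys q" q])
  finally show ?thesis .
qed

lemma lookup_to_laurent [simp]: "lookup (to_laurent p) (emb m) = lookup p m"
proof -
  have "lookup (to_laurent p) (emb m) = (\<Sum>d\<in>keys p. if d = m then lookup p d else 0)"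
    by (simp add: to_laurent_eq_sum[of "keys p"] lookup_sum lookup_single when_def)
  then show ?thesis by (simp add: in_keys_iff)
qed

lemma keys_to_laurent: "keys (to_laurent p) = emb ` keys p"
proof
  show "keys (to_laurent p) \<subseteq> emb ` keys p"
  proof
    fix a assume "a \<in> keys (to_laurent p)"
    then have "(\<Sum>m\<in>keys p. lookup (Poly_Mapping.single (emb m) (lookup p m)) a) \<noteq> 0"
      by (simp add: to_laurent_eq_sum[of "keys p"] lookup_sum in_keys_iff)
    then obtain m where "m \<in> keys p" "lookup (Poly_Mapping.single (emb m) (lookup p m)) a \<noteq> 0"
      by (rule sum.not_neutral_contains_not_neutral)
    then show "a \<in> emb ` keys p" by (auto simp: lookup_single when_def split: if_splits)
  qed
qed (auto simp: in_keys_iff)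

lemma to_laurent_inj: "to_laurent p = to_laurent q \<longleftrightarrow> p = q"
  by (metis lookup_to_laurent poly_mapping_eqI)

lemma to_laurent_eq_0_iff [simp]: "to_laurent p = 0 \<longleftrightarrow> p = 0"
  using to_laurent_inj[of p 0] by simp

text \<open>The localisation $S_{x_F}$.\<close>

definition locring :: "'v set \<Rightarrow> ('v, 'k::field) laurent set" where
  "locring F = {f. \<forall>a\<in>keys f. negs a \<subseteq> F}"

lemma locring_zero [simp]: "0 \<in> locring F"
  by (simp add: locring_def)

lemma locring_add: "f \<in> locring F \<Longrightarrow> g \<in> locring F \<Longrightarrow> f + g \<in> locring F"
  using keys_add[of f g] by (auto simp: locring_def)

lemma locring_minus: "f \<in> locring F \<Longrightarrow> g \<in> locring F \<Longrightarrow> f - g \<in> locring F"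
  using keys_minus_subset[of f g] by (auto simp: locring_def)

lemma locring_uminus: "f \<in> locring F \<Longrightarrow> - f \<in> locring F"
  by (auto simp: locring_def keys_uminus)

lemma locring_sum: "(\<And>x. x \<in> A \<Longrightarrow> f x \<in> locring F) \<Longrightarrow> sum f A \<in> locring F"
  by (induction A rule: infinite_finite_induct) (auto intro: locring_add)

lemma locring_mult: "f \<in> locring F \<Longrightarrow> g \<in> locring F \<Longrightarrow> f * g \<in> locring F"
proof -
  assume f: "f \<in> locring F" and g: "g \<in> locring F"
  have "negs c \<subseteq> F" if c: "c \<in> keys (f * g)" for c
  proof -
    obtain a b where "c = a + b" "a \<in> keys f" "b \<in> keys g" using c keys_mult[of f g] by blast
    then show ?thesis using f g negs_add[of a b] unfolding locring_def by blast
  qed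
  then show ?thesis by (simp add: locring_def)
qed

lemma locring_mono: "F \<subseteq> G \<Longrightarrow> locring F \<subseteq> locring G"
  by (auto simp: locring_def)

lemma locring_single: "negs a \<subseteq> F \<Longrightarrow> Poly_Mapping.single a c \<in> locring F"
  by (simp add: locring_def)

lemma to_laurent_in_locring: "to_laurent p \<in> locring F"
  by (auto simp: locring_def keys_to_laurent)

lemma locring_emptyE:
  assumes "f \<in> locring {}"
  obtains p where "f = to_laurent p"
proof -
  have "\<exists>p. Poly_Mapping.single a (lookup f a) = to_laurent p" if a: "a \<in> keys f" for a
  proof -
    have "negs a = {}" using assms a by (auto simp: locring_def)
    then obtain m where "a = emb m" by (rule negs_emptyE)
    then show ?thesis using to_laurent_single[of m "lookup f a"] by metis
  qed
  then obtain P where P: "\<And>a. a \<in> keys f \<Longrightarrow> Poly_Mapping.single a (lookup f a) = to_laurent (P a)"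
    by metis
  have "f = to_laurent (\<Sum>a\<in>keys f. P a)"
    by (subst poly_mapping_sum_single[of f, symmetric]) (simp add: to_laurent_sum P)
  then show thesis by (rule that)
qed

definition xpow :: "'v set \<Rightarrow> int \<Rightarrow> ('v, 'k::field) laurent" where
  "xpow F t = Poly_Mapping.single (\<Sum>v\<in>F. Poly_Mapping.single v t) 1"

lemma lookup_sum_single:
  "finite F \<Longrightarrow> lookup (\<Sum>v\<in>F. Poly_Mapping.single v t) w = (if w \<in> F then t else 0)"
  by (simp add: lookup_sum lookup_single when_def)

lemma xpow_add: "xpow F s * xpow F t = xpow F (s + t)"
  by (simp add: xpow_def mult_single single_add sum.distrib)

lemma xpow_zero [simp]: "xpow F 0 = 1"
  by (simp add: xpow_def)

lemma xpow_inverse [simp]: "xpow F (- t) * xpow F t = 1" "xpow F t * xpow F (- t) = 1"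
  by (simp_all add: xpow_add)

lemma xpow_inverse_left [simp]: "xpow F (- t) * (xpow F t * f) = f" "xpow F t * (xpow F (- t) * f) = f"
  by (simp_all flip: mult.assoc)

lemma xpow_in_locring: "finite F \<Longrightarrow> xpow F t \<in> locring F"
  unfolding xpow_def by (rule locring_single) (auto simp: negs_def lookup_sum_single split: if_splits)

lemma xpow_nonneg_in_locring: "finite F \<Longrightarrow> 0 \<le> t \<Longrightarrow> xpow F t \<in> locring G"
  unfolding xpow_def by (rule locring_single) (auto simp: negs_def lookup_sum_single split: if_splits)

text \<open>Stated for all large \<open>t\<close>, so that the components of a vector can share one
  denominator.\<close>

lemma locring_denom:
  fixes f :: "('v::finite, 'k::field) laurent"
  assumes "f \<in> locring F"
  shows "\<exists>n. \<forall>t\<ge>n. xpow F (int t) * f \<in> locring {}"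
proof -
  define n where "n = (\<Sum>a\<in>keys f. \<Sum>v\<in>UNIV. nat \<bar>lookup a v\<bar>)"
  have "xpow F (int t) * f \<in> locring {}" if "t \<ge> n" for t
    unfolding locring_def
  proof (intro CollectI ballI)
    fix b assume "b \<in> keys (xpow F (int t) * f)"
    then obtain a where a: "a \<in> keys f" and b: "b = (\<Sum>v\<in>F. Poly_Mapping.single v (int t)) + a"
      unfolding xpow_def using keys_single_mult by blast
    have "lookup b v \<ge> 0" for v
    proof (cases "v \<in> F")
      case True
      have "nat \<bar>lookup a v\<bar> \<le> (\<Sum>v\<in>UNIV. nat \<bar>lookup a v\<bar>)"
        by (rule member_le_sum) auto
      also have "\<dots> \<le> n" unfolding n_def by (rule member_le_sum) (use a in auto)
      finally show ?thesis using that True by (simp add: b lookup_add lookup_sum_single)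
    next
      case False
      then have "lookup a v \<ge> 0" using assms a unfolding locring_def negs_def by force
      then show ?thesis using False by (simp add: b lookup_add lookup_sum_single)
    qed
    then show "negs b \<subseteq> {}" by (auto simp: negs_def not_less)
  qed
  then show ?thesis by blast
qed

subsection \<open>Homogeneous components\<close>

definition deg :: "('v::finite \<Rightarrow>\<^sub>0 int) \<Rightarrow> int" where
  "deg a = (\<Sum>v\<in>UNIV. lookup a v)"

lemma deg_add: "deg (a + b) = deg a + deg b"
  by (simp add: deg_def lookup_add sum.distrib)

lemma deg_zero [simp]: "deg 0 = 0"
  by (simp add: deg_def)

lemma deg_single [simp]: "deg (Poly_Mapping.single v t) = t"
  by (simp add: deg_def lookup_single when_def)

lemma deg_sum: "deg (sum f A) = (\<Sum>x\<in>A. deg (f x))"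
  by (induction A rule: infinite_finite_induct) (simp_all add: deg_add)

lemma homogeneous_alt: "homogeneous j f \<longleftrightarrow> (\<forall>a\<in>keys f. deg a = j)"
  by (simp add: homogeneous_def deg_def)

lemma homogeneous_zero [simp]: "homogeneous j 0"
  by (simp add: homogeneous_alt)

lemma homogeneous_one: "homogeneous 0 1"
  by (simp add: homogeneous_alt)

lemma homogeneous_add: "homogeneous j f \<Longrightarrow> homogeneous j g \<Longrightarrow> homogeneous j (f + g)"
  using keys_add[of f g] by (auto simp: homogeneous_alt)

lemma homogeneous_uminus: "homogeneous j f \<Longrightarrow> homogeneous j (- f)"
  by (simp add: homogeneous_alt keys_uminus)

lemma homogeneous_minus: "homogeneous j f \<Longrightarrow> homogeneous j g \<Longrightarrow> homogeneous j (f - g)"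
  using keys_minus_subset[of f g] by (auto simp: homogeneous_alt)

lemma homogeneous_sum: "(\<And>x. x \<in> A \<Longrightarrow> homogeneous j (f x)) \<Longrightarrow> homogeneous j (sum f A)"
  by (induction A rule: infinite_finite_induct) (auto intro: homogeneous_add)

lemma homogeneous_mult: "homogeneous i f \<Longrightarrow> homogeneous j g \<Longrightarrow> homogeneous (i + j) (f * g)"
  unfolding homogeneous_alt using keys_mult[of f g] by (force simp: deg_add)

lemma homogeneous_single: "deg a = j \<Longrightarrow> homogeneous j (Poly_Mapping.single a c)"
  by (simp add: homogeneous_alt)

lemma homogeneous_xpow: "homogeneous (int (card F) * t) (xpow F t)"
  unfolding xpow_def by (rule homogeneous_single) (simp add: deg_sum)

lemma homogeneous_sg: "homogeneous 0 (sg v F)"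
proof -
  have "homogeneous 0 ((- 1) ^ n)" for n
  proof (induction n)
    case (Suc n)
    from homogeneous_mult[OF homogeneous_uminus[OF homogeneous_one] this] show ?case by simp
  qed (simp add: homogeneous_one)
  then show ?thesis by (simp add: sg_def)
qed

lemma sg_in_locring: "sg v F \<in> locring G"
proof -
  have 1: "1 \<in> locring G" by (simp add: locring_def negs_def)
  have "(- 1) ^ n \<in> locring G" for n
  proof (induction n)
    case (Suc n)
    from locring_mult[OF locring_uminus[OF 1] this] show ?case by simp
  qed (simp add: 1)
  then show ?thesis by (simp add: sg_def)
qed

definition hcomp :: "int \<Rightarrow> ('v::finite, 'k::field) laurent \<Rightarrow> ('v, 'k) laurent" where
  "hcomp j f = Poly_Mapping.mapp (\<lambda>a c. c when deg a = j) f"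

lemma lookup_hcomp: "lookup (hcomp j f) a = (lookup f a when deg a = j)"
  by (simp add: hcomp_def lookup_mapp when_def in_keys_iff)

lemma keys_hcomp: "keys (hcomp j f) = {a \<in> keys f. deg a = j}"
  by (auto simp: in_keys_iff lookup_hcomp)

lemma hcomp_add: "hcomp j (f + g) = hcomp j f + hcomp j g"
  by (rule poly_mapping_eqI) (simp add: lookup_hcomp lookup_add when_add_distrib)

lemma hcomp_zero [simp]: "hcomp j 0 = 0"
  by (rule poly_mapping_eqI) (simp add: lookup_hcomp)

lemma hcomp_sum: "hcomp j (sum f A) = (\<Sum>x\<in>A. hcomp j (f x))"
  by (induction A rule: infinite_finite_induct) (simp_all add: hcomp_add)

lemma homogeneous_hcomp: "homogeneous j (hcomp j f)"
  by (simp add: homogeneous_alt keys_hcomp)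

lemma hcomp_homogeneous: "homogeneous j f \<Longrightarrow> hcomp i f = (if i = j then f else 0)"
  by (rule poly_mapping_eqI) (auto simp: lookup_hcomp when_def homogeneous_alt in_keys_iff)

lemma hcomp_locring: "f \<in> locring F \<Longrightarrow> hcomp j f \<in> locring F"
  by (simp add: locring_def keys_hcomp)

text \<open>The components of \<open>g\<close> in degrees other than \<open>j - e\<close> contribute
  nothing to degree \<open>j\<close>.\<close>

lemma hcomp_mult:
  assumes "homogeneous e f"
  shows "hcomp j (f * g) = f * hcomp (j - e) g"
proof -
  define h where "h = g - hcomp (j - e) g"
  have h: "deg b \<noteq> j - e" if "b \<in> keys h" for b
    using that by (auto simp: h_def in_keys_iff lookup_minus lookup_hcomp)
  have "hcomp j (f * h) = 0"
  proof (rule poly_mapping_eqI)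
    fix a
    have "deg a \<noteq> j" if a: "a \<in> keys (f * h)"
    proof -
      obtain b c where "a = b + c" "b \<in> keys f" "c \<in> keys h" using a keys_mult[of f h] by blast
      then show ?thesis using h[of c] assms by (simp add: homogeneous_alt deg_add)
    qed
    then show "lookup (hcomp j (f * h)) a = lookup 0 a"
      by (auto simp: lookup_hcomp when_def in_keys_iff)
  qed
  moreover have "homogeneous j (f * hcomp (j - e) g)"
    using homogeneous_mult[OF assms homogeneous_hcomp[of "j - e" g]] by simp
  then have "hcomp j (f * hcomp (j - e) g) = f * hcomp (j - e) g"
    by (simp add: hcomp_homogeneous)
  moreover have "f * g = f * hcomp (j - e) g + f * h"
    by (simp add: h_def algebra_simps)
  ultimately show ?thesis by (simp add: hcomp_add)
qed

lemma sum_hcomp: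
  assumes "finite D" "deg ` keys f \<subseteq> D"
  shows "(\<Sum>j\<in>D. hcomp j f) = f"
proof (rule poly_mapping_eqI)
  fix a
  have "lookup (\<Sum>j\<in>D. hcomp j f) a = (\<Sum>j\<in>D. if deg a = j then lookup f a else 0)"
    by (simp add: lookup_sum lookup_hcomp when_def)
  also have "\<dots> = lookup f a" using assms not_in_keys_iff_lookup_eq_zero[of a f] by auto
  finally show "lookup (\<Sum>j\<in>D. hcomp j f) a = lookup f a" .
qed

lemma locring_empty_deg_nonneg: "f \<in> locring {} \<Longrightarrow> a \<in> keys f \<Longrightarrow> 0 \<le> deg a"
  unfolding deg_def by (rule sum_nonneg) (auto simp: locring_def negs_def not_less)

lemma locring_empty_homogeneous_neg:
  "f \<in> locring {} \<Longrightarrow> homogeneous j f \<Longrightarrow> j < 0 \<Longrightarrow> f = 0"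
  using locring_empty_deg_nonneg[of f] by (intro poly_mapping_eqI) (force simp: homogeneous_alt in_keys_iff)

subsection \<open>Cech cohomology of families of submodules\<close>

definition vdiff :: "('v::{finite,linorder} set \<Rightarrow> nat \<Rightarrow> 'a::comm_ring_1) \<Rightarrow> 'v set \<Rightarrow> nat \<Rightarrow> 'a" where
  "vdiff c F = (\<lambda>r. cdiff (\<lambda>G. c G r) F)"

text \<open>
  A submodule \<open>M\<close> of a free module is given by all its localisations \<open>M F\<close> at the monomials $x_F$;
  \<open>vanish M i j\<close> then says that $H^i_{\mathfrak m}(M)_j = 0$.
\<close>

definition cochains :: "('v::finite set \<Rightarrow> (nat \<Rightarrow> ('v, 'k::field) laurent) set) \<Rightarrow> int \<Rightarrow> int
    \<Rightarrow> ('v set \<Rightarrow> nat \<Rightarrow> ('v, 'k) laurent) set" where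
  "cochains M i j = {c. \<forall>F. c F \<in> M F \<and> (\<forall>r. homogeneous j (c F r)) \<and>
     (int (card F) \<noteq> i \<longrightarrow> c F = (\<lambda>_. 0))}"

definition vanish :: "('v::{finite,linorder} set \<Rightarrow> (nat \<Rightarrow> ('v, 'k::field) laurent) set)
    \<Rightarrow> int \<Rightarrow> int \<Rightarrow> bool" where
  "vanish M i j \<longleftrightarrow>
     (\<forall>c\<in>cochains M i j. vdiff c = (\<lambda>_ _. 0) \<longrightarrow> c \<in> vdiff ` cochains M (i - 1) j)"

lemma vanishE:
  assumes "vanish M i j" "c \<in> cochains M i j" "vdiff c = (\<lambda>_ _. 0)"
  obtains b where "b \<in> cochains M (i - 1) j" "vdiff b = c"
  using assms unfolding vanish_def by blast

lemma cochainsD: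
  assumes "c \<in> cochains M i j"
  shows "c F \<in> M F" "homogeneous j (c F r)" "int (card F) \<noteq> i \<Longrightarrow> c F r = 0"
  using assms unfolding cochains_def by (blast, blast, fastforce)

lemma vdiff_vdiff [simp]: "vdiff (vdiff c) = (\<lambda>_ _. 0)"
  by (simp add: vdiff_def fun_eq_iff)

lemma vdiff_minus: "vdiff (\<lambda>F r. c F r - c' F r) = (\<lambda>F r. vdiff c F r - vdiff c' F r)"
  by (simp add: vdiff_def fun_eq_iff cdiff_diff)

lemma vanish_large:
  fixes M :: "'v::{finite,linorder} set \<Rightarrow> (nat \<Rightarrow> ('v, 'k::field) laurent) set"
  assumes "(\<lambda>_. 0) \<in> \<Inter> (range M)" "i > int (card (UNIV :: 'v set))"
  shows "vanish M i j"
  unfolding vanish_def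
proof (intro ballI impI)
  fix c assume c: "c \<in> cochains M i j"
  have "int (card F) \<noteq> i" for F :: "'v set"
    using assms(2) card_mono[of UNIV F] by auto
  then have "c = vdiff (\<lambda>_ _. 0)" using c by (auto simp: fun_eq_iff vdiff_def cochains_def)
  moreover have "(\<lambda>_ _. 0) \<in> cochains M (i - 1) j" using assms by (auto simp: cochains_def)
  ultimately show "c \<in> vdiff ` cochains M (i - 1) j" by blast
qed

text \<open>Submodules spanned by monomials in each component, with \<open>U r a\<close> recording
  where x^a is present. Free modules and monomial ideals are both of this form.\<close>

definition monmod :: "(nat \<Rightarrow> ('v \<Rightarrow>\<^sub>0 int) \<Rightarrow> 'v set set) \<Rightarrow> 'v set \<Rightarrow> (nat \<Rightarrow> ('v, 'k::field) laurent) set" where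
  "monmod U F = {u. \<forall>r. \<forall>a\<in>keys (u r). F \<in> U r a}"

lemma lookup_sg_mult: "lookup (sg v F * f) a = sg v F * lookup f a"
  by (cases "even (card {w \<in> F. w < v})") (simp_all add: sg_def)

lemma lookup_cdiff: "lookup (cdiff c F) a = cdiff (\<lambda>G. lookup (c G) a) F"
  by (simp add: cdiff_def lookup_sum lookup_sg_mult)

lemma vanish_monmodI:
  fixes U :: "nat \<Rightarrow> ('v::{finite,linorder} \<Rightarrow>\<^sub>0 int) \<Rightarrow> 'v set set"
  assumes ac: "\<And>r a. deg a = j \<Longrightarrow> acyclic_at TYPE('k::field) (U r a) i"
  shows "vanish (monmod U :: 'v set \<Rightarrow> (nat \<Rightarrow> ('v, 'k) laurent) set) i j"
  unfolding vanish_def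
proof (intro ballI impI)
  fix c :: "'v set \<Rightarrow> nat \<Rightarrow> ('v, 'k) laurent"
  assume c: "c \<in> cochains (monmod U) i j" and d: "vdiff c = (\<lambda>_ _. 0)"
  have "\<exists>b. cochain (U r a) (i - 1) b \<and> (\<forall>F. cdiff b F = lookup (c F r) a)" if a: "deg a = j" for r a
  proof -
    have "cochain (U r a) i (\<lambda>F. lookup (c F r) a)"
      unfolding cochain_def
    proof (intro allI impI)
      fix F assume "lookup (c F r) a \<noteq> 0"
      then have "a \<in> keys (c F r)" "c F r \<noteq> 0" by (auto simp: in_keys_iff)
      then show "F \<in> U r a \<and> int (card F) = i"
        using cochainsD[OF c, of F] by (auto simp: monmod_def)
    qed
    moreover have "cdiff (\<lambda>F. lookup (c F r) a) F = 0" for F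
    proof -
      have "vdiff c F r = 0" using d by simp
      then show ?thesis unfolding lookup_cdiff[symmetric] by (simp add: vdiff_def)
    qed
    ultimately show ?thesis using acyclic_atE[OF ac[OF a]] by metis
  qed
  note ex = this
  define \<beta> where "\<beta> r a = (SOME b. cochain (U r a) (i - 1) b \<and> (\<forall>F. cdiff b F = lookup (c F r) a))" for r a
  have "cochain (U r a) (i - 1) (\<beta> r a) \<and> (\<forall>F. cdiff (\<beta> r a) F = lookup (c F r) a)"
    if "deg a = j" for r a
    unfolding \<beta>_def by (rule someI_ex[OF ex[OF that]])
  then have \<beta>: "\<And>r a. deg a = j \<Longrightarrow> cochain (U r a) (i - 1) (\<beta> r a)"
      "\<And>r a F. deg a = j \<Longrightarrow> cdiff (\<beta> r a) F = lookup (c F r) a"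
    by blast+
  \<comment> \<open>Only finitely many multidegrees occur in component \<open>r\<close> of the
    cocycle, so the primitives chosen one multidegree at a time add up to a Laurent
    polynomial.\<close>
  define A where "A r = (\<Union>F. keys (c F r))" for r
  have A: "finite (A r)" for r by (simp add: A_def)
  have Aj: "deg a = j" if "a \<in> A r" for a r
    using that cochainsD(2)[OF c] by (auto simp: A_def homogeneous_alt)
  define b where "b F r = (\<Sum>a\<in>A r. Poly_Mapping.single a (\<beta> r a F))" for F r
  have b: "lookup (b F r) a = (if a \<in> A r then \<beta> r a F else 0)" for F r a
    using A by (simp add: b_def lookup_sum lookup_single when_def)
  have "b \<in> cochains (monmod U) (i - 1) j"
  proof -
    have "F \<in> U r a" "deg a = j" "int (card F) = i - 1" if "a \<in> keys (b F r)" for F r a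
    proof -
      have "a \<in> A r" "\<beta> r a F \<noteq> 0" using that by (auto simp: in_keys_iff b split: if_splits)
      then show "F \<in> U r a" "deg a = j" "int (card F) = i - 1"
        using \<beta>(1)[OF Aj, of a r] Aj by (auto simp: cochain_def)
    qed
    moreover from this have "b F r = 0" if "int (card F) \<noteq> i - 1" for F r
      by (intro poly_mapping_eqI) (metis in_keys_iff lookup_zero that)
    ultimately show ?thesis
      by (auto simp: cochains_def monmod_def homogeneous_alt fun_eq_iff)
  qed
  moreover have "vdiff b = c"
  proof (intro ext poly_mapping_eqI)
    fix F r a
    have "lookup (vdiff b F r) a = (if a \<in> A r then cdiff (\<beta> r a) F else 0)"
      by (simp add: vdiff_def lookup_cdiff b)
    also have "\<dots> = lookup (c F r) a"
      using \<beta>(2)[OF Aj, of a r r F] by (auto simp: A_def in_keys_iff)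
    finally show "lookup (vdiff b F r) a = lookup (c F r) a" .
  qed
  ultimately show "c \<in> vdiff ` cochains (monmod U) (i - 1) j" by blast
qed

text \<open>The scalar cocycle is placed on the one monomial x^a in component \<open>r\<close>; the
  coefficients of x^a in a primitive form a scalar primitive.\<close>

lemma vanish_monmodD:
  fixes U :: "nat \<Rightarrow> ('v::{finite,linorder} \<Rightarrow>\<^sub>0 int) \<Rightarrow> 'v set set"
  assumes v: "vanish (monmod U :: 'v set \<Rightarrow> (nat \<Rightarrow> ('v, 'k::field) laurent) set) i (deg a)"
  shows "acyclic_at TYPE('k) (U r a) i"
  unfolding acyclic_at_def
proof (intro allI impI)
  fix c :: "'v set \<Rightarrow> 'k"
  assume c: "cochain (U r a) i c" "\<forall>F. cdiff c F = 0"
  define C where "C F s = (if s = r then Poly_Mapping.single a (c F) else 0)" for F s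
  have "C \<in> cochains (monmod U) i (deg a)"
    using c(1) by (auto simp: cochains_def monmod_def C_def cochain_def homogeneous_alt fun_eq_iff
        split: if_splits)
  moreover have "vdiff C = (\<lambda>_ _. 0)"
  proof (intro ext poly_mapping_eqI)
    fix F s b
    show "lookup (vdiff C F s) b = lookup 0 b"
      using c(2) by (cases "s = r"; cases "a = b")
        (simp_all add: vdiff_def lookup_cdiff C_def lookup_single when_def)
  qed
  ultimately obtain B where B: "B \<in> cochains (monmod U) (i - 1) (deg a)" "vdiff B = C"
    using vanishE[OF v] by metis
  have "cochain (U r a) (i - 1) (\<lambda>F. lookup (B F r) a)"
    unfolding cochain_def
  proof (intro allI impI)
    fix F assume "lookup (B F r) a \<noteq> 0"
    then have "a \<in> keys (B F r)" "B F r \<noteq> 0" by (auto simp: in_keys_iff)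
    then show "F \<in> U r a \<and> int (card F) = i - 1"
      using cochainsD[OF B(1), of F] by (auto simp: monmod_def)
  qed
  moreover have "cdiff (\<lambda>F. lookup (B F r) a) F = c F" for F
  proof -
    have "lookup (vdiff B F r) a = lookup (C F r) a" using B by simp
    then show ?thesis by (simp add: vdiff_def lookup_cdiff C_def)
  qed
  ultimately show "\<exists>b. cochain (U r a) (i - 1) b \<and> (\<forall>F. cdiff b F = c F)" by blast
qed

text \<open>All localisations sit in one Laurent ring, so the map from \<open>M F\<close> to
  \<open>M G\<close> is an inclusion and the Cech differential needs no transition maps.\<close>

locale locmod =
  fixes M :: "'v::{finite,linorder} set \<Rightarrow> (nat \<Rightarrow> ('v, 'k::field) laurent) set"
  assumes zero: "(\<lambda>_. 0) \<in> M F"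
    and add: "u \<in> M F \<Longrightarrow> w \<in> M F \<Longrightarrow> (\<lambda>r. u r + w r) \<in> M F"
    and scale: "u \<in> M F \<Longrightarrow> f \<in> locring F \<Longrightarrow> (\<lambda>r. f * u r) \<in> M F"
    and mono: "F \<subseteq> G \<Longrightarrow> M F \<subseteq> M G"
begin

lemma diff: "u \<in> M F \<Longrightarrow> w \<in> M F \<Longrightarrow> (\<lambda>r. u r - w r) \<in> M F"
  using add[OF _ scale[of w F "- 1"], of u] locring_uminus[of 1 F]
  by (simp add: locring_def negs_def)

lemma sum: "(\<And>x. x \<in> A \<Longrightarrow> f x \<in> M F) \<Longrightarrow> (\<lambda>r. \<Sum>x\<in>A. f x r) \<in> M F"
  by (induction A rule: infinite_finite_induct) (auto intro: add zero)

lemma cochains_diff: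
  "c \<in> cochains M i j \<Longrightarrow> c' \<in> cochains M i j \<Longrightarrow> (\<lambda>F r. c F r - c' F r) \<in> cochains M i j"
  by (auto simp: cochains_def fun_eq_iff intro!: diff homogeneous_minus)

lemma cochains_sum:
  assumes "\<And>x. x \<in> A \<Longrightarrow> f x \<in> cochains M i j"
  shows "(\<lambda>F r. \<Sum>x\<in>A. f x F r) \<in> cochains M i j"
  using assms by (auto simp: cochains_def fun_eq_iff intro!: sum homogeneous_sum sum.neutral)

lemma cochains_vdiff:
  assumes "c \<in> cochains M i j"
  shows "vdiff c \<in> cochains M (i + 1) j"
proof -
  have "vdiff c F \<in> M F" for F
    unfolding vdiff_def cdiff_def
  proof (rule sum)
    fix v assume "v \<in> F"
    have "c (F - {v}) \<in> M F" using mono[of "F - {v}" F] cochainsD(1)[OF assms] by blast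
    then show "(\<lambda>r. sg v F * c (F - {v}) r) \<in> M F" by (rule scale) (rule sg_in_locring)
  qed
  moreover have "homogeneous j (vdiff c F r)" for F r
    unfolding vdiff_def cdiff_def
    using homogeneous_mult[OF homogeneous_sg cochainsD(2)[OF assms]]
    by (intro homogeneous_sum) simp
  moreover have "vdiff c F r = 0" if "int (card F) \<noteq> i + 1" for F r
    unfolding vdiff_def cdiff_def
  proof (rule sum.neutral, rule ballI)
    fix v assume "v \<in> F"
    then have "int (card (F - {v})) \<noteq> i" using that card_Suc_Diff1[of F v] by auto
    then show "sg v F * c (F - {v}) r = 0" using cochainsD(3)[OF assms] by simp
  qed
  ultimately show ?thesis by (auto simp: cochains_def fun_eq_iff)
qed

end

section \<open>Free modules, kernels and images of homogeneous matrices\<close>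

definition freemod :: "nat \<Rightarrow> 'v set \<Rightarrow> (nat \<Rightarrow> ('v, 'k::field) laurent) set" where
  "freemod b F = {u. (\<forall>r. u r \<in> locring F) \<and> (\<forall>r\<ge>b. u r = 0)}"

definition kermod :: "nat \<Rightarrow> nat \<Rightarrow> (nat \<Rightarrow> nat \<Rightarrow> ('v, 'k::field) laurent) \<Rightarrow> 'v set
    \<Rightarrow> (nat \<Rightarrow> ('v, 'k) laurent) set" where
  "kermod b b' A F = {u \<in> freemod b F. mat_apply b b' A u = (\<lambda>_. 0)}"

definition immod :: "nat \<Rightarrow> nat \<Rightarrow> (nat \<Rightarrow> nat \<Rightarrow> ('v, 'k::field) laurent) \<Rightarrow> 'v set
    \<Rightarrow> (nat \<Rightarrow> ('v, 'k) laurent) set" where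
  "immod b b' A F = mat_apply b b' A ` freemod b F"

definition forms :: "nat \<Rightarrow> nat \<Rightarrow> (nat \<Rightarrow> nat \<Rightarrow> ('v::finite, 'k::field) laurent) \<Rightarrow> int \<Rightarrow> bool" where
  "forms b b' A d \<longleftrightarrow> (\<forall>r<b'. \<forall>c<b. A r c \<in> locring {} \<and> homogeneous d (A r c))"

lemma mat_apply_zero [simp]: "mat_apply b b' A (\<lambda>_. 0) = (\<lambda>_. 0)"
  by (simp add: mat_apply_def fun_eq_iff)

lemma mat_apply_add: "mat_apply b b' A (\<lambda>r. u r + w r) = (\<lambda>r. mat_apply b b' A u r + mat_apply b b' A w r)"
  by (simp add: mat_apply_def fun_eq_iff algebra_simps sum.distrib)

lemma mat_apply_diff: "mat_apply b b' A (\<lambda>r. u r - w r) = (\<lambda>r. mat_apply b b' A u r - mat_apply b b' A w r)"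
  by (simp add: mat_apply_def fun_eq_iff algebra_simps sum_subtractf)

lemma mat_apply_scale: "mat_apply b b' A (\<lambda>r. f * u r) = (\<lambda>r. f * mat_apply b b' A u r)"
  by (simp add: mat_apply_def fun_eq_iff sum_distrib_left mult.left_commute)

lemma vdiff_mat_apply:
  "vdiff (\<lambda>F. mat_apply b b' A (u F)) = (\<lambda>F. mat_apply b b' A (vdiff u F))"
proof (intro ext)
  fix F r
  show "vdiff (\<lambda>F. mat_apply b b' A (u F)) F r = mat_apply b b' A (vdiff u F) r"
    by (cases "r < b'") (simp_all add: vdiff_def mat_apply_def cdiff_sum cdiff_mult)
qed

lemma locmod_freemod: "locmod (freemod b)"
  by unfold_locales
    (auto simp: freemod_def intro: locring_add locring_mult locring_mono[THEN subsetD])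

lemma locmod_kermod: "locmod (kermod b b' A)"
proof -
  interpret F: locmod "freemod b" by (rule locmod_freemod)
  show ?thesis
    by unfold_locales
      (use F.mono in \<open>auto simp: kermod_def mat_apply_add mat_apply_scale intro: F.zero F.add F.scale\<close>)
qed

lemma freemod_monmod:
  "(freemod b :: 'v set \<Rightarrow> (nat \<Rightarrow> ('v, 'k::field) laurent) set) = monmod (\<lambda>r a. {F. r < b \<and> negs a \<subseteq> F})"
proof (rule ext)
  fix F :: "'v set"
  show "(freemod b F :: (nat \<Rightarrow> ('v, 'k) laurent) set) = monmod (\<lambda>r a. {F. r < b \<and> negs a \<subseteq> F}) F"
    unfolding freemod_def monmod_def locring_def
  proof (intro set_eqI iffI; clarsimp)
    fix u :: "nat \<Rightarrow> ('v, 'k) laurent" and r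
    assume "\<forall>r. \<forall>a\<in>keys (u r). r < b \<and> negs a \<subseteq> F" "b \<le> r"
    then have "a \<notin> keys (u r)" for a by fastforce
    then show "u r = 0" by (intro poly_mapping_eqI) (simp add: in_keys_iff)
  qed (metis keys_zero empty_iff not_less)
qed

text \<open>A strand has no apex only if all exponents are negative. Then it is concentrated in
  cardinality n while j is at most -n, so i exceeds n.\<close>

lemma vanish_freemod:
  fixes i :: int
  assumes "1 \<le> i + j"
  shows "vanish (freemod b :: 'v::{finite,linorder} set \<Rightarrow> (nat \<Rightarrow> ('v, 'k::field) laurent) set) i j"
  unfolding freemod_monmod
proof (rule vanish_monmodI)
  fix r and a :: "'v \<Rightarrow>\<^sub>0 int" assume a: "deg a = j"
  show "acyclic_at TYPE('k) {F. r < b \<and> negs a \<subseteq> F} i"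
  proof (cases "negs a = UNIV")
    case True
    have "deg a \<le> (\<Sum>v\<in>(UNIV :: 'v set). - 1)"
    proof -
      have "lookup a v < 0" for v using True by (auto simp: negs_def)
      then show ?thesis unfolding deg_def by (intro sum_mono) (simp add: zle_diff1_eq[of _ 0, simplified])
    qed
    then have "int (card (UNIV :: 'v set)) < i" using a assms by simp
    then show ?thesis using True by (intro acyclic_at_large) (auto simp: top.extremum_unique)
  next
    case False
    then obtain v where "v \<notin> negs a" by blast
    then show ?thesis by (intro acyclic_at_cone[of v]) auto
  qed
qed

context
  fixes A :: "nat \<Rightarrow> nat \<Rightarrow> ('v::{finite,linorder}, 'k::field) laurent" and b b' :: nat and d :: int
  assumes A: "forms b b' A d"
begin

lemma mat_apply_homogeneous:
  assumes "\<And>r. homogeneous j (u r)"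
  shows "homogeneous (d + j) (mat_apply b b' A u r)"
  using A assms by (auto simp: mat_apply_def forms_def intro!: homogeneous_sum homogeneous_mult)

lemma mat_apply_hcomp:
  "mat_apply b b' A (\<lambda>r. hcomp (j - d) (u r)) = (\<lambda>r. hcomp j (mat_apply b b' A u r))"
proof
  fix r
  show "mat_apply b b' A (\<lambda>r. hcomp (j - d) (u r)) r = hcomp j (mat_apply b b' A u r)"
  proof (cases "r < b'")
    case True
    then have "hcomp j (A r c * u c) = A r c * hcomp (j - d) (u c)" if "c < b" for c
      using A that by (intro hcomp_mult) (simp add: forms_def)
    then show ?thesis using True by (simp add: mat_apply_def hcomp_sum)
  qed (simp add: mat_apply_def)
qed

lemma mat_apply_cochains:
  assumes "z \<in> cochains (freemod b) i (j - d)"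
  shows "(\<lambda>F. mat_apply b b' A (z F)) \<in> cochains (immod b b' A) i j"
proof -
  have "homogeneous j (mat_apply b b' A (z F) r)" for F r
    using mat_apply_homogeneous[of "j - d" "z F" r] cochainsD(2)[OF assms] by simp
  moreover have "mat_apply b b' A (z F) = (\<lambda>_. 0)" if "int (card F) \<noteq> i" for F
  proof -
    have "z F = (\<lambda>_. 0)" using cochainsD(3)[OF assms that] by auto
    then show ?thesis by simp
  qed
  ultimately show ?thesis using cochainsD(1)[OF assms] by (auto simp: cochains_def immod_def)
qed

text \<open>The values of a cochain at different \<open>F\<close> are independent, so each is lifted
  by itself; taking the component of degree \<open>j - d\<close> makes the lift homogeneous.\<close>

lemma im_lift:
  assumes c: "c \<in> cochains (immod b b' A) i j"
  obtains u where "u \<in> cochains (freemod b) i (j - d)" "\<And>F. mat_apply b b' A (u F) = c F"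
proof -
  interpret F: locmod "freemod b :: 'v set \<Rightarrow> (nat \<Rightarrow> ('v, 'k) laurent) set" by (rule locmod_freemod)
  have "\<exists>u\<in>freemod b F. (\<forall>r. homogeneous (j - d) (u r)) \<and> (int (card F) \<noteq> i \<longrightarrow> u = (\<lambda>_. 0))
      \<and> mat_apply b b' A u = c F" for F
  proof (cases "int (card F) = i")
    case True
    obtain u where u: "u \<in> freemod b F" "mat_apply b b' A u = c F"
      using cochainsD(1)[OF c, of F] by (auto simp: immod_def)
    let ?u = "\<lambda>r. hcomp (j - d) (u r)"
    have "mat_apply b b' A ?u = c F"
      by (simp add: mat_apply_hcomp u hcomp_homogeneous[OF cochainsD(2)[OF c]])
    moreover have "?u \<in> freemod b F"
      using u(1) by (auto simp: freemod_def hcomp_locring)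
    ultimately show ?thesis using True homogeneous_hcomp by (intro bexI[of _ ?u]) auto
  next
    case False
    have "c F = (\<lambda>_. 0)" using cochainsD(3)[OF c False] by auto
    then show ?thesis using F.zero by (intro bexI[of _ "\<lambda>_. 0"]) auto
  qed
  then obtain u where "\<And>F. u F \<in> freemod b F \<and> (\<forall>r. homogeneous (j - d) (u F r))
      \<and> (int (card F) \<noteq> i \<longrightarrow> u F = (\<lambda>_. 0)) \<and> mat_apply b b' A (u F) = c F" by metis
  then show thesis by (intro that[of u]) (auto simp: cochains_def)
qed

text \<open>In the long exact sequence of kernel, free module and image, H^i of the image sits
  between H^i of the free module and H^(i+1) of the kernel. The shift by \<open>d\<close> is the
  degree of the matrix entries.\<close>

lemma vanish_immod:
  assumes S: "vanish (freemod b :: 'v set \<Rightarrow> (nat \<Rightarrow> ('v, 'k) laurent) set) i (j - d)"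
    and K: "vanish (kermod b b' A) (i + 1) (j - d)"
  shows "vanish (immod b b' A) i j"
  unfolding vanish_def
proof (intro ballI impI)
  interpret F: locmod "freemod b :: 'v set \<Rightarrow> (nat \<Rightarrow> ('v, 'k) laurent) set" by (rule locmod_freemod)
  fix c assume c: "c \<in> cochains (immod b b' A) i j" and d: "vdiff c = (\<lambda>_ _. 0)"
  obtain u where u: "u \<in> cochains (freemod b) i (j - d)" "\<And>F. mat_apply b b' A (u F) = c F"
    by (rule im_lift[OF c]) blast
  have cu: "c = (\<lambda>F. mat_apply b b' A (u F))" using u by auto
  have "mat_apply b b' A (vdiff u F) = (\<lambda>_. 0)" for F
    using d unfolding cu vdiff_mat_apply by (rule fun_cong)
  then have "vdiff u \<in> cochains (kermod b b' A) (i + 1) (j - d)"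
    using F.cochains_vdiff[OF u(1)] by (auto simp: cochains_def kermod_def)
  then obtain w where w: "w \<in> cochains (kermod b b' A) (i + 1 - 1) (j - d)" "vdiff w = vdiff u"
    using vanishE[OF K] vdiff_vdiff by metis
  have w': "w \<in> cochains (freemod b) i (j - d)" and w0: "\<And>F. mat_apply b b' A (w F) = (\<lambda>_. 0)"
    using w(1) by (auto simp: cochains_def kermod_def)
  have "vdiff (\<lambda>F r. u F r - w F r) = (\<lambda>_ _. 0)" by (simp add: vdiff_minus w)
  then obtain z where z: "z \<in> cochains (freemod b) (i - 1) (j - d)" "vdiff z = (\<lambda>F r. u F r - w F r)"
    using vanishE[OF S F.cochains_diff[OF u(1) w']] by metis
  have "vdiff (\<lambda>F. mat_apply b b' A (z F)) = c"
    unfolding vdiff_mat_apply z(2) mat_apply_diff w0 u(2) by simp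
  then show "c \<in> vdiff ` cochains (immod b b' A) (i - 1) j"
    using mat_apply_cochains[OF z(1)] by blast
qed

text \<open>The next stretch of the same sequence: H^(i+1) of the kernel sits between H^i of the
  image and H^(i+1) of the free module.\<close>

lemma vanish_kermod:
  assumes M: "vanish (immod b b' A) i j"
    and S: "vanish (freemod b :: 'v set \<Rightarrow> (nat \<Rightarrow> ('v, 'k) laurent) set) (i + 1) (j - d)"
  shows "vanish (kermod b b' A) (i + 1) (j - d)"
  unfolding vanish_def
proof (intro ballI impI)
  interpret F: locmod "freemod b :: 'v set \<Rightarrow> (nat \<Rightarrow> ('v, 'k) laurent) set" by (rule locmod_freemod)
  fix k assume k: "k \<in> cochains (kermod b b' A) (i + 1) (j - d)" and d: "vdiff k = (\<lambda>_ _. 0)"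
  have k': "k \<in> cochains (freemod b) (i + 1) (j - d)" and k0: "\<And>F. mat_apply b b' A (k F) = (\<lambda>_. 0)"
    using k by (auto simp: cochains_def kermod_def)
  obtain z where z: "z \<in> cochains (freemod b) (i + 1 - 1) (j - d)" "vdiff z = k"
    using vanishE[OF S k' d] .
  then have z1: "z \<in> cochains (freemod b) i (j - d)" by simp
  have "vdiff (\<lambda>F. mat_apply b b' A (z F)) = (\<lambda>_ _. 0)"
    unfolding vdiff_mat_apply z(2) k0 ..
  then obtain y where y: "y \<in> cochains (immod b b' A) (i - 1) j" "vdiff y = (\<lambda>F. mat_apply b b' A (z F))"
    using vanishE[OF M mat_apply_cochains[OF z1]] by metis
  obtain w where w: "w \<in> cochains (freemod b) (i - 1) (j - d)" "\<And>F. mat_apply b b' A (w F) = y F"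
    by (rule im_lift[OF y(1)]) blast
  let ?e = "\<lambda>F r. z F r - vdiff w F r"
  have "vdiff w \<in> cochains (freemod b) i (j - d)"
    using F.cochains_vdiff[OF w(1)] by simp
  then have e: "?e \<in> cochains (freemod b) i (j - d)"
    by (rule F.cochains_diff[OF z1])
  have yw: "y = (\<lambda>F. mat_apply b b' A (w F))" using w by auto
  have "mat_apply b b' A (vdiff w F) = mat_apply b b' A (z F)" for F
    using y(2) unfolding yw vdiff_mat_apply by (rule fun_cong)
  then have "mat_apply b b' A (?e F) = (\<lambda>_. 0)" for F
    by (simp add: mat_apply_diff)
  then have "?e \<in> cochains (kermod b b' A) (i + 1 - 1) (j - d)"
    using e by (auto simp: cochains_def kermod_def)
  moreover have "vdiff ?e = k" by (simp add: vdiff_minus z)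
  ultimately show "k \<in> vdiff ` cochains (kermod b b' A) (i + 1 - 1) (j - d)" by blast
qed

end

subsection \<open>Generation by elements of lowest degree\<close>

abbreviation xv :: "'v \<Rightarrow> ('v, 'k::field) laurent" where
  "xv v \<equiv> xpow {v} 1"

lemma xv_xpow:
  assumes "v \<notin> P" "finite P"
  shows "xv v * xpow (insert v P) (- 1) = xpow P (- 1)"
  using assms by (simp add: xpow_def mult_single flip: add.assoc single_add)

lemma homogeneous_xv: "homogeneous 1 (xv v)"
  using homogeneous_xpow[of "{v}" 1] by simp

text \<open>
  In the double complex with entries \<open>b P F\<close>, Koszul in \<open>P\<close> and Cech in \<open>F\<close>, the diagonal
  elements $m / x_P$ at \<open>F = P\<close> have matching differentials. Vanishing cohomology corrects them, from
  large \<open>P\<close> down to the empty set, by Koszul boundaries; at the empty set this exhibits \<open>m\<close> itself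
  as a boundary.
\<close>

lemma (in locmod) generated_step:
  assumes R: "\<And>i j'. d + 1 \<le> i + j' \<Longrightarrow> vanish M i j'"
    and m: "m \<in> M {}" "\<And>r. homogeneous j (m r)" and j: "d + 1 \<le> j"
  shows "\<exists>g. (\<forall>v. g v \<in> M {}) \<and> (\<forall>v r. homogeneous (j - 1) (g v r)) \<and>
    m = (\<lambda>r. \<Sum>v\<in>UNIV. xv v * g v r)"
proof -
  define c where "c P F r = (if F = P then xpow P (- 1) * m r else 0)" for P F r
  define del where "del b P F r = (\<Sum>v\<in>- P. sg v P * (xv v * b (insert v P) F r))"
    for b :: "'v set \<Rightarrow> 'v set \<Rightarrow> nat \<Rightarrow> ('v, 'k) laurent" and P F r
  have c: "c P \<in> cochains M (int (card P)) (j - int (card P))" for P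
  proof -
    have "(\<lambda>r. xpow P (- 1) * m r) \<in> M P"
      using mono[of "{}" P] m(1) xpow_in_locring[of P] by (intro scale) auto
    moreover have "homogeneous (j - int (card P)) (xpow P (- 1) * m r)" for r
      using homogeneous_mult[OF homogeneous_xpow[of P "- 1"] m(2)[of r]] by simp
    moreover have "c P F = (if F = P then (\<lambda>r. xpow P (- 1) * m r) else (\<lambda>_. 0))" for F
      by (auto simp: c_def)
    ultimately show ?thesis
      using zero by (simp add: cochains_def)
  qed
  have del: "del b P \<in> cochains M (int (card P)) (j - int (card P))"
    if b: "\<And>v. v \<notin> P \<Longrightarrow> b (insert v P) \<in> cochains M (int (card P)) (j - int (card P) - 1)" for b P
    unfolding del_def[abs_def]
  proof (rule cochains_sum)
    fix v assume "v \<in> - P"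
    then have b: "b (insert v P) \<in> cochains M (int (card P)) (j - int (card P) - 1)" using b by simp
    have "(\<lambda>r. sg v P * (xv v * b (insert v P) F r)) \<in> M F" for F
      using cochainsD(1)[OF b, of F] by (intro scale sg_in_locring xpow_nonneg_in_locring) auto
    moreover have "homogeneous (j - int (card P)) (sg v P * (xv v * b (insert v P) F r))" for F r
      using homogeneous_mult[OF homogeneous_sg homogeneous_mult[OF homogeneous_xv cochainsD(2)[OF b]]]
      by simp
    ultimately show "(\<lambda>F r. sg v P * (xv v * b (insert v P) F r)) \<in> cochains M (int (card P)) (j - int (card P))"
      using cochainsD(3)[OF b] by (auto simp: cochains_def)
  qed
  have deldel: "del (\<lambda>P. del b P) P F r = 0" for b P F r
  proof -
    have "del (\<lambda>P. del b P) P F r = (\<Sum>v\<in>- P. \<Sum>w\<in>- P - {v}.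
        sg v P * sg w (insert v P) * (xv v * xv w * b (insert w (insert v P)) F r))"
    proof -
      have "- insert v P = - P - {v}" for v by auto
      then show ?thesis by (simp add: del_def sum_distrib_left algebra_simps)
    qed
    also have "\<dots> = 0"
    proof (rule sum_antisym_zero)
      fix v w assume "v \<in> - P" "w \<in> - P" "v \<noteq> w"
      then have sw: "sg v P * sg w (insert v P) = - (sg w P * sg v (insert w P) :: ('v, 'k) laurent)"
        by (intro sg_swap_insert) auto
      have "xv v * xv w * b (insert w (insert v P)) F r = xv w * xv v * b (insert v (insert w P)) F r"
        by (simp add: insert_commute[of v w] mult.commute[of "xv v" "xv w"])
      then show "sg v P * sg w (insert v P) * (xv v * xv w * b (insert w (insert v P)) F r)
          = - (sg w P * sg v (insert w P) * (xv w * xv v * b (insert v (insert w P)) F r))"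
        unfolding sw by simp
    qed simp
    finally show ?thesis .
  qed
  \<comment> \<open>Both sides live at the sets \<open>F\<close> obtained from \<open>P\<close> by
    adding one variable \<open>w\<close>; there x_w times m / x_F is m / x_P, with equal
    signs.\<close>
  have dc: "vdiff (c P) F r = del c P F r" for P F r
  proof -
    have L: "vdiff (c P) F r = (\<Sum>v\<in>F. if F - {v} = P then sg v P * (xpow P (- 1) * m r) else 0)"
      unfolding vdiff_def cdiff_def c_def
    proof (rule sum.cong[OF refl])
      fix v
      show "sg v F * (if F - {v} = P then xpow P (- 1) * m r else 0)
          = (if F - {v} = P then sg v P * (xpow P (- 1) * m r) else 0)"
        using sg_remove_self[of v F, where 'a = "('v, 'k) laurent"] by auto
    qed
    have R: "del c P F r = (\<Sum>v\<in>- P. if F = insert v P then sg v P * (xpow P (- 1) * m r) else 0)"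
      unfolding del_def c_def
    proof (rule sum.cong[OF refl])
      fix v assume "v \<in> - P"
      then have "xv v * (xpow (insert v P) (- 1) * m r) = xpow P (- 1) * m r"
        by (simp add: xv_xpow flip: mult.assoc)
      then show "sg v P * (xv v * (if F = insert v P then xpow (insert v P) (- 1) * m r else 0))
          = (if F = insert v P then sg v P * (xpow P (- 1) * m r) else 0)"
        by simp
    qed
    show ?thesis
    proof (cases "\<exists>w. w \<notin> P \<and> F = insert w P")
      case True
      then obtain w where w: "w \<notin> P" "F = insert w P" by blast
      have "F - {v} = P \<longleftrightarrow> v = w" if "v \<in> F" for v using w that by auto
      then have "vdiff (c P) F r = (\<Sum>v\<in>F. if v = w then sg v P * (xpow P (- 1) * m r) else 0)"
        unfolding L by (intro sum.cong) auto
      also have "\<dots> = sg w P * (xpow P (- 1) * m r)" using w by simp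
      also have "\<dots> = (\<Sum>v\<in>- P. if v = w then sg v P * (xpow P (- 1) * m r) else 0)"
        using w by simp
      also have "\<dots> = del c P F r"
        unfolding R using w by (intro sum.cong) auto
      finally show ?thesis .
    next
      case False
      have "F - {v} \<noteq> P" if "v \<in> F" for v using False that by (metis Diff_iff insertI1 insert_Diff)
      moreover have "F \<noteq> insert v P" if "v \<in> - P" for v using False that by auto
      ultimately show ?thesis unfolding L R by simp
    qed
  qed
  \<comment> \<open>The recursion descends from larger to smaller sets: \<open>del b P\<close> reads
    \<open>b\<close> at the sets \<open>insert v P\<close> only.\<close>
  have "\<exists>b. \<forall>P. b P \<in> cochains M (int (card P) - 1) (j - int (card P)) \<and>
      vdiff (b P) = (\<lambda>F r. c P F r - del b P F r)"
  proof (rule dependent_wf_choice[of "{(P', P). P \<subset> P'}"])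
    show "wf {(P', P :: 'v set). P \<subset> P'}"
    proof (rule wf_subset)
      show "wf (measure (\<lambda>P :: 'v set. card (- P)))" by simp
      show "{(P', P). P \<subset> P'} \<subseteq> measure (\<lambda>P :: 'v set. card (- P))"
        by (auto intro!: psubset_card_mono)
    qed
  next
    fix f g :: "'v set \<Rightarrow> 'v set \<Rightarrow> nat \<Rightarrow> ('v, 'k) laurent" and P r
    assume fg: "\<And>z. (z, P) \<in> {(P', P). P \<subset> P'} \<Longrightarrow> f z = g z"
    have "f (insert v P) = g (insert v P)" if "v \<in> - P" for v
      using fg that by blast
    then have "del f P = del g P"
      unfolding del_def by (intro ext sum.cong refl) simp
    then show "(r \<in> cochains M (int (card P) - 1) (j - int (card P)) \<and>
          vdiff r = (\<lambda>F s. c P F s - del f P F s)) \<longleftrightarrow>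
        (r \<in> cochains M (int (card P) - 1) (j - int (card P)) \<and>
          vdiff r = (\<lambda>F s. c P F s - del g P F s))" by simp
  next
    fix P and b :: "'v set \<Rightarrow> 'v set \<Rightarrow> nat \<Rightarrow> ('v, 'k) laurent"
    assume IH: "\<And>Q. (Q, P) \<in> {(P', P). P \<subset> P'} \<Longrightarrow>
        b Q \<in> cochains M (int (card Q) - 1) (j - int (card Q)) \<and>
        vdiff (b Q) = (\<lambda>F r. c Q F r - del b Q F r)"
    have b: "b (insert v P) \<in> cochains M (int (card P)) (j - int (card P) - 1)"
        "vdiff (b (insert v P)) = (\<lambda>F r. c (insert v P) F r - del b (insert v P) F r)"
      if v: "v \<notin> P" for v
    proof -
      have "(insert v P, P) \<in> {(P', P). P \<subset> P'}" using v by auto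
      from IH[OF this] show "b (insert v P) \<in> cochains M (int (card P)) (j - int (card P) - 1)"
        "vdiff (b (insert v P)) = (\<lambda>F r. c (insert v P) F r - del b (insert v P) F r)"
        using v by (simp_all add: algebra_simps)
    qed
    let ?z = "\<lambda>F r. c P F r - del b P F r"
    have z: "?z \<in> cochains M (int (card P)) (j - int (card P))"
      by (intro cochains_diff c del b)
    have dz: "vdiff ?z = (\<lambda>_ _. 0)"
    proof (intro ext)
      fix F r
      have "vdiff (del b P) F r = del (\<lambda>P. vdiff (b P)) P F r"
        by (simp add: vdiff_def del_def cdiff_sum cdiff_mult)
      also have "\<dots> = del (\<lambda>P F r. c P F r - del b P F r) P F r"
        unfolding del_def by (intro sum.cong refl) (simp add: b(2) del_def)
      also have "\<dots> = del c P F r - del (\<lambda>P. del b P) P F r"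
        unfolding del_def by (simp add: algebra_simps sum_subtractf)
      finally show "vdiff ?z F r = 0"
        by (simp add: vdiff_minus dc deldel)
    qed
    \<comment> \<open>Cohomological and internal degree add up to \<open>j\<close> for every
      \<open>P\<close>, which is why a single bound on the sum serves the entire chase.\<close>
    have "vanish M (int (card P)) (j - int (card P))" using j by (intro R) simp
    from vanishE[OF this z dz] show "\<exists>y. y \<in> cochains M (int (card P) - 1) (j - int (card P)) \<and> vdiff y = ?z"
      by blast
  qed
  then obtain b where b: "\<And>P. b P \<in> cochains M (int (card P) - 1) (j - int (card P))"
      "\<And>P. vdiff (b P) = (\<lambda>F r. c P F r - del b P F r)" by blast
  have "c {} {} r = del b {} {} r" for r
  proof -
    \<comment> \<open>At the empty set the Cech differential is an empty sum, so no Cech boundary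
      obscures the equation there.\<close>
    have "vdiff (b {}) {} r = 0" by (simp add: vdiff_def cdiff_def)
    then show ?thesis using b(2)[of "{}"] by (simp add: fun_eq_iff)
  qed
  then have "m r = (\<Sum>v\<in>UNIV. xv v * b {v} {} r)" for r
    by (simp add: c_def del_def xpow_def)
  moreover have "b {v} {} \<in> M {}" "homogeneous (j - 1) (b {v} {} r)" for v r
    using cochainsD[OF b(1)[of "{v}"], of "{}"] by simp_all
  ultimately show ?thesis by (intro exI[of _ "\<lambda>v. b {v} {}"]) auto
qed

text \<open>For a \<open>locmod\<close> this makes \<open>M F\<close> the localisation of
  \<open>M {}\<close>, so inclusions and exactness need checking over the polynomial ring
  only.\<close>

definition has_denoms :: "('v set \<Rightarrow> (nat \<Rightarrow> ('v, 'k::field) laurent) set) \<Rightarrow> bool" where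
  "has_denoms M \<longleftrightarrow> (\<forall>F. \<forall>u\<in>M F. \<exists>t. (\<lambda>r. xpow F (int t) * u r) \<in> M {})"

lemma has_denoms_subset:
  fixes M M' :: "'v::{finite,linorder} set \<Rightarrow> (nat \<Rightarrow> ('v, 'k::field) laurent) set"
  assumes M: "has_denoms M" and M': "locmod M'" and sub: "M {} \<subseteq> M' {}"
  shows "M F \<subseteq> M' F"
proof
  interpret M': locmod M' by fact
  fix u assume "u \<in> M F"
  then obtain t where "(\<lambda>r. xpow F (int t) * u r) \<in> M {}" using M by (auto simp: has_denoms_def)
  then have "(\<lambda>r. xpow F (int t) * u r) \<in> M' F" using sub M'.mono[of "{}" F] by auto
  then have "(\<lambda>r. xpow F (- int t) * (xpow F (int t) * u r)) \<in> M' F"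
    by (rule M'.scale) (simp add: xpow_in_locring)
  then show "u \<in> M' F" by simp
qed

lemma has_denoms_freemod:
  "has_denoms (freemod b :: 'v::finite set \<Rightarrow> (nat \<Rightarrow> ('v, 'k::field) laurent) set)"
  unfolding has_denoms_def
proof (intro allI ballI)
  fix F and u :: "nat \<Rightarrow> ('v, 'k) laurent" assume u: "u \<in> freemod b F"
  then have "\<exists>n. \<forall>t\<ge>n. xpow F (int t) * u r \<in> locring {}" for r
    using locring_denom by (auto simp: freemod_def)
  then obtain n where n: "\<And>r t. t \<ge> n r \<Longrightarrow> xpow F (int t) * u r \<in> locring {}" by metis
  let ?t = "\<Sum>r<b. n r"
  have "xpow F (int ?t) * u r \<in> locring {}" for r
  proof (cases "r < b")
    case True
    then show ?thesis by (intro n member_le_sum) auto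
  next
    case False
    then show ?thesis using u by (simp add: freemod_def)
  qed
  then show "\<exists>t. (\<lambda>r. xpow F (int t) * u r) \<in> freemod b {}"
    using u by (intro exI[of _ ?t]) (auto simp: freemod_def)
qed

lemma has_denoms_kermod:
  "has_denoms (kermod b b' A :: 'v::finite set \<Rightarrow> (nat \<Rightarrow> ('v, 'k::field) laurent) set)"
  unfolding has_denoms_def
proof (intro allI ballI)
  fix F and u :: "nat \<Rightarrow> ('v, 'k) laurent" assume u: "u \<in> kermod b b' A F"
  then obtain t where "(\<lambda>r. xpow F (int t) * u r) \<in> freemod b {}"
    using has_denoms_freemod[of b] unfolding has_denoms_def kermod_def by blast
  then show "\<exists>t. (\<lambda>r. xpow F (int t) * u r) \<in> kermod b b' A {}"
    using u by (auto simp: kermod_def mat_apply_scale)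
qed

lemma has_denoms_immod:
  "has_denoms (immod b b' A :: 'v::finite set \<Rightarrow> (nat \<Rightarrow> ('v, 'k::field) laurent) set)"
  unfolding has_denoms_def
proof (intro allI ballI)
  fix F and w :: "nat \<Rightarrow> ('v, 'k) laurent" assume "w \<in> immod b b' A F"
  then obtain u where u: "u \<in> freemod b F" "w = mat_apply b b' A u" by (auto simp: immod_def)
  then obtain t where "(\<lambda>r. xpow F (int t) * u r) \<in> freemod b {}"
    using has_denoms_freemod[of b] unfolding has_denoms_def by blast
  then have "mat_apply b b' A (\<lambda>r. xpow F (int t) * u r) \<in> immod b b' A {}"
    by (auto simp: immod_def)
  then show "\<exists>t. (\<lambda>r. xpow F (int t) * w r) \<in> immod b b' A {}"
    unfolding u(2) mat_apply_scale by blast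
qed

lemma locmod_immod: "locmod (immod b b' A)"
proof
  interpret F: locmod "freemod b :: 'a set \<Rightarrow> (nat \<Rightarrow> ('a, 'b) laurent) set" by (rule locmod_freemod)
  fix F G :: "'a set" and u w and f :: "('a, 'b) laurent"
  show "(\<lambda>_. 0) \<in> immod b b' A F"
    unfolding immod_def by (rule image_eqI[OF _ F.zero]) simp
  show "(\<lambda>r. f * u r) \<in> immod b b' A F" if "u \<in> immod b b' A F" "f \<in> locring F"
    using that F.scale unfolding immod_def by (auto simp flip: mat_apply_scale)
  show "(\<lambda>r. u r + w r) \<in> immod b b' A F" if "u \<in> immod b b' A F" "w \<in> immod b b' A F"
    using that F.add unfolding immod_def by (auto simp flip: mat_apply_add)
  show "immod b b' A F \<subseteq> immod b b' A G" if "F \<subseteq> G"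
    using F.mono[OF that] unfolding immod_def by blast
qed

lemma finite_exponents: "finite {a :: 'v::finite \<Rightarrow>\<^sub>0 int. negs a = {} \<and> deg a = d}"
proof (rule finite_imageD)
  show "inj_on lookup {a :: 'v \<Rightarrow>\<^sub>0 int. negs a = {} \<and> deg a = d}"
    by (auto simp: inj_on_def intro: poly_mapping_eqI)
  have "lookup a v \<in> {0..d}" if "negs a = {}" "deg a = d" for a :: "'v \<Rightarrow>\<^sub>0 int" and v
  proof -
    have nn: "0 \<le> lookup a v" for v using that by (auto simp: negs_def not_less)
    have "lookup a v \<le> deg a" unfolding deg_def by (rule member_le_sum) (auto simp: nn)
    then show ?thesis using that nn by simp
  qed
  then have "lookup ` {a :: 'v \<Rightarrow>\<^sub>0 int. negs a = {} \<and> deg a = d}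
      \<subseteq> {f. \<forall>x. (x \<in> UNIV \<longrightarrow> f x \<in> {0..d}) \<and> (x \<notin> UNIV \<longrightarrow> f x = 0)}"
    by auto
  then show "finite (lookup ` {a :: 'v \<Rightarrow>\<^sub>0 int. negs a = {} \<and> deg a = d})"
    by (rule finite_subset) (intro finite_set_of_finite_funs; simp)
qed

section \<open>Linear algebra over the field in a single degree\<close>

definition vscale :: "'k::field \<Rightarrow> (nat \<Rightarrow> ('v, 'k) laurent) \<Rightarrow> nat \<Rightarrow> ('v, 'k) laurent" where
  "vscale k u = (\<lambda>r. Poly_Mapping.single 0 k * u r)"

interpretation vs: vector_space vscale
  by unfold_locales
    (auto simp: vscale_def fun_eq_iff algebra_simps single_add mult_single simp flip: mult.assoc)

lemma sum_fun_apply: "(\<Sum>x\<in>A. f x) r = (\<Sum>x\<in>A. f x r :: 'a::comm_monoid_add)"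
  by (induction A rule: infinite_finite_induct) simp_all

lemma homogeneous_finite_span:
  fixes b' :: nat
  shows "\<exists>T. finite T \<and>
    {u \<in> freemod b' {}. \<forall>r. homogeneous d (u r)} \<subseteq> vs.span (T :: (nat \<Rightarrow> ('v::finite, 'k::field) laurent) set)"
proof -
  let ?X = "{a :: 'v \<Rightarrow>\<^sub>0 int. negs a = {} \<and> deg a = d}"
  define e where "e = (\<lambda>(s :: nat, a). \<lambda>r. if r = s then Poly_Mapping.single a 1 else (0 :: ('v, 'k) laurent))"
  let ?T = "e ` ({..<b'} \<times> ?X)"
  have "u \<in> vs.span ?T" if u: "u \<in> freemod b' {}" "\<And>r. homogeneous d (u r)" for u
  proof -
    have keys: "a \<in> ?X" if "a \<in> keys (u r)" for a r
      using u that by (auto simp: freemod_def locring_def homogeneous_alt)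
    have "u = (\<Sum>s<b'. \<Sum>a\<in>keys (u s). vscale (lookup (u s) a) (e (s, a)))"
    proof
      fix r
      have "(\<Sum>s<b'. \<Sum>a\<in>keys (u s). vscale (lookup (u s) a) (e (s, a))) r
          = (\<Sum>s<b'. if s = r then u s else 0)"
        unfolding sum_fun_apply
      proof (rule sum.cong[OF refl])
        fix s
        show "(\<Sum>a\<in>keys (u s). vscale (lookup (u s) a) (e (s, a)) r) = (if s = r then u s else 0)"
        proof (cases "s = r")
          case True
          then show ?thesis
            by (simp add: vscale_def e_def mult_single poly_mapping_sum_single)
        qed (simp add: vscale_def e_def)
      qed
      also have "\<dots> = u r" using u(1) by (auto simp: freemod_def)
      finally show "u r = (\<Sum>s<b'. \<Sum>a\<in>keys (u s). vscale (lookup (u s) a) (e (s, a))) r" ..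
    qed
    also have "\<dots> \<in> vs.span ?T"
      using keys by (intro vs.span_sum vs.span_scale vs.span_base) blast
    finally show ?thesis .
  qed
  moreover have "finite ?T" using finite_exponents by auto
  ultimately show ?thesis by blast
qed

subsection \<open>Linear resolutions and vanishing of Cech cohomology\<close>

lemma locring_empty_homogeneous_0:
  assumes "f \<in> locring {}" "homogeneous 0 f"
  shows "f = Poly_Mapping.single 0 (lookup f 0)"
proof (rule poly_mapping_eqI)
  fix a
  show "lookup f a = lookup (Poly_Mapping.single 0 (lookup f 0)) a"
  proof (cases "a \<in> keys f")
    case True
    then have nn: "\<And>v. 0 \<le> lookup a v" and "deg a = 0"
      using assms by (auto simp: locring_def negs_def not_less homogeneous_alt)
    then have "lookup a v = 0" for v by (simp add: deg_def sum_nonneg_eq_0_iff)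
    then have "a = 0" by (intro poly_mapping_eqI) simp
    then show ?thesis by simp
  next
    case False
    then show ?thesis by (auto simp: in_keys_iff lookup_single when_def)
  qed
qed

text \<open>The columns of \<open>A\<close> are a basis of the degree \<open>d\<close> part, not
  merely generators. Independence keeps constant vectors out of the kernel, so the kernel starts in
  degree 1 and the construction can be repeated with 1 in place of \<open>d\<close>.\<close>

lemma minimal_cover:
  fixes M :: "'v::{finite,linorder} set \<Rightarrow> (nat \<Rightarrow> ('v, 'k::field) laurent) set"
  assumes M: "locmod M" and den: "has_denoms M" and sub: "M {} \<subseteq> freemod b' {}"
    and graded: "\<And>u j. u \<in> M {} \<Longrightarrow> (\<lambda>r. hcomp j (u r)) \<in> M {}"
    and R: "\<And>i j. d + 1 \<le> i + j \<Longrightarrow> vanish M i j"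
    and low: "\<And>u j. u \<in> M {} \<Longrightarrow> (\<And>r. homogeneous j (u r)) \<Longrightarrow> j < d \<Longrightarrow> u = (\<lambda>_. 0)"
  shows "\<exists>b A. forms b b' A d \<and> immod b b' A = M \<and>
    (\<forall>u j. u \<in> kermod b b' A {} \<longrightarrow> (\<forall>r. homogeneous j (u r)) \<longrightarrow> j < 1 \<longrightarrow> u = (\<lambda>_. 0))"
proof -
  interpret M: locmod M by fact
  define V where "V = {u \<in> M {}. \<forall>r. homogeneous d (u r)}"
  obtain T :: "(nat \<Rightarrow> ('v, 'k) laurent) set"
    where T: "finite T" "{u \<in> freemod b' {}. \<forall>r. homogeneous d (u r)} \<subseteq> vs.span T"
    using homogeneous_finite_span by blast
  obtain B where B: "B \<subseteq> V" "vs.independent B" "V \<subseteq> vs.span B"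
    using vs.maximal_independent_subset by blast
  have "B \<subseteq> vs.span T" using B(1) sub T(2) unfolding V_def by blast
  then have fin: "finite B" using vs.independent_span_bound[OF T(1) B(2)] by blast
  define b where "b = card B"
  obtain f where f: "bij_betw f {..<b} B"
    using ex_bij_betw_nat_finite[OF fin] unfolding b_def atLeast0LessThan by blast
  define A where "A r c = f c r" for r c
  have fV: "f c \<in> V" if "c < b" for c using f B(1) that unfolding bij_betw_def by blast
  have f0: "f c r = 0" if "c < b" "b' \<le> r" for c r
    using fV[OF that(1)] sub that(2) unfolding V_def freemod_def by blast
  have forms: "forms b b' A d"
    using fV sub unfolding forms_def A_def V_def freemod_def by blast
  have app: "mat_apply b b' A u = (\<lambda>r. \<Sum>c<b. u c * f c r)" for u
    using f0 by (auto simp: mat_apply_def A_def fun_eq_iff not_less mult.commute)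
  have imM: "immod b b' A F \<subseteq> M F" for F
  proof
    fix w assume "w \<in> immod b b' A F"
    then obtain u where u: "u \<in> freemod b F" "w = (\<lambda>r. \<Sum>c<b. u c * f c r)"
      unfolding immod_def app by blast
    show "w \<in> M F"
      unfolding u(2)
    proof (rule M.sum)
      fix c assume "c \<in> {..<b}"
      then have "f c \<in> M {}" using fV unfolding V_def by blast
      then have "f c \<in> M F" using M.mono[of "{}" F] by blast
      then show "(\<lambda>r. u c * f c r) \<in> M F"
        using u(1) by (intro M.scale) (simp_all add: freemod_def)
    qed
  qed
  interpret I: locmod "immod b b' A" by (rule locmod_immod)
  \<comment> \<open>Induction on the distance from degree \<open>d\<close>:
    \<open>generated_step\<close> writes an element as a combination of elements one degree lower
    with the variables as coefficients.\<close>
  have hom: "\<forall>u\<in>M {}. (\<forall>r. homogeneous (d + int n) (u r)) \<longrightarrow> u \<in> immod b b' A {}" for n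
  proof (induction n)
    case 0
    show ?case
    proof (intro ballI impI)
      fix u assume u: "u \<in> M {}" "\<forall>r. homogeneous (d + int 0) (u r)"
      then have "u \<in> vs.span B" using B(3) unfolding V_def by auto
      then obtain k where "u = (\<Sum>v\<in>B. vscale (k v) v)"
        using vs.span_finite[OF fin] by auto
      also have "\<dots> = (\<Sum>c<b. vscale (k (f c)) (f c))"
        using f by (rule sum.reindex_bij_betw[symmetric])
      finally have uk: "u = (\<Sum>c<b. vscale (k (f c)) (f c))" .
      let ?w = "\<lambda>c. if c < b then Poly_Mapping.single 0 (k (f c)) else 0 :: ('v, 'k) laurent"
      have "u = mat_apply b b' A ?w"
        unfolding app uk by (simp add: fun_eq_iff sum_fun_apply vscale_def)
      moreover have "?w \<in> freemod b {}" by (auto simp: freemod_def locring_def negs_def)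
      ultimately show "u \<in> immod b b' A {}" unfolding immod_def by blast
    qed
  next
    case (Suc n)
    show ?case
    proof (intro ballI impI)
      fix u assume u: "u \<in> M {}" "\<forall>r. homogeneous (d + int (Suc n)) (u r)"
      have "\<exists>g. (\<forall>v. g v \<in> M {}) \<and> (\<forall>v r. homogeneous (d + int (Suc n) - 1) (g v r)) \<and>
          u = (\<lambda>r. \<Sum>v\<in>UNIV. xv v * g v r)"
        by (rule M.generated_step[where d = d]) (fact R, fact u(1), rule u(2)[rule_format], simp)
      then obtain g where g: "\<And>v. g v \<in> M {}" "\<And>v r. homogeneous (d + int n) (g v r)"
          "u = (\<lambda>r. \<Sum>v\<in>UNIV. xv v * g v r)"
        by auto
      have "g v \<in> immod b b' A {}" for v using Suc g(1,2)[of v] by blast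
      then show "u \<in> immod b b' A {}"
        unfolding g(3) by (intro I.sum I.scale xpow_nonneg_in_locring) auto
    qed
  qed
  have M0: "M {} \<subseteq> immod b b' A {}"
  proof
    fix u assume u: "u \<in> M {}"
    have comp: "(\<lambda>r. hcomp j (u r)) \<in> immod b b' A {}" for j
    proof (cases "j < d")
      case True
      then have "(\<lambda>r. hcomp j (u r)) = (\<lambda>_. 0)"
        using low[OF graded[OF u] homogeneous_hcomp] by blast
      then show ?thesis using I.zero by simp
    next
      case False
      then have "j = d + int (nat (j - d))" by simp
      then show ?thesis
        using hom[of "nat (j - d)"] graded[OF u, of j] homogeneous_hcomp[of j] by metis
    qed
    define D where "D = (\<Union>r<b'. deg ` keys (u r))"
    have "(\<Sum>j\<in>D. hcomp j (u r)) = u r" for r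
    proof (cases "r < b'")
      case True
      then show ?thesis by (intro sum_hcomp) (auto simp: D_def)
    next
      case False
      then have "u r = 0" using u sub by (auto simp: freemod_def)
      then show ?thesis by simp
    qed
    then have "u = (\<lambda>r. \<Sum>j\<in>D. hcomp j (u r))" by simp
    also have "\<dots> \<in> immod b b' A {}" by (rule I.sum) (rule comp)
    finally show "u \<in> immod b b' A {}" .
  qed
  have "immod b b' A F = M F" for F
    using imM has_denoms_subset[OF den locmod_immod M0] by blast
  then have "immod b b' A = M" by blast
  moreover have "u = (\<lambda>_. 0)"
    if u: "u \<in> kermod b b' A {}" and hom: "\<And>r. homogeneous j (u r)" and j: "j < 1" for u j
  proof (cases "j < 0")
    case True
    then show ?thesis
      using u hom locring_empty_homogeneous_neg by (auto simp: kermod_def freemod_def fun_eq_iff)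
  next
    case False
    \<comment> \<open>A kernel element of degree 0 has constant entries, hence is a linear relation
      between the basis vectors \<open>f c\<close>.\<close>
    then have "j = 0" using j by simp
    then have u0: "u c = Poly_Mapping.single 0 (lookup (u c) 0)" for c
      using u hom by (intro locring_empty_homogeneous_0) (auto simp: kermod_def freemod_def)
    define k where "k v = lookup (u (the_inv_into {..<b} f v)) 0" for v
    have kf: "k (f c) = lookup (u c) 0" if "c < b" for c
      using f that by (simp add: k_def bij_betw_def the_inv_into_f_f)
    have "(\<Sum>v\<in>B. vscale (k v) v) = (\<Sum>c<b. vscale (k (f c)) (f c))"
      using f by (rule sum.reindex_bij_betw[symmetric])
    also have "\<dots> = mat_apply b b' A u"
      unfolding app using u0 by (simp add: fun_eq_iff sum_fun_apply vscale_def kf)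
    also have "\<dots> = 0" using u by (simp add: kermod_def zero_fun_def)
    finally have "k v = 0" if "v \<in> B" for v
      using vs.independentD[OF B(2) fin] that by blast
    then have "lookup (u c) 0 = 0" if "c < b" for c
      using kf[OF that] f that by (metis bij_betwE lessThan_iff)
    then have "u c = 0" if "c < b" for c using u0[of c] that by simp
    moreover have "u c = 0" if "\<not> c < b" for c using u that by (simp add: kermod_def freemod_def)
    ultimately show ?thesis by blast
  qed
  ultimately show ?thesis using forms by blast
qed

text \<open>
  \<open>A 0\<close> is the augmentation $F_0 \to S^{b'}$, so the differential $F_{n+1} \to F_n$ is \<open>A (Suc n)\<close>.
\<close>

definition linear_maps :: "nat \<Rightarrow> (nat \<Rightarrow> nat) \<Rightarrow>
    (nat \<Rightarrow> nat \<Rightarrow> nat \<Rightarrow> ('v::finite, 'k::field) laurent) \<Rightarrow> int \<Rightarrow> bool" where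
  "linear_maps b' b A d \<longleftrightarrow> forms (b 0) b' (A 0) d \<and>
     (\<forall>n. forms (b (Suc n)) (b n) (A (Suc n)) 1) \<and>
     kermod (b 0) b' (A 0) {} = immod (b 1) (b 0) (A 1) {} \<and>
     (\<forall>n. kermod (b (Suc n)) (b n) (A (Suc n)) {}
        = immod (b (Suc (Suc n))) (b (Suc n)) (A (Suc (Suc n))) {})"

lemma exists_linear_maps:
  fixes M :: "'v::{finite,linorder} set \<Rightarrow> (nat \<Rightarrow> ('v, 'k::field) laurent) set"
  assumes M: "locmod M" and den: "has_denoms M" and sub: "M {} \<subseteq> freemod b' {}"
    and graded: "\<And>u j. u \<in> M {} \<Longrightarrow> (\<lambda>r. hcomp j (u r)) \<in> M {}"
    and R: "\<And>i j. d + 1 \<le> i + j \<Longrightarrow> vanish M i j"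
    and low: "\<And>u j. u \<in> M {} \<Longrightarrow> (\<And>r. homogeneous j (u r)) \<Longrightarrow> j < d \<Longrightarrow> u = (\<lambda>_. 0)"
  shows "\<exists>b A. linear_maps b' b A d \<and> immod (b 0) b' (A 0) = M"
proof -
  \<comment> \<open>A state consists of source rank, target rank and matrix. Its kernel vanishes
    cohomologically from total degree 2 on and has nothing below degree 1, which are the hypotheses
    of \<open>minimal_cover\<close> for the next map. Only the augmentation has entries of degree
    \<open>d\<close>.\<close>
  define P :: "nat \<Rightarrow> nat \<times> nat \<times> (nat \<Rightarrow> nat \<Rightarrow> ('v, 'k) laurent) \<Rightarrow> bool"
    where "P n = (\<lambda>(b, c, A). forms b c A (if n = 0 then d else 1) \<and>
      (\<forall>u j. u \<in> kermod b c A {} \<longrightarrow> (\<forall>r. homogeneous j (u r)) \<longrightarrow> j < 1 \<longrightarrow> u = (\<lambda>_. 0)) \<and>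
      (\<forall>i j. 2 \<le> i + j \<longrightarrow> vanish (kermod b c A) i j) \<and>
      (n = 0 \<longrightarrow> c = b' \<and> immod b c A = M))" for n
  define Q :: "nat \<Rightarrow> nat \<times> nat \<times> (nat \<Rightarrow> nat \<Rightarrow> ('v, 'k) laurent)
      \<Rightarrow> nat \<times> nat \<times> (nat \<Rightarrow> nat \<Rightarrow> ('v, 'k) laurent) \<Rightarrow> bool"
    where "Q n = (\<lambda>(b, c, A) (b2, c2, A2). c2 = b \<and> immod b2 c2 A2 = kermod b c A)" for n
  \<comment> \<open>If the image satisfies the bound for \<open>e\<close> and the matrix has degree
    \<open>e\<close>, the kernel satisfies the bound for 1, whatever \<open>e\<close> is.\<close>
  have ker: "vanish (kermod b c A) i j"
    if A: "forms b c A e" and R: "\<And>i j. e + 1 \<le> i + j \<Longrightarrow> vanish (immod b c A) i j"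
      and ij: "2 \<le> i + j" for b c e i j and A :: "nat \<Rightarrow> nat \<Rightarrow> ('v, 'k) laurent"
  proof -
    have "vanish (immod b c A) (i - 1) (j + e)" by (rule R) (use ij in simp)
    moreover have "vanish (freemod b :: 'v set \<Rightarrow> (nat \<Rightarrow> ('v, 'k) laurent) set) (i - 1 + 1) (j + e - e)"
      by (rule vanish_freemod) (use ij in simp)
    ultimately show ?thesis using vanish_kermod[OF A, of "i - 1" "j + e"] by simp
  qed
  have "\<exists>s. \<forall>n. P n (s n) \<and> Q n (s n) (s (Suc n))"
  proof (rule dependent_nat_choice)
    have "\<exists>b A. forms b b' A d \<and> immod b b' A = M \<and>
      (\<forall>u j. u \<in> kermod b b' A {} \<longrightarrow> (\<forall>r. homogeneous j (u r)) \<longrightarrow> j < 1 \<longrightarrow> u = (\<lambda>_. 0))"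
      by (rule minimal_cover[OF M den sub]) (fact graded, fact R, rule low)
    then obtain b A where "forms b b' A d" "immod b b' A = M"
      "\<forall>u j. u \<in> kermod b b' A {} \<longrightarrow> (\<forall>r. homogeneous j (u r)) \<longrightarrow> j < 1 \<longrightarrow> u = (\<lambda>_. 0)"
      by blast
    then have "P 0 (b, b', A)"
      unfolding P_def using ker[of b b' A d] R by auto
    then show "\<exists>x. P 0 x" ..
  next
    fix s n assume "P n s"
    obtain b c A where s: "s = (b, c, A)" by (cases s)
    define e where "e = (if n = 0 then d else 1)"
    have A: "forms b c A e"
      and lowK: "\<And>u j. u \<in> kermod b c A {} \<Longrightarrow> (\<And>r. homogeneous j (u r)) \<Longrightarrow> j < 1 \<Longrightarrow> u = (\<lambda>_. 0)"
      and RK: "\<And>i j. 1 + 1 \<le> i + j \<Longrightarrow> vanish (kermod b c A) i j"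
      using \<open>P n s\<close> unfolding P_def s e_def by auto
    have gK: "(\<lambda>r. hcomp j (u r)) \<in> kermod b c A {}" if "u \<in> kermod b c A {}" for u j
      using that mat_apply_hcomp[OF A, of "j + e" u] by (simp add: kermod_def freemod_def hcomp_locring)
    have sK: "kermod b c A {} \<subseteq> freemod b {}" by (auto simp: kermod_def)
    have "\<exists>b2 A2. forms b2 b A2 1 \<and> immod b2 b A2 = kermod b c A \<and>
      (\<forall>u j. u \<in> kermod b2 b A2 {} \<longrightarrow> (\<forall>r. homogeneous j (u r)) \<longrightarrow> j < 1 \<longrightarrow> u = (\<lambda>_. 0))"
      by (rule minimal_cover[OF locmod_kermod has_denoms_kermod sK]) (fact gK, fact RK, rule lowK)
    then obtain b2 A2 where 2: "forms b2 b A2 1" "immod b2 b A2 = kermod b c A"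
      "\<forall>u j. u \<in> kermod b2 b A2 {} \<longrightarrow> (\<forall>r. homogeneous j (u r)) \<longrightarrow> j < 1 \<longrightarrow> u = (\<lambda>_. 0)"
      by blast
    then have "P (Suc n) (b2, b, A2)"
      unfolding P_def using ker[OF 2(1)] RK by auto
    moreover have "Q n s (b2, b, A2)" unfolding Q_def s using 2 by simp
    ultimately show "\<exists>t. P (Suc n) t \<and> Q n s t" by blast
  qed
  then obtain s where s: "\<And>n. P n (s n)" "\<And>n. Q n (s n) (s (Suc n))" by blast
  define b where "b n = fst (s n)" for n
  define c where "c n = fst (snd (s n))" for n
  define A where "A n = snd (snd (s n))" for n
  have sn: "s n = (b n, c n, A n)" for n by (simp add: b_def c_def A_def)
  have c: "c 0 = b'" "\<And>n. c (Suc n) = b n"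
    using s(1)[of 0] s(2) by (simp_all add: P_def Q_def sn)
  have "linear_maps b' b A d"
    unfolding linear_maps_def
    using s(1)[of 0] s(1)[of "Suc _"] s(2)[of 0] s(2)[of "Suc _"] by (simp add: P_def Q_def sn c)
  moreover have "immod (b 0) b' (A 0) = M"
    using s(1)[of 0] by (simp add: P_def sn c)
  ultimately show ?thesis by blast
qed

lemma linear_maps_vanish:
  fixes A :: "nat \<Rightarrow> nat \<Rightarrow> nat \<Rightarrow> ('v::{finite,linorder}, 'k::field) laurent"
  assumes L: "linear_maps b' b A d" and ij: "d + 1 \<le> i + j"
  shows "vanish (immod (b 0) b' (A 0)) i j"
proof -
  \<comment> \<open>Exactness is given over the polynomial ring; clearing denominators extends it to
    every localisation.\<close>
  have ex: "kermod p q B = immod p' p C"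
    if "kermod p q B {} = immod p' p C {}" for p q p' and B C :: "nat \<Rightarrow> nat \<Rightarrow> ('v, 'k) laurent"
    using has_denoms_subset[OF has_denoms_kermod locmod_immod, of p q B p' p C]
      has_denoms_subset[OF has_denoms_immod locmod_kermod, of p' p C p q B] that
    by blast
  have L0: "forms (b 0) b' (A 0) d" "kermod (b 0) b' (A 0) = immod (b 1) (b 0) (A 1)"
    and L1: "forms (b (Suc n)) (b n) (A (Suc n)) 1"
      "kermod (b (Suc n)) (b n) (A (Suc n)) = immod (b (Suc (Suc n))) (b (Suc n)) (A (Suc (Suc n)))"
    for n using L ex unfolding linear_maps_def by blast+
  \<comment> \<open>Induction on how far \<open>i\<close> lies below the end of the Cech complex,
    uniformly in \<open>n\<close>: passing to the next syzygies raises \<open>i\<close> and lowers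
    \<open>j\<close> by one, so \<open>i + j\<close> stays at least 2.\<close>
  have step: "\<forall>n i j. int (card (UNIV :: 'v set)) < i + int k \<longrightarrow> 2 \<le> i + j \<longrightarrow>
      vanish (immod (b (Suc n)) (b n) (A (Suc n))) i j" for k
  proof (induction k)
    case 0
    show ?case
    proof (intro allI impI)
      fix n i j assume "int (card (UNIV :: 'v set)) < i + int 0"
      then show "vanish (immod (b (Suc n)) (b n) (A (Suc n))) i j"
        using locmod.zero[OF locmod_immod] by (intro vanish_large) auto
    qed
  next
    case (Suc k)
    show ?case
    proof (intro allI impI)
      fix n i j assume ij: "int (card (UNIV :: 'v set)) < i + int (Suc k)" "2 \<le> i + j"
      have "vanish (kermod (b (Suc n)) (b n) (A (Suc n))) (i + 1) (j - 1)"
        unfolding L1(2) using Suc ij by simp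
      then show "vanish (immod (b (Suc n)) (b n) (A (Suc n))) i j"
        by (intro vanish_immod[OF L1(1)] vanish_freemod) (use ij in simp_all)
    qed
  qed
  have "vanish (kermod (b 0) b' (A 0)) (i + 1) (j - d)"
    unfolding L0(2) One_nat_def
    \<comment> \<open>This many shifts carry the cohomological degree past n.\<close>
    using step[of "nat (int (card (UNIV :: 'v set)) + 1 - i)"] ij
    by (simp add: algebra_simps)
  then show ?thesis
    by (intro vanish_immod[OF L0(1)] vanish_freemod) (use ij in simp_all)
qed

subsection \<open>The edge ideal and its square as monomial ideals\<close>

interpretation ideals: module "(*) :: 'a::comm_ring_1 \<Rightarrow> 'a \<Rightarrow> 'a"
  by (rule module_times)

text \<open>Membership is decided term by term because the right-hand side defines an ideal that
  contains the generators.\<close>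

lemma mem_ideal_gen_monomials:
  fixes G :: "('v \<Rightarrow>\<^sub>0 nat) set"
  shows "p \<in> ideal_gen ((\<lambda>g. Poly_Mapping.single g (1 :: 'k::field)) ` G) \<longleftrightarrow>
    (\<forall>m\<in>keys p. \<exists>g\<in>G. \<exists>m'. m = m' + g)"
proof
  let ?T = "{p :: ('v, 'k) mpol. \<forall>m\<in>keys p. \<exists>g\<in>G. \<exists>m'. m = m' + g}"
  have "ideals.subspace ?T"
  proof (rule ideals.subspaceI)
    show "0 \<in> ?T" by simp
    show "p + q \<in> ?T" if "p \<in> ?T" "q \<in> ?T" for p q
      using that keys_add[of p q] by blast
    show "c * p \<in> ?T" if p: "p \<in> ?T" for c p
    proof (intro CollectI ballI)
      fix m assume "m \<in> keys (c * p)"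
      then obtain a b where ab: "m = a + b" "b \<in> keys p" using keys_mult[of c p] by blast
      with p obtain g m' where "g \<in> G" "b = m' + g" by blast
      then show "\<exists>g\<in>G. \<exists>m'. m = m' + g" using ab by (metis add.assoc)
    qed
  qed
  moreover have "(\<lambda>g. Poly_Mapping.single g (1 :: 'k)) ` G \<subseteq> ?T"
    by auto (metis add_0)
  moreover assume "p \<in> ideal_gen ((\<lambda>g. Poly_Mapping.single g (1 :: 'k)) ` G)"
  ultimately show "\<forall>m\<in>keys p. \<exists>g\<in>G. \<exists>m'. m = m' + g"
    using ideals.span_minimal[of _ ?T] unfolding ideal_gen_def by blast
next
  assume p: "\<forall>m\<in>keys p. \<exists>g\<in>G. \<exists>m'. m = m' + g"
  have "(\<Sum>m\<in>keys p. Poly_Mapping.single m (lookup p m))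
      \<in> ideal_gen ((\<lambda>g. Poly_Mapping.single g (1 :: 'k)) ` G)"
    unfolding ideal_gen_def
  proof (rule ideals.span_sum)
    fix m assume "m \<in> keys p"
    with p obtain g m' where g: "g \<in> G" "m = m' + g" by blast
    have "Poly_Mapping.single m' (lookup p m) * Poly_Mapping.single g 1
        \<in> ideals.span ((\<lambda>g. Poly_Mapping.single g (1 :: 'k)) ` G)"
      using g(1) by (intro ideals.span_scale ideals.span_base) blast
    then show "Poly_Mapping.single m (lookup p m)
        \<in> ideals.span ((\<lambda>g. Poly_Mapping.single g (1 :: 'k)) ` G)"
      using g(2) by (simp add: mult_single)
  qed
  then show "p \<in> ideal_gen ((\<lambda>g. Poly_Mapping.single g (1 :: 'k)) ` G)"
    by (simp add: poly_mapping_sum_single)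
qed

lemma exponent_dvd_iff:
  fixes m g :: "'v \<Rightarrow>\<^sub>0 nat"
  shows "(\<exists>m'. m = m' + g) \<longleftrightarrow> (\<forall>v. lookup g v \<le> lookup m v)"
proof
  assume "\<forall>v. lookup g v \<le> lookup m v"
  then have "m = (m - g) + g" by (intro poly_mapping_eqI) (simp add: lookup_add lookup_minus)
  then show "\<exists>m'. m = m' + g" by blast
qed (auto simp: lookup_add)

definition indic :: "'v::finite set \<Rightarrow> 'v \<Rightarrow>\<^sub>0 nat" where
  "indic e = (\<Sum>v\<in>e. Poly_Mapping.single v 1)"

lemma lookup_indic: "lookup (indic e) v = of_bool (v \<in> e)"
  by (simp add: indic_def lookup_sum lookup_single when_def)

lemma edge_ideal_monomials:
  assumes "simple_graph E"
  shows "(edge_ideal E :: ('v::finite, 'k::field) mpol set)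
    = ideal_gen ((\<lambda>g. Poly_Mapping.single g 1) ` indic ` E)"
proof -
  have var: "(var i * var j :: ('v, 'k) mpol) = Poly_Mapping.single (indic {i, j}) 1" if "i \<noteq> j" for i j
    using that by (simp add: var_def mult_single indic_def)
  have "{var i * var j | i j. {i, j} \<in> E} = (\<lambda>g. Poly_Mapping.single g (1 :: 'k)) ` indic ` E"
  proof (intro subset_antisym subsetI)
    fix p :: "('v, 'k) mpol" assume "p \<in> {var i * var j | i j. {i, j} \<in> E}"
    then obtain i j where ij: "p = var i * var j" "{i, j} \<in> E" by blast
    then have "i \<noteq> j" using assms by (auto simp: simple_graph_def)
    then show "p \<in> (\<lambda>g. Poly_Mapping.single g (1 :: 'k)) ` indic ` E" using ij var by blast
  next
    fix p assume "p \<in> (\<lambda>g. Poly_Mapping.single g (1 :: 'k)) ` indic ` E"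
    then obtain e where e: "e \<in> E" "p = Poly_Mapping.single (indic e) 1" by blast
    then have "card e = 2" using assms by (simp add: simple_graph_def)
    then obtain i j where "e = {i, j}" "i \<noteq> j" by (auto simp: card_2_iff)
    then have "p = var i * var j" "{i, j} \<in> E" using e var by simp_all
    then show "p \<in> {var i * var j | i j. {i, j} \<in> E}" by blast
  qed
  then show ?thesis by (simp add: edge_ideal_def)
qed

lemma mem_edge_ideal:
  assumes "simple_graph E"
  shows "(p :: ('v::finite, 'k::field) mpol) \<in> edge_ideal E \<longleftrightarrow>
    (\<forall>m\<in>keys p. {} \<in> strand1 E (lookup (emb m)))"
proof -
  have *: "of_bool P \<le> int n \<longleftrightarrow> of_bool P \<le> n" for P and n :: nat by (cases P) auto
  show ?thesis
    unfolding edge_ideal_monomials[OF assms] mem_ideal_gen_monomials exponent_dvd_iff strand1_def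
    by (simp add: lookup_indic *)
qed

text \<open>Needed because \<open>ideal_power\<close> starts from the unit ideal, so the square
  unfolds to a product of three factors.\<close>

lemma ideal_mult_UNIV: "ideal_mult (ideal_gen X) UNIV = ideal_gen (X :: 'a::comm_ring_1 set)"
proof
  show "ideal_mult (ideal_gen X) UNIV \<subseteq> ideal_gen X"
    unfolding ideal_mult_def ideal_gen_def
  proof (rule ideals.span_minimal)
    show "{f * g | f g. f \<in> ideals.span X \<and> g \<in> UNIV} \<subseteq> ideals.span X"
      using ideals.span_scale by (auto simp: mult.commute)
  qed (rule ideals.subspace_span)
  have "f \<in> ideal_mult (ideal_gen X) UNIV" if "f \<in> ideal_gen X" for f
    using that unfolding ideal_mult_def ideal_gen_def
    by (intro ideals.span_base CollectI exI[of _ f] exI[of _ 1]) simp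
  then show "ideal_gen X \<subseteq> ideal_mult (ideal_gen X) UNIV" by blast
qed

lemma edge_ideal_power2_monomials:
  assumes "simple_graph E"
  shows "ideal_power (edge_ideal E :: ('v::finite, 'k::field) mpol set) 2
    = ideal_gen ((\<lambda>g. Poly_Mapping.single g 1) ` {indic e + indic f | e f. e \<in> E \<and> f \<in> E})"
    (is "_ = ideal_gen ?X")
proof -
  let ?I = "edge_ideal E :: ('v, 'k) mpol set"
  have I: "?I = ideal_gen ((\<lambda>g. Poly_Mapping.single g 1) ` indic ` E)"
    by (rule edge_ideal_monomials[OF assms])
  have "ideal_power ?I 2 = ideal_mult ?I ?I"
    by (simp add: numeral_2_eq_2) (simp add: I ideal_mult_UNIV)
  also have "\<dots> = ideal_gen ?X"
  proof
    show "ideal_mult ?I ?I \<subseteq> ideal_gen ?X"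
      unfolding ideal_mult_def ideal_gen_def[of "{f * g | f g. f \<in> ?I \<and> g \<in> ?I}"]
    proof (rule ideals.span_minimal)
      show "{f * g | f g. f \<in> ?I \<and> g \<in> ?I} \<subseteq> ideal_gen ?X"
      proof safe
        fix f g assume f: "f \<in> ?I" and g: "g \<in> ?I"
        show "f * g \<in> ideal_gen ?X"
          unfolding mem_ideal_gen_monomials
        proof
          fix m assume "m \<in> keys (f * g)"
          then obtain a b where ab: "m = a + b" "a \<in> keys f" "b \<in> keys g"
            using keys_mult[of f g] by blast
          obtain e a' where "e \<in> E" "a = a' + indic e"
            using f ab(2) unfolding I mem_ideal_gen_monomials by blast
          moreover obtain e' b' where "e' \<in> E" "b = b' + indic e'"
            using g ab(3) unfolding I mem_ideal_gen_monomials by blast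
          ultimately show "\<exists>g\<in>{indic e + indic f | e f. e \<in> E \<and> f \<in> E}. \<exists>m'. m = m' + g"
            using ab(1) by (intro bexI[of _ "indic e + indic e'"] exI[of _ "a' + b'"])
              (auto simp: algebra_simps)
        qed
      qed
      show "ideals.subspace (ideal_gen ?X)" unfolding ideal_gen_def by (rule ideals.subspace_span)
    qed
    show "ideal_gen ?X \<subseteq> ideal_mult ?I ?I"
      unfolding ideal_mult_def ideal_gen_def[of ?X] ideal_gen_def[of "{f * g | f g. f \<in> ?I \<and> g \<in> ?I}"]
    proof (rule ideals.span_mono)
      have "Poly_Mapping.single (indic e) 1 \<in> ?I" if "e \<in> E" for e
        unfolding I ideal_gen_def using that by (intro ideals.span_base) blast
      moreover have "Poly_Mapping.single (indic e + indic f) (1 :: 'k)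
          = Poly_Mapping.single (indic e) 1 * Poly_Mapping.single (indic f) 1" for e f
        by (simp add: mult_single)
      ultimately show "?X \<subseteq> {f * g | f g. f \<in> ?I \<and> g \<in> ?I}" by blast
    qed
  qed
  finally show ?thesis .
qed

lemma mem_edge_ideal_power2:
  assumes "simple_graph E"
  shows "(p :: ('v::finite, 'k::field) mpol) \<in> ideal_power (edge_ideal E) 2 \<longleftrightarrow>
    (\<forall>m\<in>keys p. {} \<in> strand2 E (lookup (emb m)))"
proof -
  have *: "of_bool P + of_bool Q \<le> int n \<longleftrightarrow> of_bool P + of_bool Q \<le> n" for P Q and n :: nat
    by (cases P; cases Q) auto
  have "p \<in> ideal_power (edge_ideal E) 2 \<longleftrightarrow>
      (\<forall>m\<in>keys p. \<exists>e\<in>E. \<exists>f\<in>E. \<forall>v. lookup (indic e + indic f) v \<le> lookup m v)"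
    unfolding edge_ideal_power2_monomials[OF assms] mem_ideal_gen_monomials exponent_dvd_iff by blast
  also have "\<dots> \<longleftrightarrow> (\<forall>m\<in>keys p. {} \<in> strand2 E (lookup (emb m)))"
    by (simp add: strand2_def lookup_indic lookup_add *)
  finally show ?thesis .
qed

subsection \<open>Localisations of monomial ideals\<close>

text \<open>\<open>St a\<close> stands for the sets \<open>F\<close> with x^a in the localisation at
  x_F, which \<open>localisation_eq\<close> confirms. \<open>St_denom\<close> asks for all large
  \<open>t\<close>, so that the terms of a polynomial can share a denominator.\<close>

locale monomial_ideal =
  fixes J :: "('v::{finite,linorder}, 'k::field) mpol set" and St :: "('v \<Rightarrow>\<^sub>0 int) \<Rightarrow> 'v set set"
  assumes mem_iff: "p \<in> J \<longleftrightarrow> (\<forall>m\<in>keys p. {} \<in> St (emb m))"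
    and St_mono: "F \<in> St a \<Longrightarrow> F \<subseteq> G \<Longrightarrow> G \<in> St a"
    and St_add: "F \<in> St a \<Longrightarrow> negs c \<subseteq> F \<Longrightarrow> F \<in> St (a + c)"
    and St_nonneg: "{} \<in> St a \<Longrightarrow> negs a = {}"
    and St_denom: "F \<in> St a \<Longrightarrow>
      \<exists>n. \<forall>t\<ge>n. {} \<in> St ((\<Sum>v\<in>F. Poly_Mapping.single v (int t)) + a)"
begin

lemma localisation_eq: "localisation J F = {f. \<forall>a\<in>keys f. F \<in> St a}"
proof (intro subset_antisym subsetI)
  fix f assume "f \<in> localisation J F"
  then obtain g t where f: "f = to_laurent g * xpow F (- int t)" and g: "g \<in> J"
    unfolding localisation_def xpow_def by blast
  have "F \<in> St a" if a: "a \<in> keys f" for a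
  proof -
    let ?c = "\<Sum>v\<in>F. Poly_Mapping.single v (- int t)"
    have "a \<in> (+) ?c ` keys (to_laurent g)"
      using a keys_single_mult[of ?c 1 "to_laurent g"] unfolding f xpow_def by (auto simp: mult.commute)
    then obtain m where m: "m \<in> keys g" "a = emb m + ?c"
      by (auto simp: keys_to_laurent add.commute)
    have "F \<in> St (emb m)" using g m(1) St_mono[of "{}"] unfolding mem_iff by blast
    then show ?thesis
      unfolding m(2) by (rule St_add) (auto simp: negs_def lookup_sum_single split: if_splits)
  qed
  then show "f \<in> {f. \<forall>a\<in>keys f. F \<in> St a}" by blast
next
  fix f :: "('v, 'k) laurent" assume "f \<in> {f. \<forall>a\<in>keys f. F \<in> St a}"
  then have "\<forall>a\<in>keys f. \<exists>n. \<forall>t\<ge>n. {} \<in> St ((\<Sum>v\<in>F. Poly_Mapping.single v (int t)) + a)"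
    using St_denom by blast
  then obtain n where n: "\<And>a t. a \<in> keys f \<Longrightarrow> n a \<le> t
      \<Longrightarrow> {} \<in> St ((\<Sum>v\<in>F. Poly_Mapping.single v (int t)) + a)"
    by metis
  define t where "t = (\<Sum>a\<in>keys f. n a)"
  have nt: "n a \<le> t" if "a \<in> keys f" for a
    unfolding t_def using that by (intro member_le_sum) auto
  have St: "{} \<in> St b" if "b \<in> keys (xpow F (int t) * f)" for b
    using that keys_single_mult[of "\<Sum>v\<in>F. Poly_Mapping.single v (int t)" 1 f] n nt
    unfolding xpow_def by blast
  then have "xpow F (int t) * f \<in> locring {}"
    using St_nonneg by (auto simp: locring_def)
  then obtain g where g: "xpow F (int t) * f = to_laurent g" by (rule locring_emptyE)
  have "g \<in> J"
    unfolding mem_iff using St g by (auto simp: keys_to_laurent)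
  moreover have "f = to_laurent g * xpow F (- int t)"
    unfolding g[symmetric] by (simp add: mult.commute[of _ "xpow F (- int t)"])
  ultimately show "f \<in> localisation J F"
    unfolding localisation_def xpow_def by blast
qed

text \<open>The ideal as a submodule of a free module of rank 1, which puts it in the form required
  by \<open>locmod\<close>.\<close>

definition lifted :: "'v set \<Rightarrow> (nat \<Rightarrow> ('v, 'k) laurent) set" where
  "lifted = monmod (\<lambda>r a. if r = 0 then St a else {})"

lemma lifted_iff: "u \<in> lifted F \<longleftrightarrow> u 0 \<in> localisation J F \<and> (\<forall>r>0. u r = 0)"
proof -
  have 0: "(\<forall>a\<in>keys (u r). False) \<longleftrightarrow> u r = 0" for r
    by (auto intro!: poly_mapping_eqI simp: in_keys_iff)
  have "u \<in> lifted F \<longleftrightarrow> (\<forall>r. \<forall>a\<in>keys (u r). F \<in> (if r = 0 then St a else {}))"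
    by (simp add: lifted_def monmod_def)
  also have "\<dots> \<longleftrightarrow> (\<forall>a\<in>keys (u 0). F \<in> St a) \<and> (\<forall>r>0. \<forall>a\<in>keys (u r). False)"
    by (metis empty_iff less_irrefl neq0_conv)
  finally show ?thesis by (simp add: localisation_eq 0)
qed

lemma localisation_empty: "localisation J {} = to_laurent ` J"
  unfolding localisation_def by auto

lemma lifted_empty: "lifted {} = (\<lambda>p r. if r = 0 then to_laurent p else 0) ` J"
proof (intro subset_antisym subsetI)
  fix u assume u: "u \<in> lifted {}"
  then obtain p where p: "p \<in> J" "u 0 = to_laurent p" by (auto simp: lifted_iff localisation_empty)
  then have "u = (\<lambda>r. if r = 0 then to_laurent p else 0)" using u by (auto simp: lifted_iff)
  then show "u \<in> (\<lambda>p r. if r = 0 then to_laurent p else 0) ` J" using p by blast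
qed (auto simp: lifted_iff localisation_empty)

lemma locmod_lifted: "locmod lifted"
proof
  fix F G u w and f :: "('v, 'k) laurent"
  show "(\<lambda>_. 0) \<in> lifted F" by (simp add: lifted_iff localisation_eq)
  show "(\<lambda>r. u r + w r) \<in> lifted F" if "u \<in> lifted F" "w \<in> lifted F"
    using that keys_add[of "u 0" "w 0"] by (auto simp: lifted_iff localisation_eq)
  show "lifted F \<subseteq> lifted G" if "F \<subseteq> G"
    using St_mono[OF _ that] by (auto simp: lifted_iff localisation_eq)
  show "(\<lambda>r. f * u r) \<in> lifted F" if u: "u \<in> lifted F" and f: "f \<in> locring F"
  proof -
    have "F \<in> St c" if c: "c \<in> keys (f * u 0)" for c
    proof -
      obtain a b where "c = b + a" "a \<in> keys f" "b \<in> keys (u 0)"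
        using c keys_mult[of f "u 0"] by (force simp: add.commute)
      then show ?thesis
        using u f St_add[of F b a] by (simp add: lifted_iff localisation_eq locring_def)
    qed
    then show ?thesis using u by (auto simp: lifted_iff localisation_eq)
  qed
qed

lemma has_denoms_lifted: "has_denoms lifted"
  unfolding has_denoms_def
proof (intro allI ballI)
  fix F u assume u: "u \<in> lifted F"
  then obtain g t where "u 0 = to_laurent g * xpow F (- int t)" "g \<in> J"
    unfolding lifted_iff localisation_def xpow_def by blast
  then have "xpow F (int t) * u 0 = to_laurent g" "g \<in> J"
    by (simp_all add: mult.commute[of _ "xpow F (- int t)"])
  then have "(\<lambda>r. xpow F (int t) * u r) \<in> lifted {}"
    using u by (auto simp: lifted_iff localisation_empty)
  then show "\<exists>t. (\<lambda>r. xpow F (int t) * u r) \<in> lifted {}" ..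
qed

lemma lifted_freemod: "lifted {} \<subseteq> freemod 1 {}"
  by (auto simp: lifted_iff localisation_empty freemod_def)
     (metis gr_zeroI locring_zero to_laurent_in_locring)

lemma hcomp_lifted: "u \<in> lifted {} \<Longrightarrow> (\<lambda>r. hcomp j (u r)) \<in> lifted {}"
  by (auto simp: lifted_iff localisation_eq keys_hcomp)

lemma cech_cochains_iff:
  "c \<in> cech_cochains J i j \<longleftrightarrow> (\<lambda>F r. if r = 0 then c F else 0) \<in> cochains lifted i j"
proof -
  have "(\<lambda>r. if r = 0 then c F else 0) = (\<lambda>_. 0) \<longleftrightarrow> c F = 0" for F
    by (auto simp: fun_eq_iff)
  then show ?thesis by (simp add: cech_cochains_def cochains_def lifted_iff) blast
qed

lemma vanish_lifted_iff: "vanish lifted i j \<longleftrightarrow> cocycles J i j \<subseteq> coboundaries J i j"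
proof -
  let ?L = "\<lambda>c F r. if r = (0::nat) then c F else (0 :: ('v, 'k) laurent)"
  have vd: "vdiff (?L c) = ?L (cdiff c)" for c :: "'v set \<Rightarrow> ('v, 'k) laurent"
    by (intro ext) (simp add: vdiff_def)
  have inj: "?L c = ?L c' \<longleftrightarrow> c = c'" for c c' :: "'v set \<Rightarrow> ('v, 'k) laurent"
    by (metis ext)
  have surj: "\<exists>c'. c = ?L c'" if "c \<in> cochains lifted i j" for c i j
  proof
    have "c F r = 0" if "r > 0" for F r
      using cochainsD(1)[OF \<open>c \<in> cochains lifted i j\<close>, of F] that by (simp add: lifted_iff)
    then show "c = ?L (\<lambda>F. c F 0)" by (auto simp: fun_eq_iff)
  qed
  have zero: "?L c = (\<lambda>_ _. 0) \<longleftrightarrow> c = (\<lambda>_. 0)" for c :: "'v set \<Rightarrow> ('v, 'k) laurent"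
    using inj[of c "\<lambda>_. 0"] by simp
  have cob: "?L c \<in> vdiff ` cochains lifted (i - 1) j \<longleftrightarrow> c \<in> coboundaries J i j" for c
  proof
    assume "?L c \<in> vdiff ` cochains lifted (i - 1) j"
    then obtain b where b: "b \<in> cochains lifted (i - 1) j" "?L c = vdiff b" by blast
    obtain b' where b': "b = ?L b'" using surj[OF b(1)] ..
    then have "c = cdiff b'" using b(2) vd inj by simp
    then show "c \<in> coboundaries J i j"
      using b(1) unfolding b' cech_cochains_iff[symmetric] coboundaries_def cech_diff_eq_cdiff by blast
  next
    assume "c \<in> coboundaries J i j"
    then obtain b where "b \<in> cech_cochains J (i - 1) j" "c = cdiff b"
      unfolding coboundaries_def cech_diff_eq_cdiff by blast
    then show "?L c \<in> vdiff ` cochains lifted (i - 1) j"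
      using vd[of b] unfolding cech_cochains_iff by (intro image_eqI[of _ _ "?L b"]) auto
  qed
  have "vanish lifted i j \<longleftrightarrow>
      (\<forall>c. ?L c \<in> cochains lifted i j \<longrightarrow> vdiff (?L c) = (\<lambda>_ _. 0) \<longrightarrow> ?L c \<in> vdiff ` cochains lifted (i - 1) j)"
    unfolding vanish_def using surj by blast
  also have "\<dots> \<longleftrightarrow> cocycles J i j \<subseteq> coboundaries J i j"
    unfolding cob vd zero cech_cochains_iff[symmetric] cocycles_def cech_diff_eq_cdiff by blast
  finally show ?thesis .
qed

lemma vanish_lifted_strands:
  "vanish lifted i j \<longleftrightarrow> (\<forall>a. deg a = j \<longrightarrow> acyclic_at TYPE('k) (St a) i)"
proof (intro iffI allI impI)
  fix a :: "'v \<Rightarrow>\<^sub>0 int" assume "vanish lifted i j" "deg a = j"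
  then have "vanish lifted i (deg a)" by simp
  from vanish_monmodD[OF this[unfolded lifted_def], of 0]
  show "acyclic_at TYPE('k) (St a) i" by simp
next
  assume "\<forall>a. deg a = j \<longrightarrow> acyclic_at TYPE('k) (St a) i"
  then show "vanish lifted i j"
    unfolding lifted_def by (intro vanish_monmodI) (simp add: acyclic_at_empty)
qed

lemma local_cohomology_zero_iff:
  "local_cohomology J i j = {coboundaries J i j} \<longleftrightarrow> vanish lifted i j"
proof -
  interpret L: locmod lifted by (rule locmod_lifted)
  have diff: "(\<lambda>F. c F - c' F) \<in> cech_cochains J i j"
    if "c \<in> cech_cochains J i j" "c' \<in> cech_cochains J i j" for c c' i
    using L.cochains_diff[OF that[unfolded cech_cochains_iff]] unfolding cech_cochains_iff
    by (rule back_subst[where P = "\<lambda>x. x \<in> _"]) (simp add: fun_eq_iff)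
  have cdiff_diff': "cdiff (\<lambda>F. c F - c' F) = (\<lambda>F. cdiff c F - cdiff c' F)"
    for c c' :: "'v set \<Rightarrow> ('v, 'k) laurent" by (simp add: fun_eq_iff cdiff_diff)
  have cob_diff: "(\<lambda>F. c F - c' F) \<in> coboundaries J i j"
    if c: "c \<in> coboundaries J i j" and c': "c' \<in> coboundaries J i j" for c c'
  proof -
    obtain b b' where "b \<in> cech_cochains J (i - 1) j" "c = cdiff b"
        "b' \<in> cech_cochains J (i - 1) j" "c' = cdiff b'"
      using c c' unfolding coboundaries_def cech_diff_eq_cdiff by blast
    then show ?thesis
      unfolding coboundaries_def cech_diff_eq_cdiff
      by (intro image_eqI[of _ _ "\<lambda>F. b F - b' F"]) (auto simp: cdiff_diff' diff)
  qed
  have zeroc: "(\<lambda>_. 0) \<in> cech_cochains J i j" for i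
    unfolding cech_cochains_iff using L.zero by (simp add: cochains_def)
  have zero: "(\<lambda>_. 0) \<in> coboundaries J i j"
    unfolding coboundaries_def cech_diff_eq_cdiff
    by (rule image_eqI[OF _ zeroc]) (simp add: fun_eq_iff)
  define rel where "rel = {(c, c'). (\<lambda>F. c F - c' F) \<in> coboundaries J i j}"
  have LC: "local_cohomology J i j = (\<lambda>c. rel `` {c}) ` cocycles J i j"
    unfolding local_cohomology_def rel_def quotient_def by blast
  show ?thesis
    unfolding vanish_lifted_iff
  proof
    assume L: "local_cohomology J i j = {coboundaries J i j}"
    show "cocycles J i j \<subseteq> coboundaries J i j"
    proof
      fix c assume "c \<in> cocycles J i j"
      then have "rel `` {c} \<in> local_cohomology J i j" unfolding LC by (rule imageI)
      then have "rel `` {c} = coboundaries J i j" unfolding L by simp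
      moreover have "c \<in> rel `` {c}" using zero by (simp add: rel_def)
      ultimately show "c \<in> coboundaries J i j" by blast
    qed
  next
    assume sub: "cocycles J i j \<subseteq> coboundaries J i j"
    have "rel `` {c} = coboundaries J i j" if "c \<in> cocycles J i j" for c
    proof (intro subset_antisym subsetI)
      have c: "c \<in> coboundaries J i j" using that sub by blast
      fix c'
      show "c' \<in> coboundaries J i j" if "c' \<in> rel `` {c}"
        using cob_diff[OF c, of "\<lambda>F. c F - c' F"] that by (simp add: rel_def)
      show "c' \<in> rel `` {c}" if "c' \<in> coboundaries J i j"
        using cob_diff[OF c that] by (simp add: rel_def)
    qed
    then have "local_cohomology J i j = (\<lambda>c. coboundaries J i j) ` cocycles J i j"
      unfolding LC by (rule image_cong[OF refl])
    \<comment> \<open>Without a cocycle the quotient would be empty instead of consisting of the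
      zero class.\<close>
    moreover have "(\<lambda>_. 0) \<in> cocycles J i j"
      using zeroc by (simp add: cocycles_def cech_diff_eq_cdiff fun_eq_iff)
    ultimately show "local_cohomology J i j = {coboundaries J i j}" by (auto simp: image_constant)
  qed
qed

end

section \<open>The edge ideal and its square as instances\<close>

lemma monomial_ideal_edge_ideal:
  fixes E :: "'v::{finite,linorder} set set"
  assumes E: "simple_graph E"
  shows "monomial_ideal (edge_ideal E :: ('v, 'k::field) mpol set) (\<lambda>a. strand1 E (lookup a))"
proof
  fix F G and a c :: "'v \<Rightarrow>\<^sub>0 int" and p :: "('v, 'k) mpol"
  show "p \<in> edge_ideal E \<longleftrightarrow> (\<forall>m\<in>keys p. {} \<in> strand1 E (lookup (emb m)))"
    by (rule mem_edge_ideal[OF E])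
  show "G \<in> strand1 E (lookup a)" if "F \<in> strand1 E (lookup a)" "F \<subseteq> G"
    using that unfolding strand1_def by blast
  show "negs a = {}" if "{} \<in> strand1 E (lookup a)"
    using that order_trans[of 0 "of_bool _" "lookup a _"] by (force simp: strand1_def negs_def not_less)
  show "F \<in> strand1 E (lookup (a + c))" if "F \<in> strand1 E (lookup a)" "negs c \<subseteq> F"
  proof -
    obtain e where e: "e \<in> E" "\<And>v. v \<notin> F \<Longrightarrow> of_bool (v \<in> e) \<le> lookup a v"
      using \<open>F \<in> strand1 E (lookup a)\<close> unfolding strand1_def by blast
    have "of_bool (v \<in> e) \<le> lookup (a + c) v" if "v \<notin> F" for v
    proof -
      have "0 \<le> lookup c v" using \<open>negs c \<subseteq> F\<close> that unfolding negs_def by (meson in_mono mem_Collect_eq not_le)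
      then show ?thesis using e(2)[OF that] by (simp add: lookup_add)
    qed
    then show ?thesis using e(1) unfolding strand1_def by blast
  qed
  show "\<exists>n. \<forall>t\<ge>n. {} \<in> strand1 E (lookup ((\<Sum>v\<in>F. Poly_Mapping.single v (int t)) + a))"
    if F: "F \<in> strand1 E (lookup a)"
  proof -
    obtain e where e: "e \<in> E" "\<And>v. v \<notin> F \<Longrightarrow> of_bool (v \<in> e) \<le> lookup a v"
      using F unfolding strand1_def by blast
    define n where "n = (\<Sum>v\<in>UNIV. nat (1 + \<bar>lookup a v\<bar>))"
    have "of_bool (v \<in> e) \<le> lookup ((\<Sum>v\<in>F. Poly_Mapping.single v (int t)) + a) v" if t: "n \<le> t" for t v
    proof (cases "v \<in> F")
      case True
      have "nat (1 + \<bar>lookup a v\<bar>) \<le> n" unfolding n_def by (rule member_le_sum) auto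
      then have "1 \<le> int t + lookup a v" using t by linarith
      then show ?thesis using True by (cases "v \<in> e") (simp_all add: lookup_add lookup_sum_single)
    next
      case False
      then show ?thesis using e(2)[of v] by (simp add: lookup_add lookup_sum_single)
    qed
    then show ?thesis using e(1) unfolding strand1_def by blast
  qed
qed

lemma monomial_ideal_edge_ideal_power2:
  fixes E :: "'v::{finite,linorder} set set"
  assumes E: "simple_graph E"
  shows "monomial_ideal (ideal_power (edge_ideal E :: ('v, 'k::field) mpol set) 2)
    (\<lambda>a. strand2 E (lookup a))"
proof
  fix F G and a c :: "'v \<Rightarrow>\<^sub>0 int" and p :: "('v, 'k) mpol"
  show "p \<in> ideal_power (edge_ideal E) 2 \<longleftrightarrow> (\<forall>m\<in>keys p. {} \<in> strand2 E (lookup (emb m)))"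
    by (rule mem_edge_ideal_power2[OF E])
  show "G \<in> strand2 E (lookup a)" if "F \<in> strand2 E (lookup a)" "F \<subseteq> G"
    using that unfolding strand2_def by blast
  show "negs a = {}" if St: "{} \<in> strand2 E (lookup a)"
  proof -
    obtain e f where "\<And>v. of_bool (v \<in> e) + of_bool (v \<in> f) \<le> lookup a v"
      using St unfolding strand2_def by blast
    then have "0 \<le> lookup a v" for v by (rule order_trans[rotated]) simp
    then show ?thesis by (auto simp: negs_def not_less)
  qed
  show "F \<in> strand2 E (lookup (a + c))" if F: "F \<in> strand2 E (lookup a)" and c: "negs c \<subseteq> F"
  proof -
    obtain e f where ef: "e \<in> E" "f \<in> E"
        "\<And>v. v \<notin> F \<Longrightarrow> of_bool (v \<in> e) + of_bool (v \<in> f) \<le> lookup a v"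
      using F unfolding strand2_def by blast
    have "of_bool (v \<in> e) + of_bool (v \<in> f) \<le> lookup (a + c) v" if "v \<notin> F" for v
    proof -
      have "0 \<le> lookup c v" using c that unfolding negs_def by (meson in_mono mem_Collect_eq not_le)
      then show ?thesis using ef(3)[OF that] by (simp add: lookup_add)
    qed
    then show ?thesis using ef(1,2) unfolding strand2_def by blast
  qed
  show "\<exists>n. \<forall>t\<ge>n. {} \<in> strand2 E (lookup ((\<Sum>v\<in>F. Poly_Mapping.single v (int t)) + a))"
    if F: "F \<in> strand2 E (lookup a)"
  proof -
    obtain e f where ef: "e \<in> E" "f \<in> E"
        "\<And>v. v \<notin> F \<Longrightarrow> of_bool (v \<in> e) + of_bool (v \<in> f) \<le> lookup a v"
      using F unfolding strand2_def by blast
    \<comment> \<open>Two edges through the same variable demand exponent 2; hence 2 where a single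
      edge would need 1.\<close>
    define n where "n = (\<Sum>v\<in>UNIV. nat (2 + \<bar>lookup a v\<bar>))"
    have "of_bool (v \<in> e) + of_bool (v \<in> f)
        \<le> lookup ((\<Sum>v\<in>F. Poly_Mapping.single v (int t)) + a) v" if t: "n \<le> t" for t v
    proof (cases "v \<in> F")
      case True
      have "nat (2 + \<bar>lookup a v\<bar>) \<le> n" unfolding n_def by (rule member_le_sum) auto
      then have "2 \<le> int t + lookup a v" using t by linarith
      then show ?thesis
        using True by (cases "v \<in> e"; cases "v \<in> f") (simp_all add: lookup_add lookup_sum_single)
    next
      case False
      then show ?thesis using ef(3)[of v] by (simp add: lookup_add lookup_sum_single)
    qed
    then show ?thesis using ef(1,2) unfolding strand2_def by blast
  qed
qed

subsection \<open>Graded free resolutions over the polynomial ring\<close>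

definition lmat :: "(nat \<Rightarrow> nat \<Rightarrow> ('v, 'k::field) mpol) \<Rightarrow> nat \<Rightarrow> nat \<Rightarrow> ('v, 'k) laurent" where
  "lmat B = (\<lambda>r c. to_laurent (B r c))"

definition lvec :: "(nat \<Rightarrow> ('v, 'k::field) mpol) \<Rightarrow> nat \<Rightarrow> ('v, 'k) laurent" where
  "lvec u = (\<lambda>r. to_laurent (u r))"

lemma inj_lvec: "inj lvec"
  by (rule injI) (simp add: lvec_def fun_eq_iff to_laurent_inj)

lemma lvec_eq_zero_iff: "lvec u = (\<lambda>_. 0) \<longleftrightarrow> u = (\<lambda>_. 0)"
  by (simp add: lvec_def fun_eq_iff)

lemma lvec_mat_apply: "lvec (mat_apply b b' B u) = mat_apply b b' (lmat B) (lvec u)"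
  by (simp add: fun_eq_iff lvec_def lmat_def mat_apply_def to_laurent_sum to_laurent_mult)

lemma lvec_free_mod: "lvec ` free_mod b = freemod b {}"
proof (intro subset_antisym subsetI)
  fix w :: "nat \<Rightarrow> ('a, 'b) laurent" assume w: "w \<in> freemod b {}"
  then have "\<exists>p. w r = to_laurent p" for r
    using locring_emptyE[of "w r"] unfolding freemod_def by blast
  then obtain u where u: "\<And>r. w r = to_laurent (u r)" by metis
  then have "w = lvec u" by (simp add: lvec_def fun_eq_iff)
  moreover have "u \<in> free_mod b" using w u by (simp add: free_mod_def freemod_def)
  ultimately show "w \<in> lvec ` free_mod b" by blast
qed (auto simp: free_mod_def freemod_def lvec_def to_laurent_in_locring)

lemma lvec_kernel:
  "lvec ` {u \<in> free_mod b. mat_apply b b' B u = (\<lambda>_. 0)} = kermod b b' (lmat B) {}"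
proof -
  have "kermod b b' (lmat B) {} = {w \<in> lvec ` free_mod b. mat_apply b b' (lmat B) w = (\<lambda>_. 0)}"
    by (simp add: kermod_def lvec_free_mod)
  also have "\<dots> = lvec ` {u \<in> free_mod b. mat_apply b b' B u = (\<lambda>_. 0)}"
    by (auto simp: lvec_mat_apply[symmetric] lvec_eq_zero_iff)
  finally show ?thesis ..
qed

lemma lvec_image: "lvec ` mat_apply b b' B ` free_mod b = immod b b' (lmat B) {}"
  by (simp add: immod_def image_image lvec_mat_apply flip: lvec_free_mod)

lemma exact_iff:
  "{u \<in> free_mod b. mat_apply b b' B u = (\<lambda>_. 0)} = mat_apply b2 b C ` free_mod b2 \<longleftrightarrow>
    kermod b b' (lmat B) {} = immod b2 b (lmat C) {}"
  unfolding lvec_kernel[symmetric] lvec_image[symmetric] inj_image_eq_iff[OF inj_lvec] ..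

lemma augmentation_iff:
  "(\<lambda>u. \<Sum>c<b. \<epsilon> c * u c) ` free_mod b = J \<longleftrightarrow>
    immod b 1 (lmat (\<lambda>r. \<epsilon>)) {} = (\<lambda>p r. if r = 0 then to_laurent p else 0) ` J"
proof -
  let ?K = "\<lambda>p r. if r = (0::nat) then to_laurent p else 0"
  have "?K (\<Sum>c<b. \<epsilon> c * u c) = lvec (mat_apply b 1 (\<lambda>r. \<epsilon>) u)" for u
    by (auto simp: lvec_def mat_apply_def fun_eq_iff)
  then have eq: "immod b 1 (lmat (\<lambda>r. \<epsilon>)) {} = ?K ` (\<lambda>u. \<Sum>c<b. \<epsilon> c * u c) ` free_mod b"
    by (simp add: image_image flip: lvec_image)
  have inj: "inj ?K"
    by (rule injI) (metis to_laurent_inj)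
  show ?thesis unfolding eq inj_image_eq_iff[OF inj] ..
qed

text \<open>The augmentation becomes the matrix of index 0. All its rows equal
  \<open>\<epsilon>\<close>, but its target has rank 1, so row 0 alone is read.\<close>

lemma resolution_iff:
  "graded_free_resolution J \<beta> (\<lambda>i c. d + int i) \<epsilon> \<phi> \<longleftrightarrow>
    linear_maps 1 \<beta> (\<lambda>n. lmat (case n of 0 \<Rightarrow> (\<lambda>r. \<epsilon>) | Suc n \<Rightarrow> \<phi> n)) d \<and>
    immod (\<beta> 0) 1 (lmat (\<lambda>r. \<epsilon>)) {} = (\<lambda>p r. if r = 0 then to_laurent p else 0) ` J"
proof -
  have "(\<Sum>c<\<beta> 0. \<epsilon> c * u c) = 0 \<longleftrightarrow> mat_apply (\<beta> 0) 1 (\<lambda>r. \<epsilon>) u = (\<lambda>_. 0)" for u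
    by (simp add: mat_apply_def fun_eq_iff)
  moreover have "forms b 1 (lmat (\<lambda>r. \<epsilon>)) d \<longleftrightarrow> (\<forall>c<b. homogeneous d (to_laurent (\<epsilon> c)))" for b
    by (simp add: forms_def lmat_def to_laurent_in_locring)
  moreover have "forms b b' (lmat B) e \<longleftrightarrow> (\<forall>r<b'. \<forall>c<b. homogeneous e (to_laurent (B r c)))"
    for b b' e and B :: "nat \<Rightarrow> nat \<Rightarrow> ('a, 'b) mpol"
    by (simp add: forms_def lmat_def to_laurent_in_locring)
  ultimately show ?thesis
    unfolding graded_free_resolution_def linear_maps_def augmentation_iff exact_iff[symmetric]
    by auto
qed

lemma mat_apply_cong:
  assumes "\<And>r c. r < b' \<Longrightarrow> c < b \<Longrightarrow> A r c = A' r c"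
  shows "mat_apply b b' A = mat_apply b b' A'"
  using assms by (auto simp: mat_apply_def fun_eq_iff intro!: sum.cong)

text \<open>Entries of \<open>A\<close> outside the ranks may be arbitrary Laurent polynomials. The
  polynomial preimages are chosen entrywise and agree with \<open>A\<close> within the ranks, which
  determines the maps.\<close>

lemma linear_resolution_of_linear_maps:
  fixes J :: "('v::{finite,linorder}, 'k::field) mpol set"
  assumes L: "linear_maps 1 b A d"
    and J: "immod (b 0) 1 (A 0) {} = (\<lambda>p r. if r = 0 then to_laurent p else 0) ` J"
  shows "has_linear_resolution J"
proof -
  define \<epsilon> where "\<epsilon> c = (SOME p. A 0 0 c = to_laurent p)" for c
  define \<phi> where "\<phi> n r c = (SOME p. A (Suc n) r c = to_laurent p)" for n r c
  define A' where "A' n = lmat (case n of 0 \<Rightarrow> (\<lambda>r. \<epsilon>) | Suc n \<Rightarrow> \<phi> n)" for n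
  have ex: "\<exists>p. f = to_laurent p" if "f \<in> locring {}" for f :: "('v, 'k) laurent"
    using that locring_emptyE by blast
  have 0: "A 0 r c = A' 0 r c" if "r < 1" "c < b 0" for r c
  proof -
    have "A 0 0 c \<in> locring {}" using L that by (simp add: linear_maps_def forms_def)
    then show ?thesis using someI_ex[OF ex] that by (simp add: A'_def lmat_def \<epsilon>_def)
  qed
  have S: "A (Suc n) r c = A' (Suc n) r c" if "r < b n" "c < b (Suc n)" for n r c
  proof -
    have "A (Suc n) r c \<in> locring {}" using L that by (simp add: linear_maps_def forms_def)
    then show ?thesis using someI_ex[OF ex] by (simp add: A'_def lmat_def \<phi>_def)
  qed
  note m = mat_apply_cong[of 1 "b 0" "A 0" "A' 0", OF 0]
    mat_apply_cong[of "b n" "b (Suc n)" "A (Suc n)" "A' (Suc n)" for n, OF S]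
  have "linear_maps 1 b A' d"
    using L 0 S m(2)[of 0] by (simp add: linear_maps_def forms_def kermod_def immod_def m m(1)[unfolded One_nat_def])
  moreover have "immod (b 0) 1 (A' 0) {} = (\<lambda>p r. if r = 0 then to_laurent p else 0) ` J"
    using J by (simp add: immod_def m(1)[unfolded One_nat_def])
  ultimately have "graded_free_resolution J b (\<lambda>i c. d + int i) \<epsilon> \<phi>"
    unfolding resolution_iff by (simp add: A'_def[abs_def] lmat_def)
  then show ?thesis unfolding has_linear_resolution_def by blast
qed

subsection \<open>Linear first syzygies force gap-freeness\<close>

lemma lookup_mult_group:
  fixes f g :: "'e::ab_group_add \<Rightarrow>\<^sub>0 'k::comm_semiring_0"
  shows "lookup (f * g) a = (\<Sum>b\<in>keys f. lookup f b * lookup g (a - b))"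
proof -
  have "f * g = (\<Sum>b\<in>keys f. Poly_Mapping.single b (lookup f b) * g)"
    by (subst (1) poly_mapping_sum_single[of f, symmetric]) (simp add: sum_distrib_right)
  moreover have "lookup (Poly_Mapping.single b (lookup f b) * g) a = lookup f b * lookup g (a - b)" for b
    using lookup_single_mult[of b "lookup f b" g "a - b"] by simp
  ultimately show ?thesis by (simp add: lookup_sum)
qed

lemma single_sum: "Poly_Mapping.single a (sum f A) = (\<Sum>x\<in>A. Poly_Mapping.single a (f x))"
  by (induction A rule: infinite_finite_induct) (simp_all add: single_add)

lemma strand2_deg:
  fixes a :: "'v::finite \<Rightarrow>\<^sub>0 int"
  assumes E: "simple_graph E" and a: "{} \<in> strand2 E (lookup a)"
  shows "4 \<le> deg a"
proof -
  obtain e f where ef: "e \<in> E" "f \<in> E" "\<And>v. of_bool (v \<in> e) + of_bool (v \<in> f) \<le> lookup a v"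
    using a unfolding strand2_def by blast
  have "4 = int (card e) + int (card f)" using E ef by (simp add: simple_graph_def)
  also have "\<dots> = (\<Sum>v\<in>UNIV. of_bool (v \<in> e) + of_bool (v \<in> f))"
    by (simp add: sum.distrib of_bool_def flip: sum.inter_filter)
  also have "\<dots> \<le> deg a" unfolding deg_def by (rule sum_mono) (rule ef)
  finally show ?thesis .
qed

lemma deg_1_single:
  fixes a :: "'v::finite \<Rightarrow>\<^sub>0 int"
  assumes "negs a = {}" "deg a = 1"
  obtains v where "a = Poly_Mapping.single v 1"
proof -
  have nn: "0 \<le> lookup a v" for v using assms(1) by (auto simp: negs_def not_less)
  have "\<exists>v. lookup a v \<noteq> 0"
    using assms(2) unfolding deg_def by (metis sum.neutral zero_neq_one)
  then obtain v where v: "lookup a v \<noteq> 0" by blast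
  have "(\<Sum>w\<in>UNIV. lookup a w) = lookup a v + (\<Sum>w\<in>UNIV - {v}. lookup a w)"
    by (rule sum.remove) auto
  moreover have s: "0 \<le> (\<Sum>w\<in>UNIV - {v}. lookup a w)" by (rule sum_nonneg) (rule nn)
  ultimately have v1: "lookup a v = 1" and "(\<Sum>w\<in>UNIV - {v}. lookup a w) = 0"
    using assms(2) v nn[of v] by (auto simp: deg_def)
  then have "lookup a w = 0" if "w \<noteq> v" for w
    using that nn by (simp add: sum_nonneg_eq_0_iff)
  then have "a = Poly_Mapping.single v 1"
    using v1 by (intro poly_mapping_eqI) (auto simp: lookup_single when_def)
  then show thesis by (rule that)
qed

text \<open>The exponent is that of x_e^2 x_v / x_y. Edges whose product divides it lie in the union
  of \<open>e\<close> and \<open>f\<close>, so each is \<open>e\<close> or \<open>f\<close>;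
  \<open>f\<close> is excluded because its other end does not occur, and taking \<open>e\<close>
  twice fails at \<open>y\<close>.\<close>

lemma gap_no_neighbour:
  assumes gap: "is_gap E e f" and v: "v \<in> f" and y: "y \<noteq> v" and f: "card f = 2"
  shows "{} \<notin> strand2 E (\<lambda>x. 2 * of_bool (x \<in> e) + of_bool (x = v) - of_bool (x = y))"
proof
  assume "{} \<in> strand2 E (\<lambda>x. 2 * of_bool (x \<in> e) + of_bool (x = v) - of_bool (x = y))"
  then obtain g h where gh: "g \<in> E" "h \<in> E"
    and le: "\<And>x. of_bool (x \<in> g) + of_bool (x \<in> h)
      \<le> (2 * of_bool (x \<in> e) + of_bool (x = v) - of_bool (x = y) :: int)"
    unfolding strand2_def by blast
  have "x \<in> e \<union> f" if "x \<in> g \<union> h" for x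
    using le[of x] that v by (auto simp: of_bool_def split: if_splits)
  then have "g \<in> {e, f}" "h \<in> {e, f}" using gap gh unfolding is_gap_def by blast+
  moreover have "g \<noteq> f" "h \<noteq> f"
  proof -
    obtain z where z: "z \<in> f" "z \<noteq> v" using f v by (metis card_2_iff' )
    then have "z \<notin> e" using gap unfolding is_gap_def by blast
    then have "z \<notin> g" "z \<notin> h" using le[of z] z by (auto simp: of_bool_def split: if_splits)
    then show "g \<noteq> f" "h \<noteq> f" using z by auto
  qed
  ultimately have "g = e" "h = e" by auto
  then show False using le[of y] y by (auto simp: of_bool_def split: if_splits)
qed

section \<open>A linear presentation of the square: \<open>im\<close> says that the image of the
  augmentation is the square\<close>

context
  fixes E :: "'v::{finite,linorder} set set"
    and b :: "nat \<Rightarrow> nat" and A :: "nat \<Rightarrow> nat \<Rightarrow> nat \<Rightarrow> ('v, 'k::field) laurent" and d :: int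
  assumes E: "simple_graph E" "E \<noteq> {}"
    and L: "linear_maps 1 b A d"
    and im: "\<And>u. u \<in> immod (b 0) 1 (A 0) {} \<longleftrightarrow>
      (\<forall>a\<in>keys (u 0). {} \<in> strand2 E (lookup a)) \<and> (\<forall>r>0. u r = 0)"
begin

lemma aug_apply: "mat_apply (b 0) 1 (A 0) u = (\<lambda>r. if r = 0 then \<Sum>c<b 0. A 0 0 c * u c else 0)"
  by (auto simp: mat_apply_def fun_eq_iff)

lemma aug_entry:
  assumes "c < b 0" "a \<in> keys (A 0 0 c)"
  shows "{} \<in> strand2 E (lookup a)"
proof -
  let ?u = "\<lambda>k. if k = c then 1 else 0 :: ('v, 'k) laurent"
  have "?u \<in> freemod (b 0) {}" using assms(1) by (auto simp: freemod_def locring_def negs_def)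
  then have "mat_apply (b 0) 1 (A 0) ?u \<in> immod (b 0) 1 (A 0) {}" by (auto simp: immod_def)
  moreover have "mat_apply (b 0) 1 (A 0) ?u 0 = A 0 0 c"
    unfolding aug_apply using assms(1) by (simp add: if_distrib cong: if_cong)
  ultimately show ?thesis using assms(2) unfolding im by metis
qed

lemma square_in_image:
  assumes e: "e \<in> E"
  obtains u where "u \<in> freemod (b 0) {}"
    "Poly_Mapping.single (emb (indic e + indic e)) 1 = (\<Sum>c<b 0. A 0 0 c * u c)"
proof -
  let ?M = "emb (indic e + indic e)"
  let ?w = "\<lambda>r. if r = 0 then Poly_Mapping.single ?M 1 else 0 :: ('v, 'k) laurent"
  have "{} \<in> strand2 E (lookup ?M)"
    unfolding strand2_def using e by (intro CollectI bexI[of _ e]) (auto simp: lookup_add lookup_indic)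
  then have "?w \<in> immod (b 0) 1 (A 0) {}" unfolding im by auto
  then obtain u where u: "u \<in> freemod (b 0) {}" "?w = mat_apply (b 0) 1 (A 0) u"
    by (auto simp: immod_def)
  have "Poly_Mapping.single ?M 1 = (\<Sum>c<b 0. A 0 0 c * u c)"
    using fun_cong[OF u(2), of 0] unfolding aug_apply by simp
  then show thesis using u(1) that by blast
qed

lemma deg_square:
  assumes "e \<in> E"
  shows "deg (emb (indic e + indic e)) = 4"
proof -
  have "deg (emb (indic e)) = (\<Sum>v\<in>UNIV. of_bool (v \<in> e))"
    by (simp add: deg_def lookup_indic)
  also have "\<dots> = int (card e)" by (simp add: of_bool_def flip: sum.inter_filter)
  also have "card e = 2" using E assms by (simp add: simple_graph_def)
  finally show ?thesis by (simp add: emb_add deg_add)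
qed

lemma square_hcomp:
  assumes e: "e \<in> E" and u: "Poly_Mapping.single (emb (indic e + indic e)) 1 = (\<Sum>c<b 0. A 0 0 c * u c)"
  shows "Poly_Mapping.single (emb (indic e + indic e)) 1 = (\<Sum>c<b 0. A 0 0 c * hcomp (4 - d) (u c))"
proof -
  have "hcomp 4 (A 0 0 c * u c) = A 0 0 c * hcomp (4 - d) (u c)" if "c < b 0" for c
    using L that by (intro hcomp_mult) (simp add: linear_maps_def forms_def)
  then have "hcomp 4 (\<Sum>c<b 0. A 0 0 c * u c) = (\<Sum>c<b 0. A 0 0 c * hcomp (4 - d) (u c))"
    by (simp add: hcomp_sum)
  then show ?thesis
    unfolding u[symmetric] by (simp add: hcomp_homogeneous[OF homogeneous_single[OF deg_square[OF e]]])
qed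

text \<open>A generator of degree \<open>d\<close> lies in the square, so \<open>d\<close> is at
  least 4; some generator enters x_e^2 with a nonzero polynomial coefficient of degree
  \<open>4 - d\<close>, so it is at most 4.\<close>

lemma linear_maps_degree: "d = 4"
proof -
  obtain e where e: "e \<in> E" using E by blast
  obtain u where u: "u \<in> freemod (b 0) {}"
    "Poly_Mapping.single (emb (indic e + indic e)) 1 = (\<Sum>c<b 0. A 0 0 c * u c)"
    using square_in_image[OF e] .
  have "(\<Sum>c<b 0. A 0 0 c * hcomp (4 - d) (u c)) \<noteq> 0"
  proof
    assume "(\<Sum>c<b 0. A 0 0 c * hcomp (4 - d) (u c)) = 0"
    then have "Poly_Mapping.single (emb (indic e + indic e)) (1 :: 'k) = 0"
      using square_hcomp[OF e u(2)] by simp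
    then have "lookup (Poly_Mapping.single (emb (indic e + indic e)) (1 :: 'k)) (emb (indic e + indic e)) = 0"
      by simp
    then show False by simp
  qed
  then obtain c where c: "c < b 0" "A 0 0 c * hcomp (4 - d) (u c) \<noteq> 0"
    by (metis (no_types, lifting) lessThan_iff sum.neutral)
  then have nz: "A 0 0 c \<noteq> 0" "hcomp (4 - d) (u c) \<noteq> 0" by auto
  obtain a where a: "a \<in> keys (A 0 0 c)" using nz(1) by (metis in_keys_iff lookup_zero poly_mapping_eqI)
  have "deg a = d" using L c(1) a by (simp add: linear_maps_def forms_def homogeneous_alt)
  moreover have "4 \<le> deg a" using strand2_deg[OF E(1) aug_entry[OF c(1) a]] .
  moreover have "0 \<le> 4 - d"
    using locring_empty_homogeneous_neg[of "hcomp (4 - d) (u c)" "4 - d"] nz(2) u(1)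
    by (force simp: freemod_def hcomp_locring homogeneous_hcomp)
  ultimately show ?thesis by simp
qed

text \<open>As \<open>d\<close> is 4, the coefficients of degree \<open>4 - d\<close> are
  constants.\<close>

lemma square_combination:
  assumes e: "e \<in> E"
  obtains s where "Poly_Mapping.single (emb (indic e + indic e)) 1
    = (\<Sum>c<b 0. A 0 0 c * Poly_Mapping.single 0 (s c))"
proof -
  obtain u where u: "u \<in> freemod (b 0) {}"
    "Poly_Mapping.single (emb (indic e + indic e)) 1 = (\<Sum>c<b 0. A 0 0 c * u c)"
    using square_in_image[OF e] .
  have "hcomp 0 (u c) = Poly_Mapping.single 0 (lookup (hcomp 0 (u c)) 0)" for c
    using u(1) by (intro locring_empty_homogeneous_0 hcomp_locring homogeneous_hcomp) (simp add: freemod_def)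
  then show thesis
    using that[of "\<lambda>c. lookup (hcomp 0 (u c)) 0"] square_hcomp[OF e u(2)]
    by (simp add: linear_maps_degree)
qed

lemma linear_maps_gap_free: "gap_free E"
  unfolding gap_free_def
proof safe
  fix e f assume gap: "is_gap E e f"
  then have ef: "e \<in> E" "f \<in> E" "e \<inter> f = {}" by (auto simp: is_gap_def)
  have card: "card e = 2" "card f = 2" using E ef by (auto simp: simple_graph_def)
  define M where "M = emb (indic e + indic e)"
  define N where "N = emb (indic f + indic f)"
  have "M \<noteq> N"
  proof
    assume "M = N"
    then have "lookup M x = lookup N x" for x by simp
    note MN = this
    have "x \<in> e \<longleftrightarrow> x \<in> f" for x
      using MN[of x] by (cases "x \<in> e"; cases "x \<in> f") (simp_all add: M_def N_def lookup_add lookup_indic)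
    then have "e = f" by blast
    then show False using ef(3) card(1) by auto
  qed
  let ?X = "\<lambda>a. Poly_Mapping.single a 1 :: ('v, 'k) laurent"
  obtain s where s: "?X M = (\<Sum>c<b 0. A 0 0 c * Poly_Mapping.single 0 (s c))"
    using square_combination[OF ef(1)] unfolding M_def .
  obtain t where t: "?X N = (\<Sum>c<b 0. A 0 0 c * Poly_Mapping.single 0 (t c))"
    using square_combination[OF ef(2)] unfolding N_def .
  \<comment> \<open>\<open>p c\<close> is the coefficient of x_e^2 in the generator
    \<open>c\<close>, and \<open>\<theta>\<close> extends it linearly over the Laurent ring to a
    functional on the free module of generators.\<close>
  define p where "p c = lookup (A 0 0 c) M" for c
  define \<theta> where "\<theta> z = (\<Sum>c<b 0. Poly_Mapping.single 0 (p c) * z c)" for z :: "nat \<Rightarrow> ('v, 'k) laurent"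
  have comb: "(\<Sum>c<b 0. p c * x c) = lookup (\<Sum>c<b 0. A 0 0 c * Poly_Mapping.single 0 (x c)) M" for x
  proof -
    have "lookup (A 0 0 c * Poly_Mapping.single 0 (x c)) M = p c * x c" for c
      using lookup_single_mult[of 0 "x c" "A 0 0 c" M] by (simp add: p_def mult.commute)
    then show ?thesis by (simp add: lookup_sum)
  qed
  \<comment> \<open>The Koszul syzygy of x_e^2 and x_f^2, written out in the given generators. The
    functional takes x_f^2 as its value on it, since the combination \<open>s\<close> has
    coefficient 1 at x_e^2 and \<open>t\<close> has 0.\<close>
  define z where "z c = (if c < b 0 then ?X N * Poly_Mapping.single 0 (s c)
      - ?X M * Poly_Mapping.single 0 (t c) else 0)" for c
  have "\<theta> z = ?X N * (\<Sum>c<b 0. Poly_Mapping.single 0 (p c * s c))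
      - ?X M * (\<Sum>c<b 0. Poly_Mapping.single 0 (p c * t c))"
    by (simp add: \<theta>_def z_def sum_distrib_left sum_subtractf right_diff_distrib mult_single)
  also have "(\<Sum>c<b 0. Poly_Mapping.single 0 (p c * s c)) = (Poly_Mapping.single 0 1 :: ('v, 'k) laurent)"
  proof -
    have "(\<Sum>c<b 0. Poly_Mapping.single 0 (p c * s c))
        = (Poly_Mapping.single 0 (\<Sum>c<b 0. p c * s c) :: ('v, 'k) laurent)"
      by (rule single_sum[symmetric])
    then show ?thesis unfolding comb s[symmetric] by simp
  qed
  also have "(\<Sum>c<b 0. Poly_Mapping.single 0 (p c * t c)) = (0 :: ('v, 'k) laurent)"
  proof -
    have "(\<Sum>c<b 0. Poly_Mapping.single 0 (p c * t c))
        = (Poly_Mapping.single 0 (\<Sum>c<b 0. p c * t c) :: ('v, 'k) laurent)"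
      by (rule single_sum[symmetric])
    then show ?thesis unfolding comb t[symmetric] using \<open>M \<noteq> N\<close> by (simp add: lookup_single when_def)
  qed
  finally have \<theta>z: "\<theta> z = ?X N" by (simp add: mult_single)
  have "z \<in> kermod (b 0) 1 (A 0) {}"
  proof -
    have "negs M = {}" "negs N = {}" by (simp_all add: M_def N_def)
    then have "z \<in> freemod (b 0) {}"
      by (auto simp: freemod_def z_def negs_def mult_single intro!: locring_minus locring_single)
    moreover have "(\<Sum>c<b 0. A 0 0 c * z c) = 0"
    proof -
      have "(\<Sum>c<b 0. A 0 0 c * z c) = ?X N * (\<Sum>c<b 0. A 0 0 c * Poly_Mapping.single 0 (s c))
          - ?X M * (\<Sum>c<b 0. A 0 0 c * Poly_Mapping.single 0 (t c))"
        unfolding sum_distrib_left sum_subtractf[symmetric]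
        by (intro sum.cong refl)
          (simp add: z_def right_diff_distrib mult.left_commute[of "A 0 0 _" "?X N"]
            mult.left_commute[of "A 0 0 _" "?X M"])
      also have "\<dots> = 0" unfolding s[symmetric] t[symmetric] by (simp add: mult.commute)
      finally show ?thesis .
    qed
    ultimately show ?thesis unfolding kermod_def aug_apply by (simp add: fun_eq_iff)
  qed
  also have ker: "kermod (b 0) 1 (A 0) {} = immod (b 1) (b 0) (A 1) {}"
    using L by (simp add: linear_maps_def)
  finally obtain w where w: "w \<in> freemod (b 1) {}" "z = mat_apply (b 1) (b 0) (A 1) w"
    by (auto simp: immod_def)
  \<comment> \<open>The value of the functional on the linear syzygy \<open>k\<close>, which is a
    linear form.\<close>
  define \<theta>1 where "\<theta>1 k = (\<Sum>c<b 0. Poly_Mapping.single 0 (p c) * A 1 c k)" for k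
  have "\<theta> z = (\<Sum>k<b 1. \<theta>1 k * w k)"
  proof -
    have "\<theta> z = (\<Sum>c<b 0. \<Sum>k<b 1. Poly_Mapping.single 0 (p c) * A 1 c k * w k)"
      unfolding \<theta>_def
    proof (rule sum.cong[OF refl])
      fix c assume "c \<in> {..<b 0}"
      then have "z c = (\<Sum>k<b 1. A 1 c k * w k)" unfolding w(2) by (simp add: mat_apply_def)
      then show "Poly_Mapping.single 0 (p c) * z c = (\<Sum>k<b 1. Poly_Mapping.single 0 (p c) * A 1 c k * w k)"
        by (simp only: sum_distrib_left mult.assoc)
    qed
    also have "\<dots> = (\<Sum>k<b 1. \<Sum>c<b 0. Poly_Mapping.single 0 (p c) * A 1 c k * w k)"
      by (rule sum.swap)
    finally show ?thesis unfolding \<theta>1_def sum_distrib_right .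
  qed
  \<comment> \<open>The monomial x_f^2 has to arise from some linear syzygy, so some
    \<open>\<theta>1 k\<close> contains a variable x_v that divides it. The rest shows that no
    variable of \<open>f\<close> occurs in \<open>\<theta>1 k\<close>.\<close>
  then have "(\<Sum>k<b 1. lookup (\<theta>1 k * w k) N) = 1"
    using \<theta>z by (metis lookup_single_eq lookup_sum)
  then obtain k where k: "k < b 1" "lookup (\<theta>1 k * w k) N \<noteq> 0"
    by (metis (no_types, lifting) lessThan_iff sum.neutral zero_neq_one)
  then have "N \<in> keys (\<theta>1 k * w k)" by (simp add: in_keys_iff)
  then obtain a a' where a: "N = a + a'" "a \<in> keys (\<theta>1 k)" "a' \<in> keys (w k)"
    using keys_mult[of "\<theta>1 k" "w k"] by blast
  have A1: "A 1 c k \<in> locring {}" "homogeneous 1 (A 1 c k)" if "c < b 0" for c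
    using L that k(1) by (simp_all add: linear_maps_def forms_def)
  have \<theta>1: "\<theta>1 k \<in> locring {}" "homogeneous 1 (\<theta>1 k)"
  proof -
    show "\<theta>1 k \<in> locring {}"
      unfolding \<theta>1_def by (intro locring_sum locring_mult locring_single A1) (auto simp: negs_def)
    have "homogeneous (0 + 1) (Poly_Mapping.single 0 (p c) * A 1 c k)" if "c < b 0" for c
      by (rule homogeneous_mult[OF homogeneous_single A1(2)[OF that]]) simp
    then show "homogeneous 1 (\<theta>1 k)"
      unfolding \<theta>1_def by (intro homogeneous_sum) simp
  qed
  have "negs a = {}" "deg a = 1"
    using \<theta>1 a(2) by (auto simp: locring_def homogeneous_alt)
  then obtain v where av: "a = Poly_Mapping.single v 1" by (rule deg_1_single)
  have "v \<in> f"
  proof (rule ccontr)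
    assume "v \<notin> f"
    have "0 \<le> lookup a' v" using w(1) a(3) by (force simp: freemod_def locring_def negs_def not_less)
    then have "0 < lookup N v" unfolding a(1) av by (simp add: lookup_add)
    then show False using \<open>v \<notin> f\<close> by (simp add: N_def lookup_add lookup_indic)
  qed
  \<comment> \<open>In the coefficient of x_e^2 x_v, a term x_y of the syzygy with y different from
    v meets the coefficient of x_e^2 x_v / x_y in a generator. That monomial is outside the
    square.\<close>
  have others: "lookup (A 0 0 c) (M + a - a2) = 0"
    if c: "c < b 0" and a2: "a2 \<in> keys (A 1 c k)" "a2 \<noteq> a" for c a2
  proof (rule ccontr)
    assume "lookup (A 0 0 c) (M + a - a2) \<noteq> 0"
    then have St: "{} \<in> strand2 E (lookup (M + a - a2))"
      by (intro aug_entry[OF c]) (simp add: in_keys_iff)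
    have "negs a2 = {}" "deg a2 = 1"
      using A1[OF c] a2(1) by (auto simp: locring_def homogeneous_alt)
    then obtain y where y: "a2 = Poly_Mapping.single y 1" by (rule deg_1_single)
    have "y \<noteq> v" using a2(2) y av by auto
    moreover have "lookup (M + a - a2)
        = (\<lambda>x. 2 * of_bool (x \<in> e) + of_bool (x = v) - of_bool (x = y))"
      by (auto simp: fun_eq_iff M_def av y lookup_add lookup_minus lookup_indic lookup_single when_def)
    ultimately show False using gap_no_neighbour[OF gap \<open>v \<in> f\<close> _ card(2)] St by metis
  qed
  have col: "(\<Sum>c<b 0. A 1 c k * A 0 0 c) = 0"
  proof -
    let ?u = "\<lambda>l. if l = k then 1 else 0 :: ('v, 'k) laurent"
    have "?u \<in> freemod (b 1) {}" using k(1) by (auto simp: freemod_def locring_def negs_def)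
    then have "mat_apply (b 1) (b 0) (A 1) ?u \<in> kermod (b 0) 1 (A 0) {}"
      unfolding ker by (auto simp: immod_def)
    then have "(\<Sum>c<b 0. A 0 0 c * mat_apply (b 1) (b 0) (A 1) ?u c) = 0"
      unfolding kermod_def aug_apply by (auto dest: fun_cong[of _ _ 0])
    moreover have "mat_apply (b 1) (b 0) (A 1) ?u c = A 1 c k" if "c < b 0" for c
      using that k(1) by (simp add: mat_apply_def if_distrib cong: if_cong)
    ultimately show ?thesis by (simp add: mult.commute)
  qed
  \<comment> \<open>Hence the coefficient of x_e^2 x_v in the syzygy relation is exactly the
    coefficient of x_v in \<open>\<theta>1 k\<close>, which must therefore be 0.\<close>
  have "0 = lookup (\<Sum>c<b 0. A 1 c k * A 0 0 c) (M + a)" unfolding col by simp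
  also have "\<dots> = (\<Sum>c<b 0. lookup (A 1 c k) a * p c)"
    unfolding lookup_sum
  proof (rule sum.cong[OF refl])
    fix c assume c: "c \<in> {..<b 0}"
    have "lookup (A 1 c k * A 0 0 c) (M + a)
        = (\<Sum>a2\<in>keys (A 1 c k). if a2 = a then lookup (A 1 c k) a * p c else 0)"
      unfolding lookup_mult_group using others c by (intro sum.cong) (auto simp: p_def)
    then show "lookup (A 1 c k * A 0 0 c) (M + a) = lookup (A 1 c k) a * p c"
      by (simp add: in_keys_iff)
  qed
  also have "\<dots> = lookup (\<theta>1 k) a"
  proof -
    have "lookup (Poly_Mapping.single 0 (p c) * A 1 c k) a = p c * lookup (A 1 c k) a" for c
      using lookup_single_mult[of 0 "p c" "A 1 c k" a] by simp
    then show ?thesis by (simp add: \<theta>1_def lookup_sum mult.commute)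
  qed
  finally show False using a(2) by (simp add: in_keys_iff)
qed

end

subsection \<open>Regularity\<close>

text \<open>\<open>GREATEST\<close> has a meaning only if a maximum exists; a witness and an upper
  bound provide one on the integers.\<close>

lemma Greatest_int_le_iff:
  fixes P :: "int \<Rightarrow> bool"
  assumes ex: "P x0" and bd: "\<And>x. P x \<Longrightarrow> x \<le> B"
  shows "(GREATEST x. P x) \<le> n \<longleftrightarrow> (\<forall>x. P x \<longrightarrow> x \<le> n)"
proof -
  have fin: "finite {x. P x \<and> x0 \<le> x}"
    by (rule finite_subset[of _ "{x0..B}"]) (auto simp: bd)
  define m where "m = Max {x. P x \<and> x0 \<le> x}"
  have "m \<in> {x. P x \<and> x0 \<le> x}" unfolding m_def by (rule Max_in[OF fin]) (use ex in auto)
  moreover have "x \<le> m" if "P x" for x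
  proof (cases "x0 \<le> x")
    case True
    then show ?thesis unfolding m_def using that fin by (intro Max_ge) auto
  next
    case False
    then show ?thesis using calculation by auto
  qed
  ultimately have "(GREATEST x. P x) = m" by (intro Greatest_equality) auto
  then show ?thesis using \<open>m \<in> _\<close> \<open>\<And>x. P x \<Longrightarrow> x \<le> m\<close> by force
qed

lemma regularity_edge_ideal_le_iff:
  fixes E :: "'v::{finite,linorder} set set"
  assumes E: "simple_graph E" "E \<noteq> {}"
  shows "regularity (edge_ideal E :: ('v, 'k::field) mpol set) \<le> n \<longleftrightarrow>
    (\<forall>i j. n < i + j \<longrightarrow>
      vanish (monomial_ideal.lifted (\<lambda>a. strand1 E (lookup a)) :: 'v set \<Rightarrow> (nat \<Rightarrow> ('v, 'k) laurent) set) i j)"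
proof -
  let ?I = "edge_ideal E :: ('v, 'k) mpol set"
  interpret I: monomial_ideal ?I "\<lambda>a. strand1 E (lookup a)"
    by (rule monomial_ideal_edge_ideal[OF E(1)])
  interpret IL: locmod I.lifted by (rule I.locmod_lifted)
  let ?n = "int (card (UNIV :: 'v set))"
  let ?P = "\<lambda>r. \<exists>i j. r = i + j \<and> local_cohomology ?I i j \<noteq> {coboundaries ?I i j}"
  \<comment> \<open>At the exponent with all entries -1 the strand is the single set
    \<open>UNIV\<close>, whose top cochain has nothing to bound it. So H^n in degree -n is nonzero,
    which is the witness for the maximum.\<close>
  define a0 :: "'v \<Rightarrow>\<^sub>0 int" where "a0 = (\<Sum>v\<in>UNIV. Poly_Mapping.single v (- 1))"
  have a0: "lookup a0 v = - 1" for v by (simp add: a0_def lookup_sum_single)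
  have U: "strand1 E (lookup a0) = {UNIV}"
  proof -
    have "strand1 E (lookup a0) = {F. {v. lookup a0 v < 0} \<subseteq> F \<and> (\<exists>e\<in>E. e \<subseteq> F)}"
      by (rule strand1_neg) (simp add: a0)
    then show ?thesis using E(2) by (auto simp: a0 top.extremum_unique)
  qed
  have "?P (?n + deg a0)"
  proof (intro exI conjI notI)
    assume "local_cohomology ?I ?n (deg a0) = {coboundaries ?I ?n (deg a0)}"
    then have v: "vanish I.lifted ?n (deg a0)" by (simp add: I.local_cohomology_zero_iff)
    have ac: "acyclic_at TYPE('k) {UNIV :: 'v set} ?n"
      using v U unfolding I.vanish_lifted_strands by metis
    let ?c = "\<lambda>F. if F = UNIV then 1 else 0 :: 'k"
    have cd: "cdiff ?c F = 0" for F :: "'v set" unfolding cdiff_def by (rule sum.neutral) auto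
    have cc: "cochain {UNIV :: 'v set} ?n ?c" by (auto simp: cochain_def)
    obtain b where b: "cochain {UNIV :: 'v set} (?n - 1) b" "\<And>F. cdiff b F = ?c F"
      by (rule acyclic_atE[OF ac cc cd]) blast
    have "b = (\<lambda>_. 0)" using b(1) by (auto simp: cochain_def fun_eq_iff)
    then show False using b(2)[of UNIV] by simp
  qed simp
  \<comment> \<open>For the upper bound, i is at most n by the length of the Cech complex, and j is
    at most 0 because an exponent of positive degree has a positive entry, which is an apex.\<close>
  moreover have "r \<le> ?n" if r: "?P r" for r
  proof -
    obtain i j where ij: "r = i + j" "\<not> vanish I.lifted i j"
      using r unfolding I.local_cohomology_zero_iff by blast
    have "i \<le> ?n"
    proof (rule ccontr)
      assume "\<not> i \<le> ?n"
      then have "vanish I.lifted i j" using IL.zero by (intro vanish_large) auto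
      then show False using ij by simp
    qed
    moreover have "j \<le> 0"
    proof (rule ccontr)
      assume j: "\<not> j \<le> 0"
      have "vanish I.lifted i j"
        unfolding I.vanish_lifted_strands
      proof (intro allI impI)
        fix a :: "'v \<Rightarrow>\<^sub>0 int" assume "deg a = j"
        then have "\<exists>u. 0 < lookup a u"
          using j sum_nonpos[of UNIV "lookup a"] unfolding deg_def by (metis not_less)
        then obtain u where u: "0 < lookup a u" ..
        then show "acyclic_at TYPE('k) (strand1 E (lookup a)) i" by (rule strand1_acyclic_pos)
      qed
      then show False using ij by simp
    qed
    ultimately show ?thesis using ij by simp
  qed
  ultimately have "regularity ?I \<le> n \<longleftrightarrow> (\<forall>r. ?P r \<longrightarrow> r \<le> n)"
    unfolding regularity_def by (rule Greatest_int_le_iff)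
  also have "\<dots> \<longleftrightarrow> (\<forall>i j. n < i + j \<longrightarrow> vanish I.lifted i j)"
    unfolding I.local_cohomology_zero_iff by (metis linorder_not_le)
  finally show ?thesis .
qed

section \<open>Both directions of the equivalence, through the vanishing for the square from total
  degree 5 on\<close>

lemma ex_exponent:
  fixes h :: "'v::finite \<Rightarrow> int"
  obtains a where "lookup a = h" "deg a = (\<Sum>v\<in>UNIV. h v)"
  by (rule that[of "Poly_Mapping.Abs_poly_mapping h"]) (simp_all add: deg_def)

theorem theorem1p1:
  fixes E :: "'v::{finite,linorder} set set"
  assumes "simple_graph E" and "E \<noteq> {}"
  shows "has_linear_resolution (ideal_power (edge_ideal E :: ('v, 'k::field) mpol set) 2)
     \<longleftrightarrow> gap_free E \<and> regularity (edge_ideal E :: ('v, 'k) mpol set) \<le> 3"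
proof -
  let ?I = "edge_ideal E :: ('v, 'k) mpol set"
  let ?I2 = "ideal_power ?I 2"
  interpret I: monomial_ideal ?I "\<lambda>a. strand1 E (lookup a)"
    by (rule monomial_ideal_edge_ideal[OF assms(1)])
  interpret I2: monomial_ideal ?I2 "\<lambda>a. strand2 E (lookup a)"
    by (rule monomial_ideal_edge_ideal_power2[OF assms(1)])
  have reg: "regularity ?I \<le> 3 \<longleftrightarrow> (\<forall>i j. 4 \<le> i + j \<longrightarrow> vanish I.lifted i j)"
  proof -
    have "(4 :: int) \<le> k \<longleftrightarrow> 3 < k" for k by auto
    then show ?thesis unfolding regularity_edge_ideal_le_iff[OF assms] by simp
  qed
  note lift1 = I.vanish_lifted_strands and lift2 = I2.vanish_lifted_strands
  show ?thesis
  proof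
    assume "has_linear_resolution ?I2"
    then obtain d \<beta> \<epsilon> \<phi> where "graded_free_resolution ?I2 \<beta> (\<lambda>i c. d + int i) \<epsilon> \<phi>"
      unfolding has_linear_resolution_def by blast
    then obtain A where L: "linear_maps 1 \<beta> A d" and im: "immod (\<beta> 0) 1 (A 0) {} = I2.lifted {}"
      unfolding resolution_iff I2.lifted_empty[symmetric] by (metis (mono_tags, lifting) old.nat.simps(4))
    have im': "u \<in> immod (\<beta> 0) 1 (A 0) {} \<longleftrightarrow>
      (\<forall>a\<in>keys (u 0). {} \<in> strand2 E (lookup a)) \<and> (\<forall>r>0. u r = 0)" for u
      unfolding im by (simp add: I2.lifted_iff I2.localisation_eq)
    have d: "d = 4" by (rule linear_maps_degree[OF assms L im'])
    \<comment> \<open>The resolution gives the image over the polynomial ring only; denominators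
      carry the equality to the localisations that enter the Cech complex.\<close>
    have "immod (\<beta> 0) 1 (A 0) F = I2.lifted F" for F
      using has_denoms_subset[OF has_denoms_immod I2.locmod_lifted, of "\<beta> 0" 1 "A 0" F]
        has_denoms_subset[OF I2.has_denoms_lifted locmod_immod, of "\<beta> 0" 1 "A 0" F] im by blast
    then have imF: "immod (\<beta> 0) 1 (A 0) = I2.lifted" by blast
    have v2: "vanish I2.lifted i j" if "5 \<le> i + j" for i j
      using linear_maps_vanish[OF L, of i j] that unfolding imF d by simp
    have "acyclic_at TYPE('k) (strand2 E h) i" if "5 \<le> i + (\<Sum>v\<in>UNIV. h v)" for h i
    proof -
      obtain a where "lookup a = h" "deg a = (\<Sum>v\<in>UNIV. h v)" by (rule ex_exponent)
      then show ?thesis using v2[OF that] unfolding lift2 by metis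
    qed
    then have "acyclic_at TYPE('k) (strand1 E h) i" if "4 \<le> i + (\<Sum>v\<in>UNIV. h v)" for h i
      by (rule strand1_acyclic[OF assms(1) _ that])
    then have "regularity ?I \<le> 3" unfolding reg lift1 by (auto simp: deg_def)
    moreover have "gap_free E" by (rule linear_maps_gap_free[OF assms L im'])
    ultimately show "gap_free E \<and> regularity ?I \<le> 3" by simp
  next
    assume "gap_free E \<and> regularity ?I \<le> 3"
    then have gf: "gap_free E" and v1: "\<And>i j. 4 \<le> i + j \<Longrightarrow> vanish I.lifted i j"
      unfolding reg by blast+
    have "acyclic_at TYPE('k) (strand1 E h) i" if "4 \<le> i + (\<Sum>v\<in>UNIV. h v)" for h i
    proof -
      obtain a where "lookup a = h" "deg a = (\<Sum>v\<in>UNIV. h v)" by (rule ex_exponent)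
      then show ?thesis using v1[OF that] unfolding lift1 by metis
    qed
    then have "acyclic_at TYPE('k) (strand2 E h) i" if "5 \<le> i + (\<Sum>v\<in>UNIV. h v)" for h i
      by (rule strand2_acyclic[OF assms(1) gf _ that])
    then have v2: "vanish I2.lifted i j" if "4 + 1 \<le> i + j" for i j
      using that unfolding lift2 by (auto simp: deg_def)
    \<comment> \<open>A product of two edges has degree 4, so a cover by elements of degree 4 misses
      nothing of lower degree.\<close>
    have low: "u = (\<lambda>_. 0)"
      if u: "u \<in> I2.lifted {}" and hom: "\<And>r. homogeneous j (u r)" and j: "j < 4" for u j
    proof
      fix r
      have "a \<notin> keys (u r)" for a
      proof
        assume a: "a \<in> keys (u r)"
        then have "r = 0" using u by (cases "r = 0") (auto simp: I2.lifted_iff)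
        then have "4 \<le> deg a"
          using strand2_deg[OF assms(1), of a] u a by (auto simp: I2.lifted_iff I2.localisation_eq)
        moreover have "deg a = j" using hom[of r] a by (simp add: homogeneous_alt)
        ultimately show False using j by simp
      qed
      then show "u r = 0" by (intro poly_mapping_eqI) (simp add: in_keys_iff)
    qed
    have "\<exists>b A. linear_maps 1 b A 4 \<and> immod (b 0) 1 (A 0) = I2.lifted"
      by (rule exists_linear_maps[OF I2.locmod_lifted I2.has_denoms_lifted I2.lifted_freemod])
         (fact I2.hcomp_lifted, fact v2, rule low)
    then obtain b A where "linear_maps 1 b A 4" "immod (b 0) 1 (A 0) = I2.lifted" by blast
    then show "has_linear_resolution ?I2"
      by (intro linear_resolution_of_linear_maps[of b A 4]) (simp_all add: I2.lifted_empty)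
  qed
qed

end
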